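(* For every real number $a>0$, $$\pi^3\, m\big((1+v)(1+w)(1+x)+a(1-v)(1-w)(1-x)y\big)=4\pi\,\mathcal{L}^a_3(1)-2\pi\,\mathcal{L}^a_{2:1}(1)-2i\big(\mathcal{L}^a_{2,2}(i,1)+\mathcal{L}^a_{2,1:1}(i,1)\big),$$ where the polynomial is in the four variables $v,w,x,y$.
   Context: The (logarithmic) Mahler measure of a nonzero polynomial $P\in\mathbb{C}[x_1,\dots,x_n]$ is $m(P)=\frac{1}{(2\pi i)^n}\int_{\mathbb{T}^n}\log|P(x_1,\dots,x_n)|\,\frac{dx_1}{x_1}\cdots\frac{dx_n}{x_n}$, with $\mathbb{T}^n=\{|x_1|=\dots=|x_n|=1\}$. Multiple polylogarithms: $\mathrm{Li}_{n_1,\dots,n_m}(x_1,\dots,x_m)=\sum_{0<k_1<\dots<k_m}\frac{x_1^{k_1}\cdots x_m^{k_m}}{k_1^{n_1}\cdots k_m^{n_m}}$ for $|x_i|<1$, extended by analytic continuation through $$\mathrm{Li}_{n_1,\dots,n_m}(x_1,\dots,x_m)=(-1)^m\,\mathrm{I}_{n_1,\dots,n_m}\big((x_1\cdots x_m)^{-1}:(x_2\cdots x_m)^{-1}:\dots:x_m^{-1}:1\big),$$ where $\mathrm{I}_{n_1,\dots,n_m}(a_1:\dots:a_m:1)$ is the iterated integral from $0$ to $1$ of the sequence of forms $\frac{dt}{t-a_1},\underbrace{\tfrac{dt}{t},\dots,\tfrac{dt}{t}}_{n_1-1},\frac{dt}{t-a_2},\underbrace{\tfrac{dt}{t},\dots,\tfrac{dt}{t}}_{n_2-1},\dots,\frac{dt}{t-a_m},\underbrace{\tfrac{dt}{t},\dots,\tfrac{dt}{t}}_{n_m-1}$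 over $t_1\le t_2\le\dots$ (first form in the innermost variable $t_1$). The integrals are along the real segment $[0,1]$ when no $a_i$ lies in $(0,1)$; when a singularity lies in $(0,1)$, all the integrals are taken along the path $\gamma(\theta)=\frac{e^{i\theta}+1}{2}$, $-\pi\le\theta\le0$, from $0$ to $1$. For real $a>0$ and complex $x,y$: $\mathcal{L}^a_r(x):=\mathrm{Li}_r(xa)-\mathrm{Li}_r(-xa)$; $\ \mathcal{L}^a_{r:1}(x):=\log a\,\big(\mathrm{Li}_r(xa)-\mathrm{Li}_r(-xa)\big)$. Writing $S_{r,s}(b;x,y):=\mathrm{Li}_{r,s}(bx,y/b)-\mathrm{Li}_{r,s}(-bx,y/b)+\mathrm{Li}_{r,s}(bx,-y/b)-\mathrm{Li}_{r,s}(-bx,-y/b)$, $$\mathcal{L}^a_{r,s}(x,y):=S_{r,s}(a;x,y)+S_{r,s}(1/a;x,y),\qquad \mathcal{L}^a_{r,s:1}(x,y):=\log(a)\,S_{r,s}(a;x,y)+\log(1/a)\,S_{r,s}(1/a;x,y).$$ For $a=1$ the terms with factor $\log 1=0$ are read as $0$. *)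

theory Defs
  imports
    "HOL-Complex_Analysis.Complex_Analysis"
    "HOL-Library.Poly_Mapping"
begin

section \<open>Multivariate polynomials and the Mahler measure\<close>

text \<open>
  A monomial maps each variable (a natural number) to its exponent, and a polynomial maps each
  monomial to its coefficient. Sum and product are those of the convolution ring of
  \<^theory>\<open>HOL-Library.Poly_Mapping\<close>. The polynomials in n variables are those
  whose variables are numbered below n.
\<close>

type_synonym cmpoly = "(nat \<Rightarrow>\<^sub>0 nat) \<Rightarrow>\<^sub>0 complex"

definition Var :: "nat \<Rightarrow> cmpoly"
  where "Var i = Poly_Mapping.single (Poly_Mapping.single i 1) 1"

definition Const :: "complex \<Rightarrow> cmpoly"
  where "Const c = Poly_Mapping.single 0 c"

definition mpoly_eval :: "cmpoly \<Rightarrow> (nat \<Rightarrow> complex) \<Rightarrow> complex"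
  where "mpoly_eval P z =
    (\<Sum>m\<in>Poly_Mapping.keys P. Poly_Mapping.lookup P m *
      (\<Prod>i\<in>Poly_Mapping.keys m. z i ^ Poly_Mapping.lookup m i))"

text \<open>
  The torus is parametrised by \<open>x\<^sub>j = exp (\<i> \<theta>\<^sub>j)\<close> with \<open>\<theta>\<^sub>j\<close> between 0 and \<open>2 \<pi>\<close>, so that
  \<open>dx\<^sub>j / (2 \<pi> \<i> x\<^sub>j) = d\<theta>\<^sub>j / (2 \<pi>)\<close>. The value \<open>ln 0 = 0\<close> is harmless, as the zero set of a
  nonzero polynomial is a null set of the torus.
\<close>

definition mahler_measure :: "nat \<Rightarrow> cmpoly \<Rightarrow> real"
  where "mahler_measure n P =
    1 / (2 * pi) ^ n *
    set_lebesgue_integral (Pi\<^sub>M {..<n} (\<lambda>_. lborel)) (PiE {..<n} (\<lambda>_. {0..2 * pi}))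
      (\<lambda>\<theta>. ln (norm (mpoly_eval P (\<lambda>j. cis (\<theta> j)))))"


section \<open>Iterated integrals\<close>

text \<open>
  For a path \<open>\<gamma>\<close> on [0,1], the following function integrates the forms \<open>dt / (t - b)\<close> along the
  initial piece of \<open>\<gamma>\<close> up to parameter s. The poles b are listed with the outermost variable
  first, whence the reversal in the definition of \<open>iterated_integral\<close>, which
  lists them with the innermost variable first.
\<close>

primrec iterated_integral_upto :: "(real \<Rightarrow> complex) \<Rightarrow> complex list \<Rightarrow> real \<Rightarrow> complex"
  where
    "iterated_integral_upto \<gamma> [] s = 1"
  | "iterated_integral_upto \<gamma> (b # bs) s =
       integral {0..s} (\<lambda>u. vector_derivative \<gamma> (at u within {0..1}) / (\<gamma> u - b) *
         iterated_integral_upto \<gamma> bs u)"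

definition iterated_integral :: "(real \<Rightarrow> complex) \<Rightarrow> complex list \<Rightarrow> complex"
  where "iterated_integral \<gamma> as = iterated_integral_upto \<gamma> (rev as) 1"

text \<open>
  The arc is \<open>\<gamma>(\<theta>) = (exp (\<i> \<theta>) + 1) / 2\<close> with \<open>\<theta>\<close> running from \<open>-\<pi>\<close> to 0, rescaled to [0,1].
\<close>

definition integration_path :: "complex list \<Rightarrow> real \<Rightarrow> complex"
  where "integration_path as =
    (if \<exists>a\<in>set as. a \<in> complex_of_real ` {0<..<1}
     then part_circlepath (1 / 2) (1 / 2) (- pi) 0
     else linepath 0 1)"

definition polylog_forms :: "nat list \<Rightarrow> complex list \<Rightarrow> complex list"
  where "polylog_forms ns as = concat (map2 (\<lambda>n a. a # replicate (n - 1) 0) ns as)"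

text \<open>\<open>hyperlog ns as\<close> is \<open>I\<^bsub>ns\<^esub>(as : 1)\<close>.\<close>

definition hyperlog :: "nat list \<Rightarrow> complex list \<Rightarrow> complex"
  where "hyperlog ns as = iterated_integral (integration_path as) (polylog_forms ns as)"


section \<open>Multiple polylogarithms\<close>

definition multi_polylog_series :: "nat list \<Rightarrow> complex list \<Rightarrow> complex"
  where "multi_polylog_series ns xs =
    (\<Sum>\<^sub>\<infinity>ks\<in>{ks. length ks = length ns \<and> sorted_wrt (<) (0 # ks)}.
       (\<Prod>i<length ns. xs ! i ^ (ks ! i) / of_nat (ks ! i) ^ (ns ! i)))"

text \<open>
  Entry i of the list passed to \<open>hyperlog\<close> is the inverse of the product of all arguments from
  position i on.
\<close>

definition multi_polylog :: "nat list \<Rightarrow> complex list \<Rightarrow> complex"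
  where "multi_polylog ns xs =
    (if \<forall>x\<in>set xs. norm x < 1 then multi_polylog_series ns xs
     else (- 1) ^ length ns *
       hyperlog ns (map (\<lambda>i. inverse (prod_list (drop i xs))) [0..<length xs]))"


section \<open>The combinations of polylogarithms\<close>

definition L1 :: "real \<Rightarrow> nat \<Rightarrow> complex \<Rightarrow> complex"
  where "L1 a r x =
    multi_polylog [r] [x * of_real a] - multi_polylog [r] [- x * of_real a]"

definition L1_log :: "real \<Rightarrow> nat \<Rightarrow> complex \<Rightarrow> complex"
  where "L1_log a r x =
    of_real (ln a) *
      (multi_polylog [r] [x * of_real a] - multi_polylog [r] [- x * of_real a])"

definition S2 :: "nat \<Rightarrow> nat \<Rightarrow> real \<Rightarrow> complex \<Rightarrow> complex \<Rightarrow> complex"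
  where "S2 r s b x y =
      multi_polylog [r, s] [of_real b * x, y / of_real b]
    - multi_polylog [r, s] [- of_real b * x, y / of_real b]
    + multi_polylog [r, s] [of_real b * x, - y / of_real b]
    - multi_polylog [r, s] [- of_real b * x, - y / of_real b]"

definition L2 :: "real \<Rightarrow> nat \<Rightarrow> nat \<Rightarrow> complex \<Rightarrow> complex \<Rightarrow> complex"
  where "L2 a r s x y = S2 r s a x y + S2 r s (1 / a) x y"

text \<open>
  For \<open>a = 1\<close> both logarithmic factors are \<open>ln 1 = 0\<close>, so the value is 0 whatever the values of
  the possibly divergent integrals are; likewise for \<open>L1_log\<close>.
\<close>

definition L2_log :: "real \<Rightarrow> nat \<Rightarrow> nat \<Rightarrow> complex \<Rightarrow> complex \<Rightarrow> complex"
  where "L2_log a r s x y =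
    of_real (ln a) * S2 r s a x y + of_real (ln (1 / a)) * S2 r s (1 / a) x y"

end

theory Submission
  imports Defs "HOL-Real_Asymp.Real_Asymp"
begin

text \<open>
  The polynomial is \<open>A + B y\<close> with \<open>A = (1+v)(1+w)(1+x)\<close> and \<open>B = a(1-v)(1-w)(1-x)\<close>. By Jensen's
  formula (\<open>jensen_affine\<close>) the mean of \<open>ln \<bar>A + B y\<bar>\<close> over y is
  \<open>ln \<bar>A\<bar> + log\<^sup>+ \<bar>B/A\<bar>\<close>; the mean of \<open>ln \<bar>A\<bar>\<close> vanishes, and
  \<open>\<bar>1 - e\<^sup>i\<^sup>\<theta>\<bar> / \<bar>1 + e\<^sup>i\<^sup>\<theta>\<bar> = \<bar>tan (\<theta>/2)\<bar>\<close> has the density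
  \<open>(2/\<pi>) / (1 + t\<^sup>2)\<close> for uniform \<open>\<theta>\<close>. Hence \<open>\<pi>\<^sup>3 m\<close> is 8 times the integral of
  \<open>log\<^sup>+ (a r s t)\<close> against three such weights \<open>1 / (1 + t\<^sup>2)\<close>. One of the three integrations
  produces the inverse tangent integral \<open>Ti2 y\<close>, the integral of \<open>arctan u / u\<close> from 0 to y
  (\<open>cauchy_log_plus\<close>), and the product of the two other variables has the weight
  \<open>ln z / (z\<^sup>2 - 1)\<close> (\<open>cauchy_double\<close>). With
  \<open>K\<^sub>b(t) = (ln t - ln b) / (t\<^sup>2 - b\<^sup>2)\<close>, this says that \<open>\<pi>\<^sup>3 m\<close> is \<open>8 a\<close> times the integral
  of \<open>Ti2 \<cdot> K\<^sub>a\<close> over the positive half-line. Folding the half-line at 1 with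
  \<open>Ti2 (1/u) = Ti2 u - (\<pi>/2) ln u\<close> leaves integrals over [0,1] of \<open>Ti2 \<cdot> K\<^sub>a\<close>,
  \<open>Ti2 \<cdot> K\<^bsub>1/a\<^esub>\<close> and \<open>- ln \<cdot> K\<^bsub>1/a\<^esub>\<close> (\<open>Ti2_log_kernel_nn_integral\<close>).

  The right-hand side reduces to the same three integrals. Integrating by parts against the
  outermost forms \<open>dt/t\<close> turns every iterated integral into a single integral of a power of
  \<open>ln t\<close> times \<open>dt / (t - b)\<close> times a remaining inner integral. The companion terms with a
  factor \<open>ln b\<close> are exactly those for which the numerator becomes divisible by
  \<open>ln t - ln b\<close>, which vanishes at the pole b. So the combined integrand is continuous at b,
  Cauchy's theorem moves the semicircle back to [0,1]
  (\<open>hyperlog_depth_two\<close>, \<open>hyperlog_depth_one\<close>), and the sums over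
  signs add up to real integrals (\<open>depth_two_real\<close>, \<open>depth_one_real\<close>).
\<close>

section \<open>Integration by parts against logarithms\<close>

text \<open>
  Only the product \<open>w e\<close> has to extend continuously to the endpoints: w will be a power of a
  logarithm, infinite at 0, and e may have a logarithmic singularity at 1.
\<close>

lemma weighted_by_parts:
  fixes w e w' k :: "real \<Rightarrow> complex"
  assumes dw: "\<And>u. u \<in> {0<..<1} \<Longrightarrow> (w has_vector_derivative w' u) (at u)"
    and de: "\<And>u. u \<in> {0<..<1} \<Longrightarrow> (e has_vector_derivative k u) (at u)"
    and lim0: "((\<lambda>u. w u * e u) \<longlongrightarrow> 0) (at_right 0)"
    and lim1: "((\<lambda>u. w u * e u) \<longlongrightarrow> 0) (at_left 1)"
    and m: "((\<lambda>u. w u * k u) has_integral I) {0..1}"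
  shows "((\<lambda>u. w' u * e u) has_integral - I) {0..1}"
proof -
  define F where "F = (\<lambda>u. if u \<in> {0<..<1} then w u * e u else 0)"
  have dF: "(F has_vector_derivative (w' u * e u + w u * k u)) (at u)" if u: "u \<in> {0<..<1}" for u
  proof (rule has_vector_derivative_transform_within_open[where S = "{0<..<1}"])
    show "((\<lambda>u. w u * e u) has_vector_derivative (w' u * e u + w u * k u)) (at u)"
      using has_vector_derivative_mult[OF dw[OF u] de[OF u]] by (simp add: add.commute)
  qed (use u in \<open>auto simp: F_def\<close>)
  have "continuous_on {0..1} F"
    unfolding continuous_on_def
  proof
    fix x :: real assume x: "x \<in> {0..1}"
    consider "x = 0" | "x = 1" | "x \<in> {0<..<1}" using x by fastforce
    then show "(F \<longlongrightarrow> F x) (at x within {0..1})"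
    proof cases
      case 1
      have "(F \<longlongrightarrow> 0) (at_right 0)"
        by (rule Lim_transform_eventually[OF lim0])
           (auto simp: F_def eventually_at_right_field intro!: exI[of _ 1])
      then have "(F \<longlongrightarrow> 0) (at 0 within {0..1})"
        by (simp add: at_within_Icc_at_right)
      then show ?thesis using 1 by (simp add: F_def)
    next
      case 2
      have "(F \<longlongrightarrow> 0) (at_left 1)"
        by (rule Lim_transform_eventually[OF lim1])
           (auto simp: F_def eventually_at_left_field intro!: exI[of _ 0])
      then have "(F \<longlongrightarrow> 0) (at 1 within {0..1})"
        by (simp add: at_within_Icc_at_left)
      then show ?thesis using 2 by (simp add: F_def)
    next
      case 3
      then have "isCont F x"
        using dF has_vector_derivative_continuous by blast
      then show ?thesis
        by (meson continuous_at_imp_continuous_at_within continuous_within)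
    qed
  qed
  then have "((\<lambda>u. w' u * e u + w u * k u) has_integral (F 1 - F 0)) {0..1}"
    by (intro fundamental_theorem_of_calculus_interior) (use dF in auto)
  then have "((\<lambda>u. w' u * e u + w u * k u) has_integral 0) {0..1}"
    by (simp add: F_def)
  from has_integral_diff[OF this m] show ?thesis by simp
qed

lemma continuous_on_Icc_endpoints:
  fixes f :: "real \<Rightarrow> 'a :: topological_space"
  assumes "continuous_on {0..1} f"
  shows "(f \<longlongrightarrow> f 0) (at_right 0)" "(f \<longlongrightarrow> f 1) (at_left 1)"
proof -
  have "(f \<longlongrightarrow> f 0) (at 0 within {0..1})" "(f \<longlongrightarrow> f 1) (at 1 within {0..1})"
    using assms by (auto simp: continuous_on_def)
  then show "(f \<longlongrightarrow> f 0) (at_right 0)" "(f \<longlongrightarrow> f 1) (at_left 1)"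
    by (simp_all add: at_within_Icc_at_right at_within_Icc_at_left)
qed

lemma vector_derivative_slope_right:
  fixes f :: "real \<Rightarrow> complex"
  assumes "(f has_vector_derivative d) (at_right 0)" "f 0 = 0"
  shows "((\<lambda>u. f u / of_real u) \<longlongrightarrow> d) (at_right 0)"
proof -
  have "((\<lambda>u. (1 / norm u) *\<^sub>R (f u - u *\<^sub>R d)) \<longlongrightarrow> 0) (at_right 0)"
    using assms unfolding has_vector_derivative_def has_derivative_within by simp
  then have "((\<lambda>u. f u / of_real u - d) \<longlongrightarrow> 0) (at_right 0)"
    by (rule Lim_transform_eventually)
       (auto simp: eventually_at_right_field scaleR_conv_of_real field_simps intro!: exI[of _ 1])
  then show ?thesis using Lim_null by blast
qed

lemma tendsto_mult_Ln_power:
  assumes "j \<in> {1, 2}"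
  shows "((\<lambda>z. z * Ln z ^ j) \<longlongrightarrow> 0) (at 0)"
proof (rule Lim_null_comparison)
  have ev: "eventually (\<lambda>z :: complex. z \<noteq> 0) (at 0)"
    by (simp add: eventually_at_filter)
  show "eventually (\<lambda>z. norm (z * Ln z ^ j) \<le> norm z * (\<bar>ln (norm z)\<bar> + pi) ^ j) (at 0)"
    using ev
  proof eventually_elim
    case (elim z)
    have "norm (Ln z) \<le> \<bar>ln (norm z)\<bar> + pi"
      using cmod_le[of "Ln z"] Im_Ln_le_pi[OF elim] mpi_less_Im_Ln[OF elim] elim by simp
    then show ?case
      by (simp add: norm_mult norm_power mult_left_mono power_mono)
  qed
  have "((\<lambda>x :: real. x * (\<bar>ln x\<bar> + pi) ^ 1) \<longlongrightarrow> 0) (at_right 0)"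
    "((\<lambda>x :: real. x * (\<bar>ln x\<bar> + pi) ^ 2) \<longlongrightarrow> 0) (at_right 0)"
    by real_asymp+
  then have "((\<lambda>x :: real. x * (\<bar>ln x\<bar> + pi) ^ j) \<longlongrightarrow> 0) (at_right 0)"
    using assms by auto
  moreover have "filterlim norm (at_right 0) (at (0 :: complex))"
    unfolding filterlim_at by (auto simp: eventually_at_filter intro!: tendsto_eq_intros)
  ultimately show "((\<lambda>z. norm z * (\<bar>ln (norm z)\<bar> + pi) ^ j) \<longlongrightarrow> 0) (at (0 :: complex))"
    by (rule filterlim_compose)
qed

text \<open>
  What the segment and the semicircle have in common. The principal logarithm is holomorphic
  along such a path except at the starting point 0, and the bound on the imaginary part keeps
  the path away from the poles \<open>\<i>\<close> and \<open>-\<i>\<close>. As \<open>\<gamma>'(0) \<noteq> 0\<close>, quantities of order u at the parameter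
  0 are of order \<open>\<gamma> u\<close>.
\<close>

locale log_path =
  fixes \<gamma> \<gamma>' :: "real \<Rightarrow> complex"
  assumes deriv: "\<And>u. u \<in> {0..1} \<Longrightarrow> (\<gamma> has_vector_derivative \<gamma>' u) (at u)"
    and cont_deriv: "continuous_on {0..1} \<gamma>'"
    and start: "\<gamma> 0 = 0" and finish: "\<gamma> 1 = 1"
    and deriv_start: "\<gamma>' 0 \<noteq> 0"
    and Re_pos: "\<And>u. u \<in> {0<..<1} \<Longrightarrow> Re (\<gamma> u) > 0"
    and Im_small: "\<And>u. u \<in> {0..1} \<Longrightarrow> \<bar>Im (\<gamma> u)\<bar> \<le> 1 / 2"
begin

lemma cont: "continuous_on {0..1} \<gamma>"
  using deriv by (meson continuous_at_imp_continuous_on has_vector_derivative_continuous)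

lemma vderiv: "u \<in> {0..1} \<Longrightarrow> vector_derivative \<gamma> (at u within {0..1}) = \<gamma>' u"
  by (rule vector_derivative_at_within_ivl) (use deriv in auto)

lemma nz: "u \<in> {0<..1} \<Longrightarrow> \<gamma> u \<noteq> 0"
  using Re_pos[of u] finish by (cases "u = 1") auto

lemma not_nonpos: "u \<in> {0<..1} \<Longrightarrow> \<gamma> u \<notin> \<real>\<^sub>\<le>\<^sub>0"
  using Re_pos[of u] finish by (cases "u = 1") (auto simp: complex_nonpos_Reals_iff)

lemma deriv_comp:
  assumes "u \<in> {0..1}" "(f has_field_derivative d) (at (\<gamma> u))"
  shows "((\<lambda>u. f (\<gamma> u)) has_vector_derivative (\<gamma>' u * d)) (at u)"
  using field_vector_diff_chain_at[OF deriv[OF assms(1)] assms(2)] by (simp add: o_def)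

lemma integral_comp:
  assumes s: "s \<in> {0..1}" and cF: "continuous_on {0..1} (\<lambda>u. F (\<gamma> u))"
    and dF: "\<And>u. u \<in> {0<..<1} \<Longrightarrow> (F has_field_derivative f (\<gamma> u)) (at (\<gamma> u))"
    and F0: "F 0 = 0"
  shows "((\<lambda>u. \<gamma>' u * f (\<gamma> u)) has_integral F (\<gamma> s)) {0..s}"
proof -
  have "((\<lambda>u. \<gamma>' u * f (\<gamma> u)) has_integral (F (\<gamma> s) - F (\<gamma> 0))) {0..s}"
  proof (rule fundamental_theorem_of_calculus_interior)
    show "continuous_on {0..s} (\<lambda>u. F (\<gamma> u))"
      by (rule continuous_on_subset[OF cF]) (use s in auto)
    show "((\<lambda>u. F (\<gamma> u)) has_vector_derivative \<gamma>' x * f (\<gamma> x)) (at x)" if "x \<in> {0<..<s}" for x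
      using that s by (intro deriv_comp dF) auto
  qed (use s in auto)
  then show ?thesis by (simp add: start F0)
qed

lemma tendsto_start: "(\<gamma> \<longlongrightarrow> 0) (at_right 0)"
  using continuous_on_Icc_endpoints(1)[OF cont] by (simp add: start)

lemma tendsto_finish: "(\<gamma> \<longlongrightarrow> 1) (at_left 1)"
  using continuous_on_Icc_endpoints(2)[OF cont] by (simp add: finish)

lemma tendsto_quotient_start:
  assumes "(e has_vector_derivative d) (at_right 0)" "e 0 = (0 :: complex)"
  shows "((\<lambda>u. e u / \<gamma> u) \<longlongrightarrow> d / \<gamma>' 0) (at_right 0)"
proof -
  have "(\<gamma> has_vector_derivative \<gamma>' 0) (at_right 0)"
    using deriv[of 0] has_vector_derivative_at_within by auto
  then have "((\<lambda>u. (e u / of_real u) / (\<gamma> u / of_real u)) \<longlongrightarrow> d / \<gamma>' 0) (at_right 0)"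
    by (intro tendsto_divide vector_derivative_slope_right assms start deriv_start)
  then show ?thesis
    by (rule Lim_transform_eventually) (auto simp: eventually_at_right_field intro!: exI[of _ 1])
qed

lemma tendsto_Ln_mult_start:
  assumes "(e has_vector_derivative d) (at_right 0)" "e 0 = 0" "j \<in> {1, 2}"
  shows "((\<lambda>u. Ln (\<gamma> u) ^ j * e u) \<longlongrightarrow> 0) (at_right 0)"
proof -
  have *: "((\<lambda>u. \<gamma> u * Ln (\<gamma> u) ^ j) \<longlongrightarrow> 0) (at_right 0)"
  proof (rule filterlim_compose[OF tendsto_mult_Ln_power[OF assms(3)]])
    show "filterlim \<gamma> (at 0) (at_right 0)"
      using tendsto_start unfolding filterlim_at
      by (auto simp: eventually_at_right_field intro!: exI[of _ 1] nz)
  qed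
  have "((\<lambda>u. (\<gamma> u * Ln (\<gamma> u) ^ j) * (e u / \<gamma> u)) \<longlongrightarrow> 0 * (d / \<gamma>' 0)) (at_right 0)"
    by (intro tendsto_mult * tendsto_quotient_start assms)
  then show ?thesis unfolding mult_zero_left
    by (rule Lim_transform_eventually)
       (auto simp: eventually_at_right_field nz intro!: exI[of _ 1])
qed

text \<open>
  The boundary term at 0 vanishes because e is of order \<open>\<gamma> u\<close>, which beats any power of the
  logarithm. At 1 the logarithm vanishes, but e may be infinite if k has its pole there; hence
  the assumption on the limit.
\<close>

lemma Ln_power_by_parts:
  assumes k: "continuous_on {0..<1} k" and j: "j \<in> {1, 2}"
    and e: "\<And>u. u \<in> {0..<1} \<Longrightarrow> (k has_integral e u) {0..u}"
    and lim1: "((\<lambda>u. Ln (\<gamma> u) * e u) \<longlongrightarrow> 0) (at_left 1)"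
    and m: "((\<lambda>u. Ln (\<gamma> u) ^ j * k u) has_integral I) {0..1}"
  shows "((\<lambda>u. \<gamma>' u / \<gamma> u * (of_nat j * Ln (\<gamma> u) ^ (j - 1) * e u)) has_integral - I) {0..1}"
proof -
  have e_int: "e u = integral {0..u} k" if "u \<in> {0..<1}" for u
    using e[OF that] by (simp add: integral_unique)
  have kc: "continuous_on {0..b} k" if "b < 1" for b
    by (rule continuous_on_subset[OF k]) (use that in auto)
  have de: "(e has_vector_derivative k u) (at u within {0..(u + 1) / 2})" if u: "u \<in> {0..<1}" for u
  proof -
    have "((\<lambda>u. integral {0..u} k) has_vector_derivative k u) (at u within {0..(u + 1) / 2})"
      by (rule integral_has_vector_derivative[OF kc]) (use u in auto)
    then show ?thesis
      by (rule has_vector_derivative_transform[rotated 2]) (use u in \<open>auto simp: e_int\<close>)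
  qed
  have de_int: "(e has_vector_derivative k u) (at u)" if u: "u \<in> {0<..<1}" for u
  proof -
    have "(e has_vector_derivative k u) (at u within {0<..<(u + 1) / 2})"
      by (rule has_vector_derivative_within_subset[OF de]) (use u in auto)
    then show ?thesis using has_vector_derivative_within_open[of u "{0<..<(u + 1) / 2}" e "k u"] u by auto
  qed
  have "((\<lambda>u. (\<gamma>' u * (of_nat j * Ln (\<gamma> u) ^ (j - 1) * inverse (\<gamma> u))) * e u) has_integral - I) {0..1}"
  proof (rule weighted_by_parts[OF _ de_int _ _ m])
    show "((\<lambda>u. Ln (\<gamma> u) ^ j) has_vector_derivative \<gamma>' u * (of_nat j * Ln (\<gamma> u) ^ (j - 1) * inverse (\<gamma> u))) (at u)"
      if u: "u \<in> {0<..<1}" for u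
    proof (rule deriv_comp)
      show "((\<lambda>z. Ln z ^ j) has_field_derivative of_nat j * Ln (\<gamma> u) ^ (j - 1) * inverse (\<gamma> u)) (at (\<gamma> u))"
        using DERIV_power[OF has_field_derivative_Ln[OF not_nonpos], of u j] u
        by (simp add: mult_ac)
    qed (use u in auto)
    have "(e has_vector_derivative k 0) (at_right 0)"
      using de[of 0] by (simp add: at_within_Icc_at_right)
    then show "((\<lambda>u. Ln (\<gamma> u) ^ j * e u) \<longlongrightarrow> 0) (at_right 0)"
      by (rule tendsto_Ln_mult_start) (use j e_int[of 0] in auto)
    have "((\<lambda>u. Ln (\<gamma> u) ^ (j - 1) * (Ln (\<gamma> u) * e u)) \<longlongrightarrow> Ln 1 ^ (j - 1) * 0) (at_left 1)"
      by (intro tendsto_mult tendsto_power tendsto_Ln tendsto_finish lim1) auto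
    then show "((\<lambda>u. Ln (\<gamma> u) ^ j * e u) \<longlongrightarrow> 0) (at_left 1)"
      using j by (auto simp: power2_eq_square mult_ac)
  qed
  then show ?thesis by (simp add: field_simps)
qed

lemma tendsto_Ln_mult_finish:
  assumes "continuous_on {0..1} e"
  shows "((\<lambda>u. Ln (\<gamma> u) * e u) \<longlongrightarrow> 0) (at_left 1)"
proof -
  have "(e \<longlongrightarrow> e 1) (at_left 1)"
    by (rule continuous_on_Icc_endpoints[OF assms])
  then have "((\<lambda>u. Ln (\<gamma> u) * e u) \<longlongrightarrow> Ln 1 * e 1) (at_left 1)"
    by (intro tendsto_mult tendsto_Ln tendsto_finish) auto
  then show ?thesis by simp
qed

section \<open>Iterated integrals with outermost forms dt/t\<close>

declare iterated_integral_upto.simps(2) [simp del]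

lemma iterated_Cons:
  "u \<in> {0..1} \<Longrightarrow> iterated_integral_upto \<gamma> (q # bs) u =
     integral {0..u} (\<lambda>s. \<gamma>' s / (\<gamma> s - q) * iterated_integral_upto \<gamma> bs s)"
  by (auto intro!: integral_cong simp: vderiv iterated_integral_upto.simps(2))

text \<open>
  One outer form \<open>dt/t\<close> contributes \<open>- Ln\<close> to the integrand, two contribute \<open>Ln\<^sup>2 / 2\<close>. In the second
  case, the form \<open>(\<gamma>'/\<gamma>) E\<close> takes the role of K; it is continuous at 0 once it is given the value
  \<open>K 0\<close> there, and its product with \<open>Ln\<close> is integrable by the by-parts formula for \<open>Ln\<^sup>2 / 2\<close>.
\<close>

lemma iterated_zero_Cons:
  assumes K: "\<And>s. s \<in> {0..<1} \<Longrightarrow> K s = \<gamma>' s / (\<gamma> s - q) * iterated_integral_upto \<gamma> bs s"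
    and K_cont: "continuous_on {0..<1} K"
    and lim1: "((\<lambda>u. Ln (\<gamma> u) * iterated_integral_upto \<gamma> (q # bs) u) \<longlongrightarrow> 0) (at_left 1)"
    and m: "((\<lambda>u. Ln (\<gamma> u) * K u) has_integral I) {0..1}"
  shows "iterated_integral_upto \<gamma> (0 # q # bs) 1 = - I"
    and "((\<lambda>u. Ln (\<gamma> u) ^ 2 * K u) has_integral I2) {0..1} \<Longrightarrow>
      iterated_integral_upto \<gamma> (0 # 0 # q # bs) 1 = I2 / 2"
proof -
  define E where "E = iterated_integral_upto \<gamma> (q # bs)"
  have Kb: "continuous_on {0..b} K" if "b < 1" for b
    by (rule continuous_on_subset[OF K_cont]) (use that in auto)
  have E: "(K has_integral E u) {0..u}" if u: "u \<in> {0..<1}" for u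
  proof -
    have "E u = integral {0..u} K"
      unfolding E_def using u by (subst iterated_Cons) (auto intro!: integral_cong simp: K)
    then show ?thesis
      using integrable_integral[OF integrable_continuous_interval[OF Kb]] u by auto
  qed
  have E0: "E 0 = 0" using iterated_Cons[of 0 q bs] by (simp add: E_def)
  have lim1': "((\<lambda>u. Ln (\<gamma> u) * E u) \<longlongrightarrow> 0) (at_left 1)"
    using lim1 by (simp add: E_def)
  have level: "((\<lambda>u. \<gamma>' u / \<gamma> u * E u) has_integral - I) {0..1}"
    using Ln_power_by_parts[OF K_cont _ E lim1', of 1 I] m by simp
  have E2: "iterated_integral_upto \<gamma> (0 # q # bs) u = integral {0..u} (\<lambda>u. \<gamma>' u / \<gamma> u * E u)"
    if "u \<in> {0..1}" for u
    using iterated_Cons[OF that, of 0 "q # bs"] by (simp add: E_def)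
  show "iterated_integral_upto \<gamma> (0 # q # bs) 1 = - I"
    using E2[of 1] level by (simp add: integral_unique)
  assume I2: "((\<lambda>u. Ln (\<gamma> u) ^ 2 * K u) has_integral I2) {0..1}"
  (* The next form, continued to 0: E is asymptotic to K 0 * u there. *)
  define K2 where "K2 = (\<lambda>u. if u = 0 then K 0 else \<gamma>' u / \<gamma> u * E u)"
  have K2_int: "(K2 has_integral y) {0..u} \<longleftrightarrow> ((\<lambda>u. \<gamma>' u / \<gamma> u * E u) has_integral y) {0..u}" for u y
    by (rule has_integral_spike_finite_eq[of "{0}"]) (auto simp: K2_def)
  have dE: "(E has_vector_derivative K u) (at u within {0..(u + 1) / 2})" if u: "u \<in> {0..<1}" for u
  proof -
    have "((\<lambda>u. integral {0..u} K) has_vector_derivative K u) (at u within {0..(u + 1) / 2})"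
      by (rule integral_has_vector_derivative[OF Kb]) (use u in auto)
    then show ?thesis
      by (rule has_vector_derivative_transform[rotated 2])
         (use u in \<open>auto simp: integral_unique[OF E]\<close>)
  qed
  have K2_cont: "continuous_on {0..<1} K2"
    unfolding continuous_on_def
  proof
    fix x :: real assume x: "x \<in> {0..<1}"
    show "(K2 \<longlongrightarrow> K2 x) (at x within {0..<1})"
    proof (cases "x = 0")
      case True
      have "(E has_vector_derivative K 0) (at_right 0)"
        using dE[of 0] by (simp add: at_within_Icc_at_right)
      then have 1: "((\<lambda>u. E u / \<gamma> u) \<longlongrightarrow> K 0 / \<gamma>' 0) (at_right 0)"
        using tendsto_quotient_start E0 by blast
      have 2: "(\<gamma>' \<longlongrightarrow> \<gamma>' 0) (at_right 0)"
        by (rule continuous_on_Icc_endpoints[OF cont_deriv])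
      have "((\<lambda>u. \<gamma>' u * (E u / \<gamma> u)) \<longlongrightarrow> \<gamma>' 0 * (K 0 / \<gamma>' 0)) (at_right 0)"
        by (intro tendsto_mult 1 2)
      then have "((\<lambda>u. \<gamma>' u * (E u / \<gamma> u)) \<longlongrightarrow> K 0) (at_right 0)"
        using deriv_start by simp
      then have "(K2 \<longlongrightarrow> K 0) (at_right 0)"
        by (rule Lim_transform_eventually)
           (auto simp: K2_def eventually_at_right_field intro!: exI[of _ 1])
      then show ?thesis
      proof -
        have "{0..<1} \<inter> {-1<..<1} - {0} = {0<..} \<inter> {-1<..<1} - {0 :: real}" by auto
        then have "at 0 within {0..<1} = at_right (0 :: real)"
          by (intro at_within_nhd[of 0 "{-1<..<1}"]) auto
        then show ?thesis using True \<open>(K2 \<longlongrightarrow> K 0) (at_right 0)\<close> by (simp add: K2_def)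
      qed
    next
      case False
      then have xx: "x \<in> {0<..<1}" using x by auto
      have 1: "continuous_on {0<..<1} E"
      proof (rule continuous_on_eq_continuous_within[THEN iffD2], rule ballI)
        fix u :: real assume u: "u \<in> {0<..<1}"
        have "(E has_vector_derivative K u) (at u within {0<..<(u + 1) / 2})"
          by (rule has_vector_derivative_within_subset[OF dE]) (use u in auto)
        then have "(E has_vector_derivative K u) (at u)"
          using has_vector_derivative_within_open[of u "{0<..<(u + 1) / 2}" E "K u"] u by auto
        then show "continuous (at u within {0<..<1}) E"
          using continuous_at_imp_continuous_at_within has_vector_derivative_continuous by blast
      qed
      have "continuous_on {0<..<1} (\<lambda>u. \<gamma>' u / \<gamma> u * E u)"
        by (intro continuous_intros 1 continuous_on_subset[OF cont] continuous_on_subset[OF cont_deriv])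
           (auto simp: nz)
      then have "continuous_on {0<..<1} K2"
        by (rule continuous_on_eq) (auto simp: K2_def)
      then have "isCont K2 x" using xx by (simp add: continuous_on_eq_continuous_at)
      then show ?thesis
        by (meson continuous_at_imp_continuous_at_within continuous_within)
    qed
  qed
  define E2 where "E2 = (\<lambda>u. integral {0..u} K2)"
  have K2_integrable: "K2 integrable_on {0..1}"
    using level unfolding integrable_on_def K2_int by blast
  have E2': "(K2 has_integral E2 u) {0..u}" if "u \<in> {0..<1}" for u
    unfolding E2_def by (rule integrable_integral, rule integrable_on_subinterval[OF K2_integrable])
      (use that in auto)
  have E2_eq: "iterated_integral_upto \<gamma> (0 # q # bs) u = E2 u" if u: "u \<in> {0..1}" for u
    unfolding E2[OF u] E2_def by (rule integral_spike[of "{0}"]) (auto simp: K2_def)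
  have m2: "((\<lambda>u. Ln (\<gamma> u) ^ 1 * K2 u) has_integral - I2 / 2) {0..1}"
  proof -
    have "((\<lambda>u. (\<gamma>' u / \<gamma> u * (of_nat 2 * Ln (\<gamma> u) ^ (2 - 1) * E u)) / 2) has_integral - I2 / 2) {0..1}"
      by (intro has_integral_divide Ln_power_by_parts[OF K_cont _ E lim1' I2]) auto
    then show ?thesis
      by (rule has_integral_spike_finite[rotated 2, of _ _ _ "{0}"]) (auto simp: K2_def)
  qed
  have "((\<lambda>u. \<gamma>' u / \<gamma> u * (of_nat 1 * Ln (\<gamma> u) ^ (1 - 1) * E2 u)) has_integral - (- I2 / 2)) {0..1}"
  proof (rule Ln_power_by_parts[OF K2_cont _ E2' _ m2])
    show "((\<lambda>u. Ln (\<gamma> u) * E2 u) \<longlongrightarrow> 0) (at_left 1)"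
      unfolding E2_def
      by (intro tendsto_Ln_mult_finish indefinite_integral_continuous_1 K2_integrable)
  qed auto
  then have "((\<lambda>u. \<gamma>' u / \<gamma> u * E2 u) has_integral I2 / 2) {0..1}" by simp
  moreover have "integral {0..1} (\<lambda>u. \<gamma>' u / (\<gamma> u - 0) * iterated_integral_upto \<gamma> (0 # q # bs) u) =
      integral {0..1} (\<lambda>u. \<gamma>' u / \<gamma> u * E2 u)"
    by (rule integral_cong) (simp add: E2_eq del: iterated_integral_upto.simps)
  ultimately have "integral {0..1} (\<lambda>u. \<gamma>' u / (\<gamma> u - 0) * iterated_integral_upto \<gamma> (0 # q # bs) u) = I2 / 2"
    by (simp add: integral_unique del: iterated_integral_upto.simps)
  then show "iterated_integral_upto \<gamma> (0 # 0 # q # bs) 1 = I2 / 2"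
    using iterated_Cons[of 1 0 "0 # q # bs"] by (simp del: iterated_integral_upto.simps)
qed

end

section \<open>Independence of the path\<close>

definition half_strip :: "complex set"
  where "half_strip = {z. 0 \<le> Re z \<and> \<bar>Im z\<bar> \<le> 1 / 2}"

lemma convex_half_strip: "convex half_strip"
proof -
  have *: "half_strip = {z. Re z \<ge> 0} \<inter> {z. Im z \<le> 1 / 2} \<inter> {z. Im z \<ge> - 1 / 2}"
    by (auto simp: half_strip_def)
  show ?thesis unfolding *
    by (intro convex_Int convex_halfspace_Re_ge convex_halfspace_Im_le convex_halfspace_Im_ge)
qed

lemma half_strip_not_nonpos: "z \<in> half_strip \<Longrightarrow> z \<noteq> 0 \<Longrightarrow> z \<notin> \<real>\<^sub>\<le>\<^sub>0"
  by (auto simp: half_strip_def complex_nonpos_Reals_iff complex_eq_iff)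

context log_path
begin

lemma in_half_strip: "u \<in> {0..1} \<Longrightarrow> \<gamma> u \<in> half_strip"
  using Re_pos[of u] Im_small[of u] start finish
  by (cases "u = 0"; cases "u = 1") (auto simp: half_strip_def)

text \<open>
  The starting point 0 lies on the boundary of the convex region, so the primitive is only
  differentiated within the region.
\<close>

lemma integral_comp_half_strip:
  assumes "\<And>z. z \<in> half_strip \<Longrightarrow> (G has_field_derivative f z) (at z within half_strip)"
  shows "((\<lambda>u. \<gamma>' u * f (\<gamma> u)) has_integral (G 1 - G 0)) {0..1}"
proof -
  have "((\<lambda>u. \<gamma>' u * f (\<gamma> u)) has_integral (G (\<gamma> 1) - G (\<gamma> 0))) {0..1}"
  proof (rule fundamental_theorem_of_calculus)
    fix u :: real assume u: "u \<in> {0..1}"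
    have "((G \<circ> \<gamma>) has_vector_derivative \<gamma>' u * f (\<gamma> u)) (at u within {0..1})"
      by (rule field_vector_diff_chain_within[OF has_vector_derivative_at_within[OF deriv[OF u]]])
         (rule DERIV_subset[OF assms], use u in_half_strip in auto)
    then show "((\<lambda>u. G (\<gamma> u)) has_vector_derivative \<gamma>' u * f (\<gamma> u)) (at u within {0..1})"
      by (simp add: o_def)
  qed auto
  then show ?thesis by (simp add: start finish)
qed

end

lemma continuous_on_mult_Ln_power:
  assumes "j \<in> {1, 2}" "S \<subseteq> half_strip"
  shows "continuous_on S (\<lambda>z. z * Ln z ^ j)"
proof -
  have "isCont (\<lambda>z. z * Ln z ^ j) z" if "z \<in> S" for z
  proof (cases "z = 0")
    case True
    then show ?thesis
      using tendsto_mult_Ln_power[OF assms(1)] by (simp add: isCont_def)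
  next
    case False
    then show ?thesis
      using half_strip_not_nonpos[of z] that assms(2) by (intro continuous_intros) auto
  qed
  then show ?thesis by (simp add: continuous_at_imp_continuous_on)
qed

lemma path_independence:
  assumes cont: "continuous_on half_strip f" and "finite K"
    and diff: "\<And>z. z \<in> interior half_strip - K \<Longrightarrow> f field_differentiable (at z)"
  obtains V where "\<And>\<gamma> \<gamma>'. log_path \<gamma> \<gamma>' \<Longrightarrow> ((\<lambda>u. \<gamma>' u * f (\<gamma> u)) has_integral V) {0..1}"
proof -
  obtain G where G: "\<And>z. z \<in> half_strip \<Longrightarrow> (G has_field_derivative f z) (at z within half_strip)"
    by (rule holomorphic_convex_primitive[OF convex_half_strip assms(2) cont diff]) auto
  show thesis
    by (rule that[of "G 1 - G 0"], rule log_path.integral_comp_half_strip[OF _ G])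
qed

lemma interior_half_strip: "z \<in> interior half_strip \<Longrightarrow> z \<in> half_strip \<and> z \<noteq> 0"
proof
  assume z: "z \<in> interior half_strip"
  then show "z \<in> half_strip" using interior_subset by blast
  show "z \<noteq> 0"
  proof
    assume "z = 0"
    with z obtain e where "e > 0" "ball 0 e \<subseteq> half_strip"
      by (meson mem_interior)
    moreover have "of_real (- e / 2) \<in> ball (0 :: complex) e" using \<open>e > 0\<close> by simp
    ultimately have "of_real (- e / 2) \<in> half_strip" by blast
    then show False using \<open>e > 0\<close> by (simp add: half_strip_def)
  qed
qed

lemma continuous_on_removable:
  fixes N :: "'a :: real_normed_field \<Rightarrow> 'a"
  assumes N: "continuous_on S N" and d: "(N has_field_derivative c) (at q)" and Nq: "N q = 0"
  shows "continuous_on S (\<lambda>z. if z = q then c else N z / (z - q))"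
  unfolding continuous_on_eq_continuous_within
proof
  fix z assume z: "z \<in> S"
  show "continuous (at z within S) (\<lambda>z. if z = q then c else N z / (z - q))"
  proof (cases "z = q")
    case True
    have "((\<lambda>z. N z / (z - q)) \<longlongrightarrow> c) (at q)"
      using d Nq by (simp add: has_field_derivative_iff)
    then have "((\<lambda>z. if z = q then c else N z / (z - q)) \<longlongrightarrow> c) (at q)"
      by (rule Lim_transform_eventually) (auto simp: eventually_at_filter)
    then have "isCont (\<lambda>z. if z = q then c else N z / (z - q)) z"
      using True by (simp add: isCont_def)
    then show ?thesis by (rule continuous_at_imp_continuous_at_within)
  next
    case False
    have "continuous (at z within S) (\<lambda>z. N z / (z - q))"
      using N z False by (intro continuous_intros) (auto simp: continuous_on_eq_continuous_within)
    then show ?thesis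
      by (rule continuous_transform_within[where \<delta> = "dist z q"]) (use z False in \<open>auto simp: dist_commute\<close>)
  qed
qed

text \<open>
  A zero of the numerator at the real pole q makes the integrand continuous there, and Cauchy's
  theorem tolerates finitely many points of mere continuity. This is how the value over the
  semicircle is compared with the one over the segment through q, where the integrand at the
  single parameter q is immaterial.
\<close>

lemma path_independence_removable:
  assumes N: "continuous_on half_strip N" and q: "q \<in> \<real>" "Re q > 0" and Nq: "N q = 0"
    and dN: "\<And>z. z \<in> half_strip \<Longrightarrow> z \<noteq> 0 \<Longrightarrow> N field_differentiable (at z)"
  obtains V where "\<And>\<gamma> \<gamma>'. log_path \<gamma> \<gamma>' \<Longrightarrow> q \<notin> \<gamma> ` {0<..<1} \<or> (\<gamma> = (\<lambda>t. of_real t)) \<Longrightarrow>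
    ((\<lambda>u. \<gamma>' u * (N (\<gamma> u) / (\<gamma> u - q))) has_integral V) {0..1}"
proof -
  have qS: "q \<in> half_strip" "q \<noteq> 0" using q by (auto simp: half_strip_def complex_is_Real_iff)
  then obtain c where c: "(N has_field_derivative c) (at q)"
    using dN field_differentiable_def by blast
  define f where "f = (\<lambda>z. if z = q then c else N z / (z - q))"
  have cont: "continuous_on half_strip f"
    unfolding f_def by (rule continuous_on_removable[OF N c Nq])
  have diff: "f field_differentiable (at z)" if z: "z \<in> interior half_strip - {q}" for z
  proof (rule field_differentiable_transform_within[where d = "dist z q" and f = "\<lambda>z. N z / (z - q)"])
    show "(\<lambda>z. N z / (z - q)) field_differentiable at z within UNIV"
      using z interior_half_strip dN by (intro derivative_intros) auto
  qed (use z in \<open>auto simp: f_def dist_commute\<close>)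
  obtain V where V: "\<And>\<gamma> \<gamma>'. log_path \<gamma> \<gamma>' \<Longrightarrow> ((\<lambda>u. \<gamma>' u * f (\<gamma> u)) has_integral V) {0..1}"
    using path_independence[OF cont _ diff, of "{q}"] by auto
  show thesis
  proof (rule that)
    fix \<gamma> \<gamma>' assume "log_path \<gamma> \<gamma>'" and *: "q \<notin> \<gamma> ` {0<..<1} \<or> (\<gamma> = (\<lambda>t. of_real t))"
    have "\<gamma> u \<noteq> q" if "u \<in> {0..1} - {0, 1, Re q}" for u
      using * that by auto
    then show "((\<lambda>u. \<gamma>' u * (N (\<gamma> u) / (\<gamma> u - q))) has_integral V) {0..1}"
      by (intro has_integral_spike_finite[OF _ _ V[OF \<open>log_path \<gamma> \<gamma>'\<close>], of "{0, 1, Re q}"])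
         (auto simp: f_def)
  qed
qed

text \<open>
  The two paths of integration: the segment and the lower semicircle with diameter [0,1].
\<close>

lemma log_path_of_real: "log_path (\<lambda>t. of_real t) (\<lambda>_. 1)"
  by unfold_locales (use has_vector_derivative_of_real[OF DERIV_ident] in auto)

lemma linepath_0_1: "linepath 0 1 = (\<lambda>t. of_real t :: complex)"
  by (auto simp: linepath_def scaleR_conv_of_real)

abbreviation arc :: "real \<Rightarrow> complex"
  where "arc \<equiv> part_circlepath (1 / 2) (1 / 2) (- pi) 0"

lemma arc_eq: "arc t = (1 + cis (pi * (t - 1))) / 2"
  by (simp add: part_circlepath_def linepath_def cis_conv_exp algebra_simps add_divide_distrib)

lemma log_path_arc: "log_path arc (\<lambda>t. \<i> * of_real (pi / 2) * cis (pi * (t - 1)))"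
proof
  fix u :: real assume u: "u \<in> {0..1}"
  have "((\<lambda>t. (1 + exp (\<i> * of_real (pi * (t - 1)))) / 2) has_vector_derivative
      \<i> * of_real (pi / 2) * exp (\<i> * of_real (pi * (u - 1)))) (at u)"
    by (auto intro!: derivative_eq_intros has_vector_derivative_real_field simp: algebra_simps)
  then show "(arc has_vector_derivative \<i> * of_real (pi / 2) * cis (pi * (u - 1))) (at u)"
    by (simp add: arc_eq [abs_def] cis_conv_exp)
  show "\<bar>Im (arc u)\<bar> \<le> 1 / 2"
    by (simp add: arc_eq)
next
  fix u :: real assume u: "u \<in> {0<..<1}"
  have "cos (pi * (1 - u)) > -1"
  proof -
    have "cos (pi * (1 - u)) > cos pi"
      by (rule cos_monotone_0_pi) (use u in auto)
    then show ?thesis by simp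
  qed
  moreover have "cos (pi * (u - 1)) = cos (pi * (1 - u))"
    by (metis cos_minus minus_diff_eq mult_minus_right)
  ultimately show "0 < Re (arc u)"
    by (simp add: arc_eq)
qed (auto simp: arc_eq intro!: continuous_intros simp: complex_eq_iff)

lemma arc_not_real:
  assumes "q \<in> \<real>" shows "q \<notin> arc ` {0<..<1}"
proof
  assume "q \<in> arc ` {0<..<1}"
  then obtain u where u: "0 < u" "u < 1" "q = arc u" by auto
  have "sin (pi * (1 - u)) > 0"
    by (rule sin_gt_zero) (use u in auto)
  moreover have "sin (pi * (u - 1)) = - sin (pi * (1 - u))"
    by (metis sin_minus minus_diff_eq mult_minus_right)
  ultimately have "Im (arc u) \<noteq> 0" by (simp add: arc_eq)
  then show False using assms u by (simp add: complex_is_Real_iff)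
qed

section \<open>The dilogarithm with a pole at \<i> or -\<i>\<close>

lemma Ln_deriv:
  assumes p: "p \<in> {\<i>, -\<i>}" and z: "\<bar>Im z\<bar> < 1"
  shows "((\<lambda>z. Ln (1 - z / p)) has_field_derivative 1 / (z - p)) (at z)"
proof -
  have "Re (1 - z / p) > 0" using p z by auto
  then have 1: "1 - z / p \<notin> \<real>\<^sub>\<le>\<^sub>0" by (auto simp: complex_nonpos_Reals_iff)
  have 2: "p \<noteq> 0" "z \<noteq> p" using p z by auto
  have "((\<lambda>z. Ln (1 - z / p)) has_field_derivative (- (1 / p)) * inverse (1 - z / p)) (at z)"
    using 1 2 by (auto intro!: derivative_eq_intros)
  also have "(- (1 / p)) * inverse (1 - z / p) = 1 / (z - p)"
    using 2 by (simp add: field_simps)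
  finally show ?thesis .
qed

definition strip :: "complex set"
  where "strip = {z. \<bar>Im z\<bar> < 1}"

lemma strip_open_convex: "open strip" "convex strip"
proof -
  have *: "strip = {z. Im z < 1} \<inter> {z. Im z > -1}" by (auto simp: strip_def)
  show "open strip" "convex strip"
    unfolding *
    by (intro open_Int open_halfspace_Im_lt open_halfspace_Im_gt convex_Int
          convex_halfspace_Im_lt convex_halfspace_Im_gt)+
qed

lemma neg_dilog_exists:
  assumes p: "p \<in> {\<i>, -\<i>}"
  shows "\<exists>D. D 0 = 0 \<and> (\<forall>z\<in>strip. (D has_field_derivative
    (if z = 0 then - 1 / p else Ln (1 - z / p) / z)) (at z))"
proof -
  have dl: "((\<lambda>z. Ln (1 - z / p)) has_field_derivative 1 / (z - p)) (at z)"
    if "z \<in> strip" for z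
    using Ln_deriv[OF p] that by (simp add: strip_def)
  have "((\<lambda>z. Ln (1 - z / p)) has_field_derivative - 1 / p) (at 0)"
    using dl[of 0] by (simp add: strip_def)
  moreover have "continuous_on strip (\<lambda>z. Ln (1 - z / p))"
    using dl by (intro continuous_at_imp_continuous_on ballI DERIV_isCont) auto
  ultimately have cont: "continuous_on strip (\<lambda>z. if z = 0 then - 1 / p else Ln (1 - z / p) / z)"
    using continuous_on_removable[of strip "\<lambda>z. Ln (1 - z / p)" "- 1 / p" 0] unfolding diff_0_right by simp
  have diff: "(\<lambda>z. if z = 0 then - 1 / p else Ln (1 - z / p) / z) field_differentiable at z"
    if z: "z \<in> interior strip - {0}" for z
  proof (rule field_differentiable_transform_within[where d = "norm z" and f = "\<lambda>z. Ln (1 - z / p) / z"])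
    have "(\<lambda>z. Ln (1 - z / p)) field_differentiable at z"
      using dl[of z] z strip_open_convex by (auto simp: field_differentiable_def interior_open)
    then show "(\<lambda>z. Ln (1 - z / p) / z) field_differentiable at z within UNIV"
      using z by (intro derivative_intros) auto
  qed (use z in \<open>auto simp: dist_norm\<close>)
  obtain G where G: "\<And>z. z \<in> strip \<Longrightarrow> (G has_field_derivative
      (if z = 0 then - 1 / p else Ln (1 - z / p) / z)) (at z within strip)"
    using holomorphic_convex_primitive[OF strip_open_convex(2) _ cont diff, of "{0}"] by auto
  have "((\<lambda>z. G z - G 0) has_field_derivative
      (if z = 0 then - 1 / p else Ln (1 - z / p) / z)) (at z)" if "z \<in> strip" for z
    using G[OF that] at_within_open[OF that strip_open_convex(1)]
    by (auto intro!: derivative_eq_intros)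
  then show ?thesis by (intro exI[of _ "\<lambda>z. G z - G 0"]) auto
qed

text \<open>
  The double integral \<open>dt/(t - p)\<close>, \<open>dt/t\<close>, that is \<open>- Li\<^sub>2 (z/p)\<close>, as a holomorphic function on
  a strip containing both paths.
\<close>

definition neg_dilog :: "complex \<Rightarrow> complex \<Rightarrow> complex"
  where "neg_dilog p = (SOME D. D 0 = 0 \<and> (\<forall>z\<in>strip. (D has_field_derivative
    (if z = 0 then - 1 / p else Ln (1 - z / p) / z)) (at z)))"

lemma neg_dilog:
  assumes "p \<in> {\<i>, -\<i>}"
  shows neg_dilog_0: "neg_dilog p 0 = 0"
    and neg_dilog_deriv: "z \<in> strip \<Longrightarrow>
      (neg_dilog p has_field_derivative (if z = 0 then - 1 / p else Ln (1 - z / p) / z)) (at z)"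
  using someI_ex[OF neg_dilog_exists[OF assms]] unfolding neg_dilog_def by auto

lemma half_strip_subset: "half_strip \<subseteq> strip"
  by (auto simp: half_strip_def strip_def)

lemma neg_dilog_cont: "p \<in> {\<i>, -\<i>} \<Longrightarrow> continuous_on half_strip (neg_dilog p)"
  by (intro continuous_at_imp_continuous_on ballI DERIV_isCont[OF neg_dilog_deriv])
     (use half_strip_subset in auto)

context log_path
begin

lemma in_strip: "u \<in> {0..1} \<Longrightarrow> \<gamma> u \<in> strip"
  using in_half_strip half_strip_subset by blast

lemma iterated_log:
  assumes p: "p \<in> {\<i>, -\<i>}" and u: "u \<in> {0..1}"
  shows "iterated_integral_upto \<gamma> [p] u = Ln (1 - \<gamma> u / p)"
proof -
  have dl: "((\<lambda>z. Ln (1 - z / p)) has_field_derivative 1 / (\<gamma> u - p)) (at (\<gamma> u))"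
    if "u \<in> {0..1}" for u
    using Ln_deriv[OF p] in_strip[OF that] by (simp add: strip_def)
  have "((\<lambda>s. \<gamma>' s * (1 / (\<gamma> s - p))) has_integral Ln (1 - \<gamma> u / p)) {0..u}"
  proof (rule integral_comp[OF u])
    show "continuous_on {0..1} (\<lambda>u. Ln (1 - \<gamma> u / p))"
      by (intro continuous_at_imp_continuous_on ballI has_vector_derivative_continuous[OF deriv_comp[OF _ dl]])
    show "((\<lambda>z. Ln (1 - z / p)) has_field_derivative 1 / (\<gamma> v - p)) (at (\<gamma> v))" if "v \<in> {0<..<1}" for v
      by (rule dl) (use that in auto)
  qed auto
  then show ?thesis
    using iterated_Cons[OF u, of p "[]"] by (simp add: integral_unique)
qed

lemma iterated_neg_dilog:
  assumes p: "p \<in> {\<i>, -\<i>}" and u: "u \<in> {0..1}"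
  shows "iterated_integral_upto \<gamma> [0, p] u = neg_dilog p (\<gamma> u)"
proof -
  have "((\<lambda>s. \<gamma>' s * (Ln (1 - \<gamma> s / p) / \<gamma> s)) has_integral neg_dilog p (\<gamma> u)) {0..u}"
  proof (rule integral_comp[OF u])
    show "continuous_on {0..1} (\<lambda>u. neg_dilog p (\<gamma> u))"
      by (rule continuous_on_compose2[OF neg_dilog_cont[OF p] cont]) (use in_half_strip in auto)
    show "(neg_dilog p has_field_derivative Ln (1 - \<gamma> v / p) / \<gamma> v) (at (\<gamma> v))" if "v \<in> {0<..<1}" for v
      using neg_dilog_deriv[OF p in_strip, of v] nz[of v] that by auto
  qed (use neg_dilog_0[OF p] in auto)
  moreover have "iterated_integral_upto \<gamma> [0, p] u = integral {0..u} (\<lambda>s. \<gamma>' s * (Ln (1 - \<gamma> s / p) / \<gamma> s))"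
    unfolding iterated_Cons[OF u] by (rule integral_cong) (use u in \<open>auto simp: iterated_log[OF p]\<close>)
  ultimately show ?thesis by (simp add: integral_unique)
qed

end

section \<open>Hyperlogarithms as single integrals\<close>

lemma continuous_on_Ln_mult_neg_dilog:
  assumes "p \<in> {\<i>, -\<i>}"
  shows "continuous_on half_strip (\<lambda>z. Ln z * neg_dilog p z)"
proof -
  have "(neg_dilog p has_field_derivative - 1 / p) (at 0)"
    using neg_dilog_deriv[OF assms, of 0] by (simp add: strip_def)
  then have "continuous_on half_strip (\<lambda>z. if z = 0 then - 1 / p else neg_dilog p z / (z - 0))"
    by (intro continuous_on_removable neg_dilog_cont neg_dilog_0 assms)
  then have "continuous_on half_strip (\<lambda>z. (z * Ln z ^ 1) * (if z = 0 then - 1 / p else neg_dilog p z / (z - 0)))"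
    by (intro continuous_on_mult continuous_on_mult_Ln_power) auto
  then show ?thesis
    by (rule continuous_on_eq) (use neg_dilog_0[OF assms] in auto)
qed

text \<open>
  If the pole is the endpoint 1, the integral up to u is \<open>O (ln (1 - u))\<close>, and
  \<open>ln u \<cdot> ln (1 - u)\<close> tends to 0.
\<close>

lemma log_pole_finish:
  fixes K J :: "real \<Rightarrow> complex"
  assumes J: "continuous_on {0..1} J"
    and K: "\<And>s. s \<in> {0..<1} \<Longrightarrow> K s = J s / (of_real s - 1)"
  shows "((\<lambda>u. Ln (of_real u) * integral {0..u} K) \<longlongrightarrow> 0) (at_left 1)"
proof -
  obtain C where "\<forall>x\<in>J ` {0..1}. norm x \<le> C"
    using compact_imp_bounded[OF compact_continuous_image[OF J compact_Icc]]
    unfolding bounded_iff by blast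
  then have C: "norm (J s) \<le> C" if "s \<in> {0..1}" for s
    using that by blast
  have bound: "norm (integral {0..u} K) \<le> C * - ln (1 - u)" if u: "u \<in> {0<..<1}" for u
  proof -
    have int: "((\<lambda>s. C * (1 / (1 - s))) has_integral C * - ln (1 - u) - C * - ln (1 - 0)) {0..u}"
      by (rule fundamental_theorem_of_calculus)
         (use u in \<open>auto intro!: derivative_eq_intros
            simp flip: has_real_derivative_iff_has_vector_derivative simp: field_simps\<close>)
    have "norm (integral {0..u} K) \<le> integral {0..u} (\<lambda>s. C * (1 / (1 - s)))"
    proof (rule integral_norm_bound_integral)
      have "continuous_on {0..u} (\<lambda>s. J s / (of_real s - 1))"
        using u by (intro continuous_intros continuous_on_subset[OF J]) (auto simp: complex_eq_iff)
      then show "K integrable_on {0..u}"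
        using u K by (intro integrable_continuous_interval, elim continuous_on_eq) auto
      show "norm (K s) \<le> C * (1 / (1 - s))" if s: "s \<in> {0..u}" for s
      proof -
        have "norm (of_real s - 1 :: complex) = 1 - s"
          using s u by (metis abs_of_nonpos atLeastAtMost_iff diff_le_0_iff_le greaterThanLessThan_iff le_less_trans less_imp_le minus_diff_eq norm_of_real of_real_1 of_real_diff)
        then show ?thesis
          using K[of s] C[of s] s u by (simp add: norm_divide divide_right_mono)
      qed
    qed (use int in blast)
    then show ?thesis using int by (simp add: integral_unique)
  qed
  show ?thesis
  proof (rule Lim_null_comparison)
    show "eventually (\<lambda>u. norm (Ln (of_real u) * integral {0..u} K) \<le> \<bar>ln u\<bar> * (C * - ln (1 - u))) (at_left 1)"
      using eventually_at_left_real[of 0 1]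
    proof (rule eventually_mono)
      fix u :: real assume u: "u \<in> {0<..<1}"
      then show "norm (Ln (of_real u) * integral {0..u} K) \<le> \<bar>ln u\<bar> * (C * - ln (1 - u))"
      proof -
        have "norm (Ln (complex_of_real u)) = \<bar>ln u\<bar>"
          using u by (simp add: Ln_of_real)
        then show ?thesis
          using mult_left_mono[OF bound[OF u], of "\<bar>ln u\<bar>"] by (simp only: norm_mult abs_ge_zero)
      qed
    qed simp
    have "((\<lambda>u. \<bar>ln u\<bar> * ln (1 - u)) \<longlongrightarrow> 0) (at_left (1 :: real))"
      by real_asymp
    from tendsto_mult[OF tendsto_const[of "- C"] this]
    show "((\<lambda>u. \<bar>ln u\<bar> * (C * - ln (1 - u))) \<longlongrightarrow> 0) (at_left (1 :: real))"
      by (simp add: mult_ac)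
  qed
qed

context log_path
begin

lemma pole_iterated_finish:
  assumes q: "q \<noteq> 0" "q \<notin> \<gamma> ` {0<..<1}" "q \<noteq> 1 \<or> \<gamma> = of_real \<and> \<gamma>' = (\<lambda>_. 1)"
    and J: "continuous_on {0..1} (iterated_integral_upto \<gamma> bs)"
    and K_def: "K = (\<lambda>s. \<gamma>' s / (\<gamma> s - q) * iterated_integral_upto \<gamma> bs s)"
  shows "continuous_on {0..<1} K"
    and "q \<noteq> 1 \<Longrightarrow> continuous_on {0..1} K"
    and "((\<lambda>u. Ln (\<gamma> u) * iterated_integral_upto \<gamma> (q # bs) u) \<longlongrightarrow> 0) (at_left 1)"
proof -
  have ne: "\<gamma> u \<noteq> q" if "u \<in> {0..<1}" for u
    using that q start by (cases "u = 0") auto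
  have ne': "\<gamma> u \<noteq> q" if "q \<noteq> 1" "u \<in> {0..1}" for u
    using that ne[of u] finish by (cases "u = 1") auto
  show c: "continuous_on {0..<1} K" unfolding K_def
    by (intro continuous_intros continuous_on_subset[OF cont_deriv] continuous_on_subset[OF cont]
        continuous_on_subset[OF J]) (use ne in auto)
  show c': "continuous_on {0..1} K" if "q \<noteq> 1"
    unfolding K_def by (intro continuous_intros cont_deriv cont J) (use ne'[OF that] in auto)
  have eq: "iterated_integral_upto \<gamma> (q # bs) u = integral {0..u} K" if "u \<in> {0..1}" for u
    using iterated_Cons[OF that] by (simp add: K_def)
  show "((\<lambda>u. Ln (\<gamma> u) * iterated_integral_upto \<gamma> (q # bs) u) \<longlongrightarrow> 0) (at_left 1)"
  proof (cases "q = 1")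
    case False
    have "continuous_on {0..1} (\<lambda>u. integral {0..u} K)"
      by (rule indefinite_integral_continuous_1, rule integrable_continuous_interval, rule c'[OF False])
    then show ?thesis
      by (intro tendsto_Ln_mult_finish) (erule continuous_on_eq, simp add: eq)
  next
    case True
    then have *: "\<gamma> = of_real" "\<gamma>' = (\<lambda>_. 1)" using q by auto
    have "((\<lambda>u. Ln (of_real u) * integral {0..u} K) \<longlongrightarrow> 0) (at_left 1)"
      by (rule log_pole_finish[OF J]) (simp add: K_def * True)
    then show ?thesis unfolding *(1)
      by (rule Lim_transform_eventually)
         (use eq in \<open>auto simp: eventually_at_left_field * intro!: exI[of _ 0]\<close>)
  qed
qed

text \<open>
  For \<open>q = 1\<close> the iterated integral of weight three diverges, so it must come with the factor 0.
\<close>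

lemma depth_two:
  assumes q: "q \<noteq> 0" "q \<notin> \<gamma> ` {0<..<1}" "q \<noteq> 1 \<or> \<gamma> = of_real \<and> \<gamma>' = (\<lambda>_. 1) \<and> L = 0"
    and p: "p \<in> {\<i>, -\<i>}"
    and V: "((\<lambda>u. \<gamma>' u * ((L - Ln (\<gamma> u)) * neg_dilog p (\<gamma> u) / (\<gamma> u - q))) has_integral V) {0..1}"
  shows "iterated_integral_upto \<gamma> [0, q, 0, p] 1 + L * iterated_integral_upto \<gamma> [q, 0, p] 1 = V"
proof -
  define K where "K = (\<lambda>s. \<gamma>' s / (\<gamma> s - q) * iterated_integral_upto \<gamma> [0, p] s)"
  have "continuous_on {0..1} (\<lambda>u. neg_dilog p (\<gamma> u))"
    by (rule continuous_on_compose2[OF neg_dilog_cont[OF p] cont]) (use in_half_strip in auto)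
  then have J: "continuous_on {0..1} (iterated_integral_upto \<gamma> [0, p])"
    by (rule continuous_on_eq) (simp add: iterated_neg_dilog[OF p])
  have q': "q \<noteq> 1 \<or> \<gamma> = of_real \<and> \<gamma>' = (\<lambda>_. 1)" using q by auto
  note K = pole_iterated_finish[OF q(1,2) q' J K_def]
  have LK: "((\<lambda>u. L * K u) has_integral L * iterated_integral_upto \<gamma> [q, 0, p] 1) {0..1}"
  proof (cases "q = 1")
    case False
    have "(K has_integral integral {0..1} K) {0..1}"
      by (rule integrable_integral, rule integrable_continuous_interval, rule K(2)[OF False])
    moreover have "iterated_integral_upto \<gamma> [q, 0, p] 1 = integral {0..1} K"
      unfolding K_def by (rule iterated_Cons) auto
    ultimately show ?thesis by (simp add: has_integral_mult_right)
  qed (use q in simp)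
  have "((\<lambda>u. L * K u - \<gamma>' u * ((L - Ln (\<gamma> u)) * neg_dilog p (\<gamma> u) / (\<gamma> u - q)))
      has_integral (L * iterated_integral_upto \<gamma> [q, 0, p] 1 - V)) {0..1}"
    by (rule has_integral_diff[OF LK V])
  then have m: "((\<lambda>u. Ln (\<gamma> u) * K u) has_integral (L * iterated_integral_upto \<gamma> [q, 0, p] 1 - V)) {0..1}"
    by (rule has_integral_eq[rotated])
       (simp add: K_def iterated_neg_dilog[OF p] diff_divide_distrib algebra_simps)
  have "iterated_integral_upto \<gamma> [0, q, 0, p] 1 = - (L * iterated_integral_upto \<gamma> [q, 0, p] 1 - V)"
    by (rule iterated_zero_Cons(1)[OF _ K(1) K(3) m]) (simp add: K_def)
  then show ?thesis by simp
qed

lemma Ln_power_integral: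
  assumes j: "j \<in> {1, 2}"
  shows "((\<lambda>u. \<gamma>' u * Ln (\<gamma> u) ^ j) has_integral (if j = 1 then - 1 else 2)) {0..1}"
proof -
  define P where "P = (\<lambda>z. if j = 1 then z * Ln z ^ 1 - z else z * Ln z ^ 2 - 2 * (z * Ln z ^ 1) + 2 * z)"
  have "continuous_on half_strip P"
    unfolding P_def by (cases "j = 1") (auto intro!: continuous_intros continuous_on_mult_Ln_power[unfolded power_one_right, of 1] continuous_on_mult_Ln_power[of 2] continuous_on_mult_Ln_power[of 1, unfolded power_one_right])
  then have "continuous_on {0..1} (\<lambda>u. P (\<gamma> u))"
    by (rule continuous_on_compose2[OF _ cont]) (use in_half_strip in auto)
  moreover have "(P has_field_derivative Ln (\<gamma> u) ^ j) (at (\<gamma> u))" if "u \<in> {0<..<1}" for u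
    using not_nonpos[of u] nz[of u] that j unfolding P_def
    by (cases "j = 1") (auto intro!: derivative_eq_intros simp: power2_eq_square field_simps)
  moreover have "P 0 = 0" by (simp add: P_def)
  ultimately have "((\<lambda>u. \<gamma>' u * Ln (\<gamma> u) ^ j) has_integral P (\<gamma> 1)) {0..1}"
    by (intro integral_comp) auto
  then show ?thesis by (auto simp: P_def finish)
qed

text \<open>
  The powers of \<open>Ln\<close> are not continuous at 0. The identity
  \<open>1 / (z - q) = (z / (z - q) - 1) / q\<close> splits off the part without a pole, which has an
  elementary primitive, and the rest has the continuous numerator \<open>z Ln\<^sup>j z\<close>.
\<close>

lemma pole_integral:
  assumes j: "j \<in> {1, 2}" and V: "((\<lambda>u. \<gamma>' u * (\<gamma> u * Ln (\<gamma> u) ^ j / (\<gamma> u - q))) has_integral V) {0..1}"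
    and q: "q \<noteq> 0" "q \<notin> \<gamma> ` {0<..<1}"
  shows "((\<lambda>u. \<gamma>' u * (Ln (\<gamma> u) ^ j / (\<gamma> u - q))) has_integral (V - (if j = 1 then - 1 else 2)) / q) {0..1}"
proof -
  have "((\<lambda>u. (\<gamma>' u * (\<gamma> u * Ln (\<gamma> u) ^ j / (\<gamma> u - q)) - \<gamma>' u * Ln (\<gamma> u) ^ j) / q)
      has_integral (V - (if j = 1 then - 1 else 2)) / q) {0..1}"
    by (intro has_integral_divide has_integral_diff V Ln_power_integral j)
  then show ?thesis
  proof (rule has_integral_spike_finite[rotated 2, of _ _ _ "{0, 1}"])
    fix u :: real assume "u \<in> {0..1} - {0, 1}"
    then have "\<gamma> u \<noteq> q" using q by auto
    then show "\<gamma>' u * (Ln (\<gamma> u) ^ j / (\<gamma> u - q)) =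
        (\<gamma>' u * (\<gamma> u * Ln (\<gamma> u) ^ j / (\<gamma> u - q)) - \<gamma>' u * Ln (\<gamma> u) ^ j) / q"
      using q by (simp add: divide_simps) (simp add: algebra_simps)
  qed simp
qed

lemma pole_integral_exists:
  assumes j: "j \<in> {1, 2}" and q: "q \<in> \<real>" "q \<noteq> 0" "q \<notin> \<gamma> ` {0<..<1}"
    and q': "q \<noteq> 1 \<or> \<gamma> = of_real \<and> \<gamma>' = (\<lambda>_. 1)"
  obtains V where "((\<lambda>u. \<gamma>' u * (\<gamma> u * Ln (\<gamma> u) ^ j / (\<gamma> u - q))) has_integral V) {0..1}"
proof (cases "q = 1")
  case True
  have c: "continuous_on half_strip (\<lambda>z. z * Ln z ^ j)"
    by (rule continuous_on_mult_Ln_power[OF j]) auto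
  have d: "(\<lambda>z. z * Ln z ^ j) field_differentiable (at z)" if "z \<in> half_strip" "z \<noteq> 0" for z
    by (intro derivative_intros field_differentiable_at_Ln half_strip_not_nonpos that)
  have z: "q * Ln q ^ j = 0" using True j by auto
  obtain V where V: "\<And>\<gamma> \<gamma>'. log_path \<gamma> \<gamma>' \<Longrightarrow> q \<notin> \<gamma> ` {0<..<1} \<or> (\<gamma> = (\<lambda>t. of_real t)) \<Longrightarrow>
    ((\<lambda>u. \<gamma>' u * ((\<gamma> u * Ln (\<gamma> u) ^ j) / (\<gamma> u - q))) has_integral V) {0..1}"
    by (rule path_independence_removable[OF c q(1) _ z d]) (use True in auto)
  show thesis
    by (rule that[of V], rule V[OF log_path_axioms]) (use q in auto)
next
  case False
  have ne: "\<gamma> u \<noteq> q" if "u \<in> {0..1}" for u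
    using that q False start finish by (cases "u = 0 \<or> u = 1") auto
  have "continuous_on {0..1} (\<lambda>u. \<gamma> u * Ln (\<gamma> u) ^ j)"
    by (rule continuous_on_compose2[OF continuous_on_mult_Ln_power[OF j, of half_strip] cont])
       (use in_half_strip in auto)
  then have "continuous_on {0..1} (\<lambda>u. \<gamma>' u * (\<gamma> u * Ln (\<gamma> u) ^ j / (\<gamma> u - q)))"
    by (intro continuous_on_mult[OF cont_deriv] continuous_on_divide continuous_on_diff continuous_on_const cont)
       (use ne in auto)
  then show thesis using that integrable_continuous_interval by (meson integrable_on_def)
qed

lemma depth_one:
  assumes q: "q \<in> \<real>" "q \<noteq> 0" "q \<notin> \<gamma> ` {0<..<1}"
    and q': "q \<noteq> 1 \<or> \<gamma> = of_real \<and> \<gamma>' = (\<lambda>_. 1)"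
    and V: "((\<lambda>u. \<gamma>' u * (Ln (\<gamma> u) * (Ln (\<gamma> u) - L) / (\<gamma> u - q))) has_integral V) {0..1}"
  shows "2 * iterated_integral_upto \<gamma> [0, 0, q] 1 + L * iterated_integral_upto \<gamma> [0, q] 1 = V"
proof -
  define K where "K = (\<lambda>s. \<gamma>' s / (\<gamma> s - q) * iterated_integral_upto \<gamma> [] s)"
  have "\<exists>I. ((\<lambda>u. Ln (\<gamma> u) ^ j * K u) has_integral I) {0..1}" if j: "j \<in> {1, 2}" for j
  proof -
    obtain V where V: "((\<lambda>u. \<gamma>' u * (\<gamma> u * Ln (\<gamma> u) ^ j / (\<gamma> u - q))) has_integral V) {0..1}"
      by (rule pole_integral_exists[OF j q q'])
    show ?thesis
      using pole_integral[OF j V q(2,3)] by (intro exI) (simp add: K_def mult_ac)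
  qed
  from this[of 1] this[of 2] obtain I1 I2 where
    I: "((\<lambda>u. Ln (\<gamma> u) * K u) has_integral I1) {0..1}" "((\<lambda>u. Ln (\<gamma> u) ^ 2 * K u) has_integral I2) {0..1}"
    by auto
  have "((\<lambda>u. Ln (\<gamma> u) ^ 2 * K u - L * (Ln (\<gamma> u) * K u)) has_integral (I2 - L * I1)) {0..1}"
    by (intro has_integral_diff has_integral_mult_right I)
  moreover have "(\<lambda>u. Ln (\<gamma> u) ^ 2 * K u - L * (Ln (\<gamma> u) * K u)) =
      (\<lambda>u. \<gamma>' u * (Ln (\<gamma> u) * (Ln (\<gamma> u) - L) / (\<gamma> u - q)))"
    by (auto simp: K_def power2_eq_square algebra_simps diff_divide_distrib)
  ultimately have "((\<lambda>u. \<gamma>' u * (Ln (\<gamma> u) * (Ln (\<gamma> u) - L) / (\<gamma> u - q))) has_integral (I2 - L * I1)) {0..1}"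
    by simp
  then have V_eq: "I2 - L * I1 = V" by (rule has_integral_unique[OF _ V])
  have J: "continuous_on {0..1} (iterated_integral_upto \<gamma> [])"
    by simp
  note K = pole_iterated_finish[OF q(2,3) q' J K_def]
  have iter: "iterated_integral_upto \<gamma> [0, q] 1 = - I1" "iterated_integral_upto \<gamma> [0, 0, q] 1 = I2 / 2"
    by (rule iterated_zero_Cons(1)[OF _ K(1) K(3) I(1)], simp add: K_def)
       (rule iterated_zero_Cons(2)[OF _ K(1) K(3) I], simp add: K_def)
  show ?thesis unfolding iter V_eq[symmetric] by simp
qed

end

lemma real_pole:
  fixes b :: real
  assumes "b > 0" "q = of_real b \<or> q = - of_real b"
  shows "q \<in> \<real>" "q \<noteq> 0"
    and "q \<in> complex_of_real ` {0<..<1} \<longleftrightarrow> q = of_real b \<and> b < 1"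
    and "q = 1 \<longleftrightarrow> q = of_real b \<and> b = 1"
proof -
  show "q \<in> complex_of_real ` {0<..<1} \<longleftrightarrow> q = of_real b \<and> b < 1"
    using assms by (auto simp: image_iff complex_eq_iff)
  show "q = 1 \<longleftrightarrow> q = of_real b \<and> b = 1"
    using assms by (auto simp: complex_eq_iff)
qed (use assms in auto)

text \<open>
  Collects what is needed about the prescribed path when q decides between the semicircle and
  the segment. The semicircle meets the real axis only at its ends; a negative pole or a pole at 1 goes with the
  segment.
\<close>

lemma integration_path_log_path:
  assumes b: "b > 0" and q: "q = of_real b \<or> q = - of_real b"
    and poles: "(\<exists>a\<in>set as. a \<in> complex_of_real ` {0<..<1}) \<longleftrightarrow> q \<in> complex_of_real ` {0<..<1}"
  obtains \<gamma>' where "log_path (integration_path as) \<gamma>'" "q \<notin> integration_path as ` {0<..<1}"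
    and "q \<noteq> 1 \<or> integration_path as = of_real \<and> \<gamma>' = (\<lambda>_. 1)"
    and "q = of_real b \<or> integration_path as = of_real \<and> \<gamma>' = (\<lambda>_. 1)"
proof (cases "q \<in> complex_of_real ` {0<..<1}")
  case True
  then have "integration_path as = arc" using poles by (simp add: integration_path_def)
  then show ?thesis
    using that[of "\<lambda>t. \<i> * of_real (pi / 2) * cis (pi * (t - 1))"] log_path_arc
      arc_not_real[OF real_pole(1)[OF b q]] real_pole(3,4)[OF b q] True by simp
next
  case False
  then have "integration_path as = of_real" using poles by (simp add: integration_path_def linepath_0_1)
  then show ?thesis using that[of "\<lambda>_. 1"] log_path_of_real False by simp
qed

text \<open>
  The integrand is independent of the path because \<open>ln b - Ln t\<close> vanishes at \<open>t = b\<close>. For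
  \<open>b = 1\<close> the companion term drops out.
\<close>

lemma hyperlog_depth_two:
  assumes b: "b > 0" and q: "q = of_real b \<or> q = - of_real b" and p: "p \<in> {\<i>, - \<i>}"
  shows "((\<lambda>t. (of_real (ln b) - Ln (of_real t)) * neg_dilog p (of_real t) / (of_real t - q)) has_integral
    (hyperlog [2, 2] [p, q] + of_real (ln b) * hyperlog [2, 1] [p, q])) {0..1}"
proof -
  note rp = real_pole[OF b q]
  define \<gamma> where "\<gamma> = integration_path [p, q]"
  have forms: "polylog_forms [2, 2] [p, q] = [p, 0, q, 0]" "polylog_forms [2, 1] [p, q] = [p, 0, q]"
    by (simp_all add: polylog_forms_def numeral_2_eq_2)
  have hyp: "hyperlog [2, 2] [p, q] = iterated_integral_upto \<gamma> [0, q, 0, p] 1"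
    "hyperlog [2, 1] [p, q] = iterated_integral_upto \<gamma> [q, 0, p] 1"
    unfolding hyperlog_def iterated_integral_def forms by (simp_all add: \<gamma>_def)
  have "p \<notin> \<real>" using p by (auto simp: complex_is_Real_iff)
  then have "(\<exists>a\<in>set [p, q]. a \<in> complex_of_real ` {0<..<1}) \<longleftrightarrow> q \<in> complex_of_real ` {0<..<1}"
    by auto
  then obtain \<gamma>' where path: "log_path \<gamma> \<gamma>'" and q_not: "q \<notin> \<gamma> ` {0<..<1}"
    and q': "q \<noteq> 1 \<or> \<gamma> = of_real \<and> \<gamma>' = (\<lambda>_. 1)"
    and line: "q = of_real b \<or> \<gamma> = of_real \<and> \<gamma>' = (\<lambda>_. 1)"
    by (rule integration_path_log_path[OF b q, of "[p, q]", folded \<gamma>_def]) auto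
  define L where "L = complex_of_real (ln b)"
  define N where "N = (\<lambda>z. (L - Ln z) * neg_dilog p z)"
  have N_cont: "continuous_on half_strip N"
  proof -
    have "continuous_on half_strip (\<lambda>z. L * neg_dilog p z - Ln z * neg_dilog p z)"
      by (intro continuous_intros continuous_on_Ln_mult_neg_dilog neg_dilog_cont p)
    then show ?thesis by (simp add: N_def algebra_simps)
  qed
  have line_ex: "\<exists>V. ((\<lambda>u. 1 * (N (of_real u) / (of_real u - q))) has_integral V) {0..1} \<and>
      ((\<lambda>u. \<gamma>' u * (N (\<gamma> u) / (\<gamma> u - q))) has_integral V) {0..1}"
  proof (cases "q = of_real b")
    case True
    have Nq: "N q = 0" using True b by (simp add: N_def L_def Ln_of_real)
    have dN: "N field_differentiable (at z)" if "z \<in> half_strip" "z \<noteq> 0" for z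
    proof -
      have "neg_dilog p field_differentiable (at z)"
        using neg_dilog_deriv[OF p, of z] half_strip_subset that field_differentiable_def by blast
      then show ?thesis unfolding N_def
        by (intro derivative_intros field_differentiable_at_Ln half_strip_not_nonpos that)
    qed
    obtain V where V: "\<And>\<gamma> \<gamma>'. log_path \<gamma> \<gamma>' \<Longrightarrow> q \<notin> \<gamma> ` {0<..<1} \<or> (\<gamma> = (\<lambda>t. of_real t)) \<Longrightarrow>
        ((\<lambda>u. \<gamma>' u * (N (\<gamma> u) / (\<gamma> u - q))) has_integral V) {0..1}"
      by (rule path_independence_removable[OF N_cont rp(1) _ Nq dN]) (use True b in auto)
    show ?thesis
      using V[OF log_path_of_real] V[OF path] q_not by blast
  next
    case False
    then have line: "\<gamma> = of_real" "\<gamma>' = (\<lambda>_. 1)" using line False by simp_all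
    have ne: "complex_of_real u \<noteq> q" if "u \<in> {0..1}" for u
      using that False q b by (auto simp: complex_eq_iff)
    have "continuous_on {0..1} (\<lambda>u. N (complex_of_real u))"
      by (rule continuous_on_compose2[OF N_cont]) (auto intro!: continuous_intros simp: half_strip_def)
    then have "continuous_on {0..1} (\<lambda>u. 1 * (N (of_real u) / (of_real u - q)))"
      by (intro continuous_intros) (use ne in auto)
    then have "((\<lambda>u. 1 * (N (of_real u) / (of_real u - q))) integrable_on {0..1})"
      by (rule integrable_continuous_interval)
    then show ?thesis unfolding line integrable_on_def by blast
  qed
  then obtain V where V: "((\<lambda>u. 1 * (N (of_real u) / (of_real u - q))) has_integral V) {0..1}"
    "((\<lambda>u. \<gamma>' u * (N (\<gamma> u) / (\<gamma> u - q))) has_integral V) {0..1}" by blast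
  have "hyperlog [2, 2] [p, q] + L * hyperlog [2, 1] [p, q] = V"
    unfolding hyp
  proof (rule log_path.depth_two[OF path rp(2) q_not _ p])
    show "q \<noteq> 1 \<or> \<gamma> = of_real \<and> \<gamma>' = (\<lambda>_. 1) \<and> L = 0"
      using rp(4) q' by (auto simp: L_def)
    show "((\<lambda>u. \<gamma>' u * ((L - Ln (\<gamma> u)) * neg_dilog p (\<gamma> u) / (\<gamma> u - q))) has_integral V) {0..1}"
      using V(2) by (simp add: N_def)
  qed
  then show ?thesis using V(1) by (simp add: N_def L_def)
qed

text \<open>
  As in depth two, the numerator \<open>Ln t (Ln t - ln b)\<close> vanishes at \<open>t = b\<close>; the factor \<open>Ln t\<close>
  comes from the additional forms \<open>dt/t\<close>.
\<close>

lemma hyperlog_depth_one: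
  assumes b: "b > 0" and q: "q = of_real b \<or> q = - of_real b"
  shows "((\<lambda>t. Ln (of_real t) * (Ln (of_real t) - of_real (ln b)) / (of_real t - q)) has_integral
    (2 * hyperlog [3] [q] + of_real (ln b) * hyperlog [2] [q])) {0..1}"
proof -
  note rp = real_pole[OF b q]
  define \<gamma> where "\<gamma> = integration_path [q]"
  have forms: "polylog_forms [3] [q] = [q, 0, 0]" "polylog_forms [2] [q] = [q, 0]"
    by (simp_all add: polylog_forms_def numeral_2_eq_2 numeral_3_eq_3)
  have hyp: "hyperlog [3] [q] = iterated_integral_upto \<gamma> [0, 0, q] 1"
    "hyperlog [2] [q] = iterated_integral_upto \<gamma> [0, q] 1"
    unfolding hyperlog_def iterated_integral_def forms by (simp_all add: \<gamma>_def)
  obtain \<gamma>' where path: "log_path \<gamma> \<gamma>'" and q_not: "q \<notin> \<gamma> ` {0<..<1}"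
    and q': "q \<noteq> 1 \<or> \<gamma> = of_real \<and> \<gamma>' = (\<lambda>_. 1)"
    and line: "q = of_real b \<or> \<gamma> = of_real \<and> \<gamma>' = (\<lambda>_. 1)"
    by (rule integration_path_log_path[OF b q, of "[q]", folded \<gamma>_def]) auto
  define L where "L = complex_of_real (ln b)"
  define N where "N = (\<lambda>z. z * Ln z ^ 2 - L * (z * Ln z ^ 1))"
  have N_cont: "continuous_on half_strip N"
    unfolding N_def by (intro continuous_intros continuous_on_mult_Ln_power) auto
  have line_ex: "\<exists>V. ((\<lambda>u. 1 * (Ln (of_real u) * (Ln (of_real u) - L) / (of_real u - q))) has_integral V) {0..1} \<and>
      ((\<lambda>u. \<gamma>' u * (Ln (\<gamma> u) * (Ln (\<gamma> u) - L) / (\<gamma> u - q))) has_integral V) {0..1}"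
  proof (cases "q = of_real b")
    case True
    have Nq: "N q = 0" using True b by (simp add: N_def L_def Ln_of_real power2_eq_square)
    have dN: "N field_differentiable (at z)" if "z \<in> half_strip" "z \<noteq> 0" for z
      unfolding N_def
      by (intro derivative_intros field_differentiable_at_Ln half_strip_not_nonpos that)
    obtain V where V: "\<And>\<gamma> \<gamma>'. log_path \<gamma> \<gamma>' \<Longrightarrow> q \<notin> \<gamma> ` {0<..<1} \<or> (\<gamma> = (\<lambda>t. of_real t)) \<Longrightarrow>
        ((\<lambda>u. \<gamma>' u * (N (\<gamma> u) / (\<gamma> u - q))) has_integral V) {0..1}"
      by (rule path_independence_removable[OF N_cont rp(1) _ Nq dN]) (use True b in auto)
    have *: "((\<lambda>u. g' u * (Ln (g u) * (Ln (g u) - L) / (g u - q))) has_integral (V - (2 - L * (- 1))) / q) {0..1}"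
      if g: "log_path g g'" and qg: "q \<notin> g ` {0<..<1} \<or> g = of_real" for g g'
    proof -
      have "((\<lambda>u. (g' u * (N (g u) / (g u - q)) - (g' u * Ln (g u) ^ 2 - L * (g' u * Ln (g u) ^ 1))) / q)
          has_integral (V - (2 - L * (- 1))) / q) {0..1}"
        using log_path.Ln_power_integral[OF g, of 1] log_path.Ln_power_integral[OF g, of 2]
        by (intro has_integral_divide has_integral_diff has_integral_mult_right V[OF g qg]) auto
      then show ?thesis
      proof (rule has_integral_spike_finite[rotated 2, of _ _ _ "{0, 1, b}"])
        fix u :: real assume u: "u \<in> {0..1} - {0, 1, b}"
        then have "u \<in> {0<..<1}" "u \<noteq> b" by auto
        then have "g u \<noteq> q" using qg True by (metis imageI of_real_eq_iff)
        then show "g' u * (Ln (g u) * (Ln (g u) - L) / (g u - q)) =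
            (g' u * (N (g u) / (g u - q)) - (g' u * Ln (g u) ^ 2 - L * (g' u * Ln (g u) ^ 1))) / q"
          using rp(2) by (simp add: N_def divide_simps) (simp add: algebra_simps power2_eq_square)
      qed simp
    qed
    show ?thesis
      using *[OF log_path_of_real] *[OF path] q_not by blast
  next
    case False
    then have line: "\<gamma> = of_real" "\<gamma>' = (\<lambda>_. 1)" using line False by simp_all
    have ex: "\<exists>I. ((\<lambda>u. \<gamma>' u * (Ln (\<gamma> u) ^ j / (\<gamma> u - q))) has_integral I) {0..1}" if j: "j \<in> {1, 2}" for j
      by (rule log_path.pole_integral_exists[OF path j rp(1,2) q_not q'])
         (use log_path.pole_integral[OF path j _ rp(2) q_not] in blast)
    obtain I1 I2 where "((\<lambda>u. \<gamma>' u * (Ln (\<gamma> u) ^ 1 / (\<gamma> u - q))) has_integral I1) {0..1}"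
      "((\<lambda>u. \<gamma>' u * (Ln (\<gamma> u) ^ 2 / (\<gamma> u - q))) has_integral I2) {0..1}"
      using ex[of 1] ex[of 2] by auto
    then have "((\<lambda>u. \<gamma>' u * (Ln (\<gamma> u) ^ 2 / (\<gamma> u - q)) - L * (\<gamma>' u * (Ln (\<gamma> u) ^ 1 / (\<gamma> u - q))))
        has_integral (I2 - L * I1)) {0..1}"
      by (intro has_integral_diff has_integral_mult_right)
    then have "((\<lambda>u. 1 * (Ln (of_real u) * (Ln (of_real u) - L) / (of_real u - q))) has_integral (I2 - L * I1)) {0..1}"
      by (rule has_integral_eq[rotated])
         (simp add: line power2_eq_square diff_divide_distrib algebra_simps)
    then show ?thesis unfolding line by blast
  qed
  then obtain V where V: "((\<lambda>u. 1 * (Ln (of_real u) * (Ln (of_real u) - L) / (of_real u - q))) has_integral V) {0..1}"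
      "((\<lambda>u. \<gamma>' u * (Ln (\<gamma> u) * (Ln (\<gamma> u) - L) / (\<gamma> u - q))) has_integral V) {0..1}" by blast
  have "2 * hyperlog [3] [q] + L * hyperlog [2] [q] = V"
    unfolding hyp by (rule log_path.depth_one[OF path rp(1,2) q_not q' V(2)])
  then show ?thesis using V(1) by (simp add: L_def)
qed

section \<open>Polylogarithms inside the unit disc\<close>

definition polylog :: "nat \<Rightarrow> complex \<Rightarrow> complex"
  where "polylog r z = suminf (\<lambda>n. z ^ Suc n / of_nat (Suc n) ^ r)"

lemma polylog_abs_summable:
  assumes "norm (z :: complex) < 1"
  shows "summable (\<lambda>n. norm (z ^ Suc n / of_nat (Suc n) ^ r))"
proof (rule summable_comparison_test')
  show "summable (\<lambda>n. norm z ^ n)"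
    using assms by (intro summable_geometric) simp
  fix n :: nat
  have "norm z ^ Suc n / real (Suc n) ^ r \<le> norm z ^ Suc n / 1"
    by (intro divide_left_mono) (auto simp del: power_Suc)
  also have "\<dots> \<le> norm z ^ n"
    using assms by (simp add: mult_left_le_one_le)
  finally show "norm (norm (z ^ Suc n / of_nat (Suc n) ^ r)) \<le> norm z ^ n"
    by (simp add: norm_divide norm_mult norm_power del: of_nat_Suc)
qed

lemma polylog_0: "polylog r 0 = 0"
  by (simp add: polylog_def)

lemma polylog_deriv:
  assumes "norm z < 1"
  shows "(polylog (Suc r) has_field_derivative suminf (\<lambda>n. z ^ n / of_nat (Suc n) ^ r)) (at z)"
proof -
  define c where "c = (\<lambda>n. if n = 0 then 0 else 1 / of_nat n ^ Suc r :: complex)"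
  have sm: "summable (\<lambda>n. c n * z ^ n)" if "norm z < 1" for z
  proof -
    have "summable (\<lambda>n. z ^ Suc n / of_nat (Suc n) ^ Suc r)"
      using polylog_abs_summable[OF that] by (rule summable_norm_cancel)
    then have "summable (\<lambda>n. c (Suc n) * z ^ Suc n)"
      by (simp add: c_def del: of_nat_Suc)
    then show ?thesis by (subst (asm) summable_Suc_iff)
  qed
  have eq: "suminf (\<lambda>n. c n * z ^ n) = polylog (Suc r) z" if "norm z < 1" for z
    using suminf_split_head[OF sm[OF that]] by (simp add: c_def polylog_def del: of_nat_Suc power_Suc)
  have d: "((\<lambda>z. suminf (\<lambda>n. c n * z ^ n)) has_field_derivative suminf (\<lambda>n. diffs c n * z ^ n)) (at z)"
    by (rule termdiffs_strong'[OF sm assms])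
  have "(polylog (Suc r) has_field_derivative suminf (\<lambda>n. diffs c n * z ^ n)) (at z)"
    by (rule has_field_derivative_transform_within_open[OF d, of "ball 0 1"])
       (use assms eq in auto)
  moreover have "diffs c n * z ^ n = z ^ n / of_nat (Suc n) ^ r" for n
    by (simp add: diffs_def c_def divide_simps del: of_nat_Suc)
  ultimately show ?thesis by simp
qed

lemma polylog_deriv_Suc:
  assumes "norm z < 1" "z \<noteq> 0"
  shows "(polylog (Suc r) has_field_derivative polylog r z / z) (at z)"
proof -
  have "summable (\<lambda>n. z ^ Suc n / of_nat (Suc n) ^ r)"
    using polylog_abs_summable[OF assms(1)] by (rule summable_norm_cancel)
  then have "suminf (\<lambda>n. z ^ Suc n / of_nat (Suc n) ^ r / z) = polylog r z / z"
    unfolding polylog_def by (rule suminf_divide)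
  then show ?thesis using polylog_deriv[OF assms(1), of r] assms(2) by simp
qed

lemma polylog_deriv_1:
  assumes "norm z < 1"
  shows "(polylog 1 has_field_derivative 1 / (1 - z)) (at z)"
  using polylog_deriv[OF assms, of 0] suminf_geometric[OF assms] by simp

lemma polylog_isCont: "norm z < 1 \<Longrightarrow> isCont (polylog (Suc r)) z"
  using polylog_deriv DERIV_isCont by blast

lemma multi_polylog_series_single:
  assumes x: "norm x < 1"
  shows "multi_polylog_series [r] [x] = polylog r x"
proof -
  have S: "{ks. length ks = length [r] \<and> sorted_wrt (<) (0 # ks)} = range (\<lambda>n. [Suc n])"
    by (auto simp: length_Suc_conv image_iff gr0_conv_Suc)
  have "multi_polylog_series [r] [x] = infsum ((\<lambda>ks. \<Prod>i<length [r]. [x] ! i ^ (ks ! i) / of_nat (ks ! i) ^ ([r] ! i)) \<circ> (\<lambda>n. [Suc n])) UNIV"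
    unfolding multi_polylog_series_def S by (rule infsum_reindex) (auto simp: inj_on_def)
  also have "\<dots> = infsum (\<lambda>n. x ^ Suc n / of_nat (Suc n) ^ r) UNIV"
    by (simp add: o_def)
  also have "\<dots> = polylog r x"
    unfolding polylog_def
    using norm_summable_imp_has_sum[OF polylog_abs_summable[OF x] summable_sums[OF summable_norm_cancel[OF polylog_abs_summable[OF x]]]]
    by (rule infsumI)
  finally show ?thesis .
qed

text \<open>
  The series satisfy \<open>z Li'\<^bsub>r+1\<^esub>(z) = Li\<^sub>r(z)\<close> and \<open>Li'\<^sub>1(z) = 1 / (1 - z)\<close>, which are the
  relations between successive iterated integrals along the segment. So inside the unit disc
  the series may be replaced by the hyperlogarithm that is used outside.
\<close>

lemma hyperlog_eq_polylog:
  assumes x: "norm x < 1" "x \<noteq> 0" and r: "r \<in> {2, 3}"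
  shows "hyperlog [r] [inverse x] = - polylog r x"
proof -
  interpret log_path "\<lambda>t. of_real t" "\<lambda>_. 1" by (rule log_path_of_real)
  have nx: "norm (x * of_real u) < 1" if "u \<in> {0..1}" for u
  proof -
    have "norm (x * of_real u) \<le> norm x * 1"
      unfolding norm_mult using that by (intro mult_left_mono) auto
    then show ?thesis using x by simp
  qed
  have c: "continuous_on {0..1} (\<lambda>u. - polylog (Suc r) (x * of_real u))" for r
  proof -
    have "isCont (\<lambda>u. - polylog (Suc r) (x * complex_of_real u)) u" if "u \<in> {0..1}" for u
      by (intro continuous_intros isCont_o2[OF _ polylog_isCont] nx that)
    then show ?thesis by (simp add: continuous_at_imp_continuous_on)
  qed
  have 1: "iterated_integral_upto of_real [inverse x] u = - polylog 1 (x * of_real u)" if u: "u \<in> {0..1}" for u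
  proof -
    have "((\<lambda>s. 1 * (- (1 / (1 - x * of_real s) * x))) has_integral - polylog 1 (x * of_real u)) {0..u}"
    proof (rule integral_comp[OF u, where F = "\<lambda>z. - polylog 1 (x * z)" and f = "\<lambda>z. - (1 / (1 - x * z) * x)"])
      show "((\<lambda>z. - polylog 1 (x * z)) has_field_derivative - (1 / (1 - x * of_real s) * x)) (at (of_real s))"
        if s: "s \<in> {0<..<1}" for s
        using nx[of s] s
        by (intro DERIV_minus DERIV_chain'[OF _ polylog_deriv_1, THEN DERIV_cong]) (auto intro!: derivative_eq_intros)
    qed (use c[of 0] polylog_0 in auto)
    moreover have "1 * (- (1 / (1 - x * of_real s) * x)) = 1 / (of_real s - inverse x) * 1" for s
      using x(2) by (cases "1 - x * of_real s = 0") (auto simp: field_simps)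
    ultimately show ?thesis
      by (subst iterated_Cons[OF u]) (simp add: integral_unique)
  qed
  have step: "iterated_integral_upto of_real (0 # bs) u = - polylog (Suc (Suc r)) (x * of_real u)"
    if u: "u \<in> {0..1}" and bs: "\<And>u. u \<in> {0..1} \<Longrightarrow> iterated_integral_upto of_real bs u = - polylog (Suc r) (x * of_real u)"
    for u bs r
  proof -
    have hi: "((\<lambda>s. 1 * (- polylog (Suc r) (x * of_real s) / of_real s)) has_integral - polylog (Suc (Suc r)) (x * of_real u)) {0..u}"
    proof (rule integral_comp[OF u, where F = "\<lambda>z. - polylog (Suc (Suc r)) (x * z)" and f = "\<lambda>z. - polylog (Suc r) (x * z) / z"])
      fix s :: real assume s: "s \<in> {0<..<1}"
      have "((\<lambda>z. polylog (Suc (Suc r)) (x * z)) has_field_derivative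
          polylog (Suc r) (x * of_real s) / (x * of_real s) * x) (at (of_real s))"
        by (rule DERIV_chain'[OF _ polylog_deriv_Suc]) (use nx[of s] s x in \<open>auto intro!: derivative_eq_intros\<close>)
      from DERIV_minus[OF this]
      show "((\<lambda>z. - polylog (Suc (Suc r)) (x * z)) has_field_derivative - polylog (Suc r) (x * of_real s) / of_real s) (at (of_real s))"
        using x by simp
    qed (use c[of "Suc r"] polylog_0 in auto)
    have "integral {0..u} (\<lambda>s. 1 / (of_real s - 0) * iterated_integral_upto of_real bs s) =
        integral {0..u} (\<lambda>s. 1 * (- polylog (Suc r) (x * of_real s) / of_real s))"
      by (rule integral_cong) (use u bs in auto)
    also have "\<dots> = - polylog (Suc (Suc r)) (x * of_real u)"
      by (rule integral_unique[OF hi])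
    finally show ?thesis
      by (subst iterated_Cons[OF u])
  qed
  have 2: "iterated_integral_upto of_real [0, inverse x] u = - polylog 2 (x * of_real u)" if "u \<in> {0..1}" for u
    using step[OF that, of "[inverse x]" 0] 1 by (simp add: numeral_2_eq_2)
  have 3: "iterated_integral_upto of_real [0, 0, inverse x] u = - polylog 3 (x * of_real u)" if "u \<in> {0..1}" for u
    using step[OF that, of "[0, inverse x]" 1] 2 by (simp add: numeral_2_eq_2 numeral_3_eq_3)
  have path: "integration_path [inverse x] = of_real"
  proof -
    have "inverse x \<notin> complex_of_real ` {0<..<1}"
    proof
      assume "inverse x \<in> complex_of_real ` {0<..<1}"
      then have "norm (inverse x) < 1" by auto
      moreover have "norm (inverse x) > 1"
        using x by (simp add: norm_inverse one_less_inverse)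
      ultimately show False by simp
    qed
    then show ?thesis by (simp add: integration_path_def linepath_0_1)
  qed
  have forms: "polylog_forms [3] [inverse x] = [inverse x, 0, 0]" "polylog_forms [2] [inverse x] = [inverse x, 0]"
    by (simp_all add: polylog_forms_def numeral_2_eq_2 numeral_3_eq_3)
  show ?thesis
    using r 2[of 1] 3[of 1] unfolding hyperlog_def path iterated_integral_def by (auto simp: forms)
qed

lemma multi_polylog_single:
  assumes "x \<noteq> 0" "r \<in> {2, 3}"
  shows "multi_polylog [r] [x] = - hyperlog [r] [inverse x]"
  using multi_polylog_series_single[of x r] hyperlog_eq_polylog[OF _ assms]
  by (cases "norm x < 1") (simp_all add: multi_polylog_def)

section \<open>The polylogarithmic side as real integrals\<close>

definition Ti2 :: "real \<Rightarrow> real"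
  where "Ti2 y = integral {0..y} (\<lambda>u. arctan u / u)"

text \<open>
  The singularity at \<open>t = b\<close> is removable; the default value 0 of the quotient there is immaterial
  under an integral.
\<close>

definition log_kernel :: "real \<Rightarrow> real \<Rightarrow> real"
  where "log_kernel b t = (ln t - ln b) / (t\<^sup>2 - b\<^sup>2)"

lemma Ln_1_plus_i: "Ln (1 + \<i> * of_real u) = Complex (ln (sqrt (1 + u\<^sup>2))) (arctan u)"
proof (rule Ln_unique)
  have p: "1 + u\<^sup>2 > 0" by (simp add: add_pos_nonneg)
  then have "exp (ln (sqrt (1 + u\<^sup>2))) = sqrt (1 + u\<^sup>2)" by simp
  then show "exp (Complex (ln (sqrt (1 + u\<^sup>2))) (arctan u)) = 1 + \<i> * of_real u"
    using p by (auto simp: complex_eq_iff Re_exp Im_exp cos_arctan sin_arctan)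
qed (use arctan_bounded[of u] pi_gt_zero in \<open>auto simp del: pi_gt_zero\<close>)

lemma Ln_diff: "Ln (1 - \<i> * of_real u) - Ln (1 + \<i> * of_real u) = - 2 * \<i> * of_real (arctan u)"
  using Ln_1_plus_i[of u] Ln_1_plus_i[of "- u"]
  by (simp add: complex_eq_iff arctan_minus)

text \<open>
  The innermost forms \<open>dt/(t + \<i>)\<close> and \<open>dt/(t - \<i>)\<close> differ by \<open>-2\<i> dt/(1 + t\<^sup>2)\<close>.
\<close>

lemma neg_dilog_diff:
  assumes u: "u \<in> {0..1}"
  shows "neg_dilog (- \<i>) (of_real u) - neg_dilog \<i> (of_real u) = - 2 * \<i> * of_real (Ti2 u)"
proof -
  interpret log_path "\<lambda>t. of_real t" "\<lambda>_. 1" by (rule log_path_of_real)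
  define D where "D = (\<lambda>z. (neg_dilog (- \<i>) z - neg_dilog \<i> z) / (- 2 * \<i>))"
  have "((\<lambda>s. 1 * ((Ln (1 - of_real s / (- \<i>)) / of_real s - Ln (1 - of_real s / \<i>) / of_real s) / (- 2 * \<i>)))
      has_integral D (of_real u)) {0..u}"
  proof (rule integral_comp[OF u, where F = D and
      f = "\<lambda>s. (Ln (1 - s / (- \<i>)) / s - Ln (1 - s / \<i>) / s) / (- 2 * \<i>)"])
    have "continuous_on half_strip D"
      unfolding D_def by (intro continuous_intros neg_dilog_cont) auto
    then show "continuous_on {0..1} (\<lambda>u. D (of_real u))"
      by (rule continuous_on_compose2[OF _ cont]) (use in_half_strip in auto)
    show "(D has_field_derivative
        (Ln (1 - of_real s / (- \<i>)) / of_real s - Ln (1 - of_real s / \<i>) / of_real s) / (- 2 * \<i>)) (at (of_real s))"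
      if s: "s \<in> {0<..<1}" for s
    proof -
      have "(neg_dilog (- \<i>) has_field_derivative Ln (1 - of_real s / (- \<i>)) / of_real s) (at (of_real s))"
        "(neg_dilog \<i> has_field_derivative Ln (1 - of_real s / \<i>) / of_real s) (at (of_real s))"
        using neg_dilog_deriv[of "- \<i>" "of_real s"] neg_dilog_deriv[of "\<i>" "of_real s"] in_strip[of s] s by auto
      then show ?thesis unfolding D_def by (intro DERIV_cdivide DERIV_diff)
    qed
  qed (simp add: D_def neg_dilog_0)
  moreover have "1 * ((Ln (1 - of_real s / (- \<i>)) / of_real s - Ln (1 - of_real s / \<i>) / of_real s) / (- 2 * \<i>)) =
      of_real (arctan s / s)" for s :: real
    using Ln_diff[of s] by (simp add: diff_divide_distrib[symmetric] mult.commute)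
  ultimately have *: "((\<lambda>s. complex_of_real (arctan s / s)) has_integral D (of_real u)) {0..u}" by simp
  from has_integral_linear[OF this bounded_linear_Re]
  have "((\<lambda>s. arctan s / s) has_integral Re (D (of_real u))) {0..u}" by (simp add: o_def)
  then have "((\<lambda>s. arctan s / s) has_integral Ti2 u) {0..u}" by (simp add: Ti2_def integral_unique)
  from has_integral_unique[OF * has_integral_of_real[OF this]]
  show ?thesis by (simp add: D_def field_simps)
qed

lemma has_integral_complex_of_real:
  assumes "((\<lambda>t. complex_of_real (f t)) has_integral V) S"
  shows "V = of_real (Re V)" "(f has_integral Re V) S"
proof -
  show *: "(f has_integral Re V) S"
    using has_integral_linear[OF assms bounded_linear_Re] by (simp add: o_def)
  show "V = of_real (Re V)"
    using has_integral_unique[OF assms has_integral_of_real[OF *]] .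
qed

text \<open>
  The four sign choices of \<open>S2\<close> give the poles \<open>\<plusminus>\<i>\<close> and \<open>\<plusminus>b\<close> with the signs that produce
  \<open>1/(t - b) - 1/(t + b) = 2b / (t\<^sup>2 - b\<^sup>2)\<close> and the difference of the two dilogarithms.
\<close>

lemma depth_two_real:
  assumes b: "b > 0"
  shows "\<exists>A. ((\<lambda>t. Ti2 t * log_kernel b t) has_integral A) {0..1} \<and>
    S2 2 2 b \<i> 1 + of_real (ln b) * S2 2 1 b \<i> 1 = 4 * \<i> * of_real (b * A)"
proof -
  have hyp: "S2 2 s b \<i> 1 = hyperlog [2, s] [- \<i>, of_real b] - hyperlog [2, s] [\<i>, of_real b]
      + hyperlog [2, s] [\<i>, - of_real b] - hyperlog [2, s] [- \<i>, - of_real b]" for s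
  proof -
    have big: "\<not> (norm (of_real b :: complex) < 1 \<and> norm (1 / of_real b :: complex) < 1)"
      using b by (auto simp: norm_divide field_simps)
    have i: "inverse \<i> = - \<i>" by (simp add: complex_eq_iff)
    have ml: "multi_polylog [2, s] [p * of_real b, c / of_real b] = hyperlog [2, s] [inverse (p * c), of_real b / c]"
      if "norm p = 1" "norm c = 1" for p c
      using b big that by (auto simp: multi_polylog_def norm_mult norm_divide field_simps)
    show ?thesis
      using ml[of \<i> 1] ml[of "- \<i>" 1] ml[of \<i> "-1"] ml[of "- \<i>" "-1"]
      by (simp add: S2_def mult.commute i)
  qed
  let ?I = "\<lambda>p q t. (of_real (ln b) - Ln (of_real t)) * neg_dilog p (of_real t) / (of_real t - q)"
  let ?D = "\<lambda>t. ?I (- \<i>) (of_real b) t - ?I \<i> (of_real b) t + ?I \<i> (- of_real b) t - ?I (- \<i>) (- of_real b) t"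
  let ?H = "\<lambda>p q. hyperlog [2, 2] [p, q] + of_real (ln b) * hyperlog [2, 1] [p, q]"
  have "(?D has_integral (?H (- \<i>) (of_real b) - ?H \<i> (of_real b) + ?H \<i> (- of_real b) - ?H (- \<i>) (- of_real b))) {0..1}"
    by (intro has_integral_add has_integral_diff hyperlog_depth_two b) auto
  also have "?H (- \<i>) (of_real b) - ?H \<i> (of_real b) + ?H \<i> (- of_real b) - ?H (- \<i>) (- of_real b)
     = S2 2 2 b \<i> 1 + of_real (ln b) * S2 2 1 b \<i> 1"
    unfolding hyp by (simp add: algebra_simps)
  finally have 1: "(?D has_integral (S2 2 2 b \<i> 1 + of_real (ln b) * S2 2 1 b \<i> 1)) {0..1}" .
  define X where "X = S2 2 2 b \<i> 1 + of_real (ln b) * S2 2 1 b \<i> 1"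
  have "((\<lambda>t. ?D t / (4 * \<i> * b)) has_integral
    X / (4 * \<i> * b)) {0..1}"
    unfolding X_def by (intro has_integral_divide 1)
  then have 2: "((\<lambda>t. complex_of_real (Ti2 t * log_kernel b t)) has_integral X / (4 * \<i> * b)) {0..1}"
  proof (rule has_integral_spike_finite[rotated 2, of _ _ _ "{0, b}"])
    fix t assume t: "t \<in> {0..1} - {0, b}"
    define c where "c = complex_of_real (Ti2 t)"
    have D: "neg_dilog (- \<i>) (of_real t) = neg_dilog \<i> (of_real t) - 2 * \<i> * c"
      using neg_dilog_diff[of t] t by (simp add: c_def algebra_simps)
    have n: "complex_of_real t - of_real b \<noteq> 0" "complex_of_real t + of_real b \<noteq> 0"
      using t b by (auto simp flip: of_real_add)
    then have n2: "(complex_of_real t)\<^sup>2 - (of_real b)\<^sup>2 \<noteq> 0"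
      by (simp add: power2_eq_square square_diff_square_factored)
    define l where "l = complex_of_real (ln b) - of_real (ln t)"
    have L: "of_real (ln b) - Ln (of_real t) = l"
      using t by (simp add: l_def Ln_of_real)
    have k: "complex_of_real (Ti2 t * log_kernel b t) = c * (- l / ((of_real t)\<^sup>2 - (of_real b)\<^sup>2))"
      by (simp add: log_kernel_def c_def l_def)
    have "1 / (complex_of_real t - of_real b) - 1 / (of_real t + of_real b) = 2 * of_real b / ((of_real t)\<^sup>2 - (of_real b)\<^sup>2)"
      using n n2 by (simp add: field_simps power2_eq_square)
    moreover have "?D t
        = l * (- 2 * \<i> * c) * (1 / (complex_of_real t - of_real b) - 1 / (of_real t + of_real b))"
      unfolding L D by (simp add: algebra_simps diff_divide_distrib add_divide_distrib)
    ultimately show "complex_of_real (Ti2 t * log_kernel b t) = ?D t / (4 * \<i> * b)"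
      unfolding k using b by simp
  qed simp
  show ?thesis
  proof (intro exI conjI)
    show "((\<lambda>t. Ti2 t * log_kernel b t) has_integral Re (X / (4 * \<i> * b))) {0..1}"
      by (rule has_integral_complex_of_real(2)[OF 2])
    have "X = 4 * \<i> * b * (X / (4 * \<i> * b))" using b by simp
    also have "X / (4 * \<i> * b) = of_real (Re (X / (4 * \<i> * b)))"
      by (rule has_integral_complex_of_real(1)[OF 2])
    finally show "S2 2 2 b \<i> 1 + of_real (ln b) * S2 2 1 b \<i> 1 = 4 * \<i> * of_real (b * Re (X / (4 * \<i> * b)))"
      unfolding X_def[symmetric] of_real_mult by (simp only: mult.assoc)
  qed
qed

text \<open>
  Here the pole is \<open>b = 1/a\<close>, so that \<open>ln b = - ln a\<close>.
\<close>

lemma depth_one_real: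
  assumes a: "a > 0"
  shows "\<exists>A. ((\<lambda>t. - ln t * log_kernel (1 / a) t) has_integral A) {0..1} \<and>
    2 * L1 a 3 1 - L1_log a 2 1 = of_real (2 / a * A)"
proof -
  define b where "b = 1 / a"
  have b: "b > 0" "inverse (complex_of_real a) = of_real b" "ln b = - ln a"
    using a by (simp_all add: b_def inverse_eq_divide ln_div)
  have L: "L1 a r 1 = hyperlog [r] [- of_real b] - hyperlog [r] [of_real b]" if "r \<in> {2, 3}" for r
    using multi_polylog_single[of "of_real a" r] multi_polylog_single[of "- of_real a" r] that a b
    by (simp add: L1_def)
  have LL: "L1_log a 2 1 = of_real (ln a) * L1 a 2 1" by (simp add: L1_log_def L1_def)
  let ?I = "\<lambda>q t. Ln (of_real t) * (Ln (of_real t) - of_real (ln b)) / (of_real t - q)"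
  define X where "X = 2 * L1 a 3 1 - L1_log a 2 1"
  have "((\<lambda>t. (?I (- of_real b) t - ?I (of_real b) t) / (2 * b)) has_integral
      ((2 * hyperlog [3] [- of_real b] + of_real (ln b) * hyperlog [2] [- of_real b]) -
       (2 * hyperlog [3] [of_real b] + of_real (ln b) * hyperlog [2] [of_real b])) / (2 * b)) {0..1}"
    by (intro has_integral_divide has_integral_diff hyperlog_depth_one b(1)) auto
  also have "(2 * hyperlog [3] [- of_real b] + of_real (ln b) * hyperlog [2] [- of_real b]) -
       (2 * hyperlog [3] [of_real b] + of_real (ln b) * hyperlog [2] [of_real b]) = X"
    unfolding X_def LL L[of 2, simplified] L[of 3, simplified] b(3) by (simp add: algebra_simps)
  finally have 2: "((\<lambda>t. complex_of_real (- ln t * log_kernel b t)) has_integral X / (2 * b)) {0..1}"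
  proof (rule has_integral_spike_finite[rotated 2, of _ _ _ "{0, b}"])
    fix t assume t: "t \<in> {0..1} - {0, b}"
    define l where "l = complex_of_real (ln t)"
    define m where "m = complex_of_real (ln t) - of_real (ln b)"
    have n: "complex_of_real t - of_real b \<noteq> 0" "complex_of_real t + of_real b \<noteq> 0"
      using t b by (auto simp flip: of_real_add)
    then have n2: "(complex_of_real t)\<^sup>2 - (of_real b)\<^sup>2 \<noteq> 0"
      by (simp add: power2_eq_square square_diff_square_factored)
    have k: "complex_of_real (- ln t * log_kernel b t) = - (l * m / ((of_real t)\<^sup>2 - (of_real b)\<^sup>2))"
      by (simp add: log_kernel_def l_def m_def)
    have "1 / (of_real t + of_real b) - 1 / (complex_of_real t - of_real b) = - (2 * of_real b / ((of_real t)\<^sup>2 - (of_real b)\<^sup>2))"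
      using n n2 by (simp add: field_simps power2_eq_square)
    moreover have "?I (- of_real b) t - ?I (of_real b) t =
        l * m * (1 / (of_real t + of_real b) - 1 / (complex_of_real t - of_real b))"
      using t by (simp add: l_def m_def Ln_of_real algebra_simps diff_divide_distrib add_divide_distrib)
    ultimately show "complex_of_real (- ln t * log_kernel b t) = (?I (- of_real b) t - ?I (of_real b) t) / (2 * b)"
      unfolding k using b by simp
  qed simp
  show ?thesis
  proof (intro exI conjI)
    show "((\<lambda>t. - ln t * log_kernel (1 / a) t) has_integral Re (X / (2 * b))) {0..1}"
      using has_integral_complex_of_real(2)[OF 2] by (simp add: b_def)
    have "X = 2 * b * (X / (2 * b))" using b by simp
    also have "X / (2 * b) = of_real (Re (X / (2 * b)))"
      by (rule has_integral_complex_of_real(1)[OF 2])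
    finally show "2 * L1 a 3 1 - L1_log a 2 1 = of_real (2 / a * Re (X / (2 * b)))"
      unfolding X_def[symmetric] by (simp add: b_def)
  qed
qed

section \<open>Substitutions in integrals over the half-line\<close>

lemma nn_integral_incseq_indicator:
  fixes h :: "'a \<Rightarrow> ennreal"
  assumes A: "incseq A" "\<And>n. A n \<in> sets M" and h[measurable]: "h \<in> borel_measurable M"
  shows "(\<integral>\<^sup>+x. h x * indicator (\<Union>n. A n) x \<partial>M) = (SUP n. \<integral>\<^sup>+x. h x * indicator (A n) x \<partial>M)"
proof -
  have [measurable]: "A n \<in> sets M" for n using A(2) .
  have "(\<integral>\<^sup>+x. (SUP n. h x * indicator (A n) x) \<partial>M) = (SUP n. \<integral>\<^sup>+x. h x * indicator (A n) x \<partial>M)"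
    using A(1) by (intro nn_integral_monotone_convergence_SUP)
      (auto simp: incseq_def le_fun_def intro!: mult_left_mono split: split_indicator)
  moreover have "(SUP n. h x * indicator (A n) x) = h x * indicator (\<Union>n. A n) x" for x
    by (auto simp: indicator_def intro!: antisym SUP_least SUP_upper2)
  ultimately show ?thesis by simp
qed

text \<open>
  Substitution on compact intervals passes to an increasing union by monotone convergence.
\<close>

lemma nn_integral_substitution_UN:
  fixes f :: "real \<Rightarrow> ennreal" and g g' :: "real \<Rightarrow> real"
  assumes f[measurable]: "f \<in> borel_measurable borel"
    and ab: "\<And>n. a n < b n" "incseq (\<lambda>n. {a n..b n})" "incseq (\<lambda>n. {g (a n)..g (b n)})"
    and g: "\<And>n x. x \<in> {a n..b n} \<Longrightarrow> (g has_real_derivative g' x) (at x)"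
    and g'_cont: "\<And>n. continuous_on {a n..b n} g'" and g'_pos: "\<And>n x. x \<in> {a n..b n} \<Longrightarrow> 0 \<le> g' x"
    and meas[measurable]: "g \<in> borel_measurable borel" "g' \<in> borel_measurable borel"
  shows "(\<integral>\<^sup>+x. f x * indicator (\<Union>n. {g (a n)..g (b n)}) x \<partial>lborel) =
    (\<integral>\<^sup>+x. f (g x) * ennreal (g' x) * indicator (\<Union>n. {a n..b n}) x \<partial>lborel)"
proof -
  have "(\<integral>\<^sup>+x. f x * indicator (\<Union>n. {g (a n)..g (b n)}) x \<partial>lborel) =
      (SUP n. \<integral>\<^sup>+x. f x * indicator {g (a n)..g (b n)} x \<partial>lborel)"
    by (rule nn_integral_incseq_indicator[OF ab(3)]) auto
  also have "\<dots> = (SUP n. \<integral>\<^sup>+x. f (g x) * ennreal (g' x) * indicator {a n..b n} x \<partial>lborel)"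
    using nn_integral_substitution_aux[OF f _ g g'_cont g'_pos ab(1)] by simp
  also have "\<dots> = (\<integral>\<^sup>+x. f (g x) * ennreal (g' x) * indicator (\<Union>n. {a n..b n}) x \<partial>lborel)"
    by (rule nn_integral_incseq_indicator[OF ab(2), symmetric]) auto
  finally show ?thesis .
qed

definition cauchy_weight :: "real \<Rightarrow> ennreal"
  where "cauchy_weight t = ennreal (1 / (1 + t\<^sup>2)) * indicator {0<..} t"

lemma cauchy_weight_measurable[measurable]: "cauchy_weight \<in> borel_measurable borel"
  unfolding cauchy_weight_def by measurable

lemma borel_measurable_tan[measurable]: "(tan :: real \<Rightarrow> real) \<in> borel_measurable borel"
  unfolding tan_def by measurable

lemma tan_substitution_half:
  fixes f :: "real \<Rightarrow> ennreal"
  assumes f[measurable]: "f \<in> borel_measurable borel"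
  shows "(\<integral>\<^sup>+x. f \<bar>tan (x / 2)\<bar> * indicator {0..<pi} x \<partial>lborel) = 2 * (\<integral>\<^sup>+t. f t * cauchy_weight t \<partial>lborel)"
proof -
  have U1: "(\<Union>n. {2 * arctan 0..2 * arctan (real (Suc n))}) = {0..<pi}"
  proof -
    have "\<exists>n. x \<le> 2 * arctan (real (Suc n))" if "0 \<le> x" "x < pi" for x
    proof -
      obtain n where "tan (x / 2) < real n" using reals_Archimedean2 by blast
      then have "arctan (tan (x / 2)) \<le> arctan (real (Suc n))" by (simp add: arctan_le_iff)
      moreover have "arctan (tan (x / 2)) = x / 2" by (rule arctan_tan) (use that in auto)
      ultimately show ?thesis by (intro exI[of _ n]) simp
    qed
    moreover have "2 * arctan y < pi" for y using arctan_ubound[of y] by simp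
    ultimately show ?thesis by (fastforce intro: le_less_trans)
  qed
  have U2: "(\<Union>n. {0..real (Suc n)}) = {0..}"
  proof -
    have "\<exists>n. x \<le> real (Suc n)" for x
    proof -
      obtain n where "x \<le> real n" using real_arch_simple by blast
      then have "x \<le> real (Suc n)" by simp
      then show ?thesis by blast
    qed
    then show ?thesis by (auto simp del: of_nat_Suc)
  qed
  have "(\<integral>\<^sup>+x. f \<bar>tan (x / 2)\<bar> * indicator (\<Union>n. {2 * arctan 0..2 * arctan (real (Suc n))}) x \<partial>lborel) =
     (\<integral>\<^sup>+t. f \<bar>tan ((2 * arctan t) / 2)\<bar> * ennreal (2 / (1 + t\<^sup>2)) * indicator (\<Union>n. {0..real (Suc n)}) t \<partial>lborel)"
  proof (rule nn_integral_substitution_UN)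
    show "((\<lambda>t. 2 * arctan t) has_real_derivative 2 / (1 + x\<^sup>2)) (at x)" for x
      by (auto intro!: derivative_eq_intros simp: inverse_eq_divide)
    show "continuous_on {0..real (Suc n)} (\<lambda>x. 2 / (1 + x\<^sup>2))" for n
      by (intro continuous_intros) (smt (verit) zero_le_power2)
    show "incseq (\<lambda>n. {2 * arctan 0..2 * arctan (real (Suc n))})"
      by (auto simp: incseq_def arctan_le_iff intro: order_trans)
  qed (auto simp: incseq_def)
  also have "\<dots> = (\<integral>\<^sup>+t. 2 * (f t * cauchy_weight t) \<partial>lborel)"
  proof (rule nn_integral_cong_AE)
    have "AE t in lborel. t \<noteq> (0 :: real)" by (rule AE_lborel_singleton)
    then show "AE t in lborel. f \<bar>tan ((2 * arctan t) / 2)\<bar> * ennreal (2 / (1 + t\<^sup>2)) * indicator (\<Union>n. {0..real (Suc n)}) t =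
       2 * (f t * cauchy_weight t)"
    proof eventually_elim
      case (elim t)
      have "ennreal (2 / (1 + t\<^sup>2)) = 2 * ennreal (1 / (1 + t\<^sup>2))"
        using ennreal_mult[of 2 "1 / (1 + t\<^sup>2)"] by (simp add: ennreal_numeral)
      then show ?case unfolding U2 using elim
        by (auto simp: tan_arctan cauchy_weight_def mult_ac split: split_indicator)
    qed
  qed
  also have "\<dots> = 2 * (\<integral>\<^sup>+t. f t * cauchy_weight t \<partial>lborel)"
    by (rule nn_integral_cmult) auto
  finally show ?thesis unfolding U1 .
qed

text \<open>
  \<open>t = \<bar>tan (x/2)\<bar>\<close> runs twice through the positive half-line, and \<open>dx = 2 dt / (1 + t\<^sup>2)\<close>.
\<close>

lemma tan_substitution:
  fixes f :: "real \<Rightarrow> ennreal"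
  assumes f[measurable]: "f \<in> borel_measurable borel"
  shows "(\<integral>\<^sup>+x. f \<bar>tan (x / 2)\<bar> * indicator {0..2 * pi} x \<partial>lborel) = 4 * (\<integral>\<^sup>+t. f t * cauchy_weight t \<partial>lborel)"
proof -
  have refl: "(\<integral>\<^sup>+x. f \<bar>tan (x / 2)\<bar> * indicator {pi<..2 * pi} x \<partial>lborel) =
      (\<integral>\<^sup>+x. f \<bar>tan (x / 2)\<bar> * indicator {0..<pi} x \<partial>lborel)"
  proof -
    have t: "\<bar>tan (pi - x / 2)\<bar> = \<bar>tan (x / 2)\<bar>" for x
      by (simp add: tan_def)
    have "(\<integral>\<^sup>+x. f \<bar>tan (x / 2)\<bar> * indicator {pi<..2 * pi} x \<partial>lborel) =
      (\<integral>\<^sup>+x. f \<bar>tan ((2 * pi + (- 1) * x) / 2)\<bar> * indicator {pi<..2 * pi} (2 * pi + (- 1) * x) \<partial>lborel)"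
      by (subst nn_integral_real_affine[of _ "- 1" "2 * pi"]) auto
    also have "\<dots> = (\<integral>\<^sup>+x. f \<bar>tan (x / 2)\<bar> * indicator {0..<pi} x \<partial>lborel)"
      by (rule nn_integral_cong) (auto simp: diff_divide_distrib t split: split_indicator)
    finally show ?thesis .
  qed
  have "(\<integral>\<^sup>+x. f \<bar>tan (x / 2)\<bar> * indicator {0..2 * pi} x \<partial>lborel) =
      (\<integral>\<^sup>+x. f \<bar>tan (x / 2)\<bar> * indicator {0..<pi} x + f \<bar>tan (x / 2)\<bar> * indicator {pi<..2 * pi} x \<partial>lborel)"
  proof (rule nn_integral_cong_AE)
    have "AE x in lborel. x \<noteq> pi" by (rule AE_lborel_singleton)
    then show "AE x in lborel. f \<bar>tan (x / 2)\<bar> * indicator {0..2 * pi} x =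
        f \<bar>tan (x / 2)\<bar> * indicator {0..<pi} x + f \<bar>tan (x / 2)\<bar> * indicator {pi<..2 * pi} x"
      by eventually_elim (use pi_gt_zero in \<open>auto split: split_indicator\<close>)
  qed
  also have "\<dots> = (\<integral>\<^sup>+x. f \<bar>tan (x / 2)\<bar> * indicator {0..<pi} x \<partial>lborel) + (\<integral>\<^sup>+x. f \<bar>tan (x / 2)\<bar> * indicator {pi<..2 * pi} x \<partial>lborel)"
    by (rule nn_integral_add) auto
  also have "\<dots> = 4 * (\<integral>\<^sup>+t. f t * cauchy_weight t \<partial>lborel)"
    unfolding refl tan_substitution_half[OF f] by (simp flip: distrib_right mult.assoc)
  finally show ?thesis .
qed

section \<open>The inverse tangent integral\<close>

lemma arctan_div_cont: "continuous_on UNIV (\<lambda>u :: real. if u = 0 then 1 else arctan u / u)"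
proof -
  have "(arctan has_real_derivative 1) (at 0)"
    by (auto intro!: derivative_eq_intros)
  then have "continuous_on UNIV (\<lambda>u :: real. if u = 0 then 1 else arctan u / (u - 0))"
    by (intro continuous_on_removable continuous_intros) auto
  then show ?thesis unfolding diff_0_right .
qed

lemma Ti2_has_integral: "((\<lambda>u. arctan u / u) has_integral Ti2 y) {0..y}"
proof -
  have "(\<lambda>u :: real. if u = 0 then 1 else arctan u / u) integrable_on {0..y}"
    by (rule integrable_continuous_interval, rule continuous_on_subset[OF arctan_div_cont]) auto
  then have "(\<lambda>u. arctan u / u) integrable_on {0..y}"
    by (rule integrable_spike[where S = "{0}"]) auto
  then show ?thesis unfolding Ti2_def by (rule integrable_integral)
qed

lemma Ti2_nonneg: "0 \<le> Ti2 y"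
  using has_integral_nonneg[OF Ti2_has_integral[of y]] by simp

lemma Ti2_eq: "Ti2 y = integral {0..y} (\<lambda>u :: real. if u = 0 then 1 else arctan u / u)"
  unfolding Ti2_def by (rule integral_spike[where S = "{0}"]) auto

lemma Ti2_deriv:
  assumes "y > 0" shows "(Ti2 has_real_derivative arctan y / y) (at y)"
proof -
  have "((\<lambda>y. integral {0..y} (\<lambda>u :: real. if u = 0 then 1 else arctan u / u)) has_real_derivative
      (if y = 0 then 1 else arctan y / y)) (at y within {0..y + 1})"
    by (rule integral_has_real_derivative)
       (use assms in \<open>auto intro: continuous_on_subset[OF arctan_div_cont]\<close>)
  then have "(Ti2 has_real_derivative arctan y / y) (at y within {0..y + 1})"
    using assms by (simp add: Ti2_eq[abs_def])
  moreover have "at y within {0..y + 1} = at y"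
    using assms by (intro at_within_interior) (simp add: interior_atLeastAtMost_real)
  ultimately show ?thesis by simp
qed

lemma Ti2_measurable[measurable]: "Ti2 \<in> borel_measurable borel"
proof -
  have "continuous_on {0<..} Ti2"
    by (intro continuous_at_imp_continuous_on ballI DERIV_isCont[OF Ti2_deriv]) auto
  then have "(\<lambda>x. if x \<in> {0<..} then Ti2 x else 0) \<in> borel_measurable borel"
    by (intro borel_measurable_continuous_on_if) auto
  moreover have "Ti2 = (\<lambda>x. if x \<in> {0<..} then Ti2 x else 0)"
    by (auto simp: Ti2_def fun_eq_iff not_less le_less)
  ultimately show ?thesis by simp
qed

lemma Ti2_inverse:
  assumes u: "u > 0" shows "Ti2 (1 / u) = Ti2 u - pi / 2 * ln u"
proof -
  define F where "F = (\<lambda>u. Ti2 (1 / u) - Ti2 u + pi / 2 * ln u)"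
  have "(F has_real_derivative 0) (at x)" if "x > 0" for x
  proof -
    have "(F has_real_derivative (arctan (1 / x) / (1 / x)) * (- 1 / x\<^sup>2) - arctan x / x + pi / 2 * (1 / x)) (at x)"
      unfolding F_def using that
      by (auto intro!: derivative_eq_intros DERIV_chain2[OF Ti2_deriv] Ti2_deriv simp: power2_eq_square)
    moreover have "(arctan (1 / x) / (1 / x)) * (- 1 / x\<^sup>2) - arctan x / x + pi / 2 * (1 / x) = 0"
    proof -
      have "arctan (1 / x) = pi / 2 - arctan x" using arctan_inverse[of x] that by (simp add: inverse_eq_divide)
      then show ?thesis using that by (simp only:) (simp add: field_simps power2_eq_square)
    qed
    ultimately show ?thesis by simp
  qed
  then have const: "F u = F 1"
  proof -
    have "\<exists>c. \<forall>x\<in>{0<..}. F x = c"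
    proof (rule has_field_derivative_zero_constant)
      fix x :: real assume "x \<in> {0<..}"
      then show "(F has_field_derivative 0) (at x within {0<..})"
        using \<open>\<And>x. x > 0 \<Longrightarrow> (F has_real_derivative 0) (at x)\<close>
        by (auto intro: has_field_derivative_at_within)
    qed (simp add: convex_real_interval)
    then show ?thesis using u by auto
  qed
  then show ?thesis by (simp add: F_def)
qed

definition log_plus :: "real \<Rightarrow> real" where "log_plus x = max 0 (ln x)"

lemma log_plus_measurable[measurable]: "log_plus \<in> borel_measurable borel"
  unfolding log_plus_def by measurable

text \<open>
  \<open>log\<^sup>+ (y t)\<close> is the integral of \<open>du/u\<close> from \<open>1/t\<close> to y, a range that is described
  symmetrically in t and u to allow an exchange of integrals.
\<close>

lemma log_plus_nn_integral:
  assumes t: "t > 0" and y: "y \<ge> 0"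
  shows "ennreal (log_plus (y * t)) = (\<integral>\<^sup>+u. ennreal (1 / u) * indicator {u. 0 < u \<and> u \<le> y \<and> 1 \<le> u * t} u \<partial>lborel)"
proof (cases "1 \<le> y * t")
  case True
  then have y0: "y > 0" using t y by (cases "y = 0") auto
  have le: "1 / t \<le> y" using True t by (simp add: field_simps)
  have "((\<lambda>u. 1 / u) has_integral (ln y - ln (1 / t))) {1 / t..y}"
  proof (rule fundamental_theorem_of_calculus[OF le])
    fix x assume "x \<in> {1 / t..y}"
    moreover have "1 / t > 0" using t by simp
    ultimately have "x > 0" by (meson atLeastAtMost_iff less_le_trans)
    then show "(ln has_vector_derivative 1 / x) (at x within {1 / t..y})"
      by (auto intro!: derivative_eq_intros simp flip: has_real_derivative_iff_has_vector_derivative)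
  qed
  then have "(\<integral>\<^sup>+u. ennreal (1 / u) * indicator {1 / t..y} u \<partial>lborel) = ennreal (ln y - ln (1 / t))"
    by (rule nn_integral_has_integral_lebesgue'[rotated]) (use t in \<open>auto intro: order_trans[rotated]\<close>)
  moreover have "{1 / t..y} = {u. 0 < u \<and> u \<le> y \<and> 1 \<le> u * t}"
    using t by (auto simp: field_simps) (smt (verit) mult_nonneg_nonneg mult_nonpos_nonneg)
  moreover have "ln y - ln (1 / t) = log_plus (y * t)"
    using ln_ge_zero[OF True] t y0 by (simp add: log_plus_def ln_mult ln_div max_absorb2)
  ultimately show ?thesis by simp
next
  case False
  have "{u. 0 < u \<and> u \<le> y \<and> 1 \<le> u * t} = {}"
    using False t by (auto simp: not_le) (meson less_le_trans linorder_not_le mult_right_mono order_less_imp_le)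
  moreover have "ln (y * t) \<le> 0"
    using False y t by (cases "y = 0") (auto simp: not_le intro!: ln_le_zero_iff[THEN iffD2])
  ultimately show ?thesis by (simp add: log_plus_def)
qed

text \<open>
  After the exchange of integrals, the inner one is the weight of \<open>[1/u, \<infinity>)\<close>, which is
  \<open>\<pi>/2 - arctan (1/u) = arctan u\<close>.
\<close>

lemma cauchy_log_plus:
  assumes y: "y \<ge> 0"
  shows "(\<integral>\<^sup>+t. ennreal (log_plus (y * t)) * cauchy_weight t \<partial>lborel) = ennreal (Ti2 y)"
proof -
  let ?h = "\<lambda>t u. ennreal (1 / u) * indicator {u. 0 < u \<and> u \<le> y \<and> 1 \<le> u * t} u * cauchy_weight t"
  have "(\<integral>\<^sup>+t. ennreal (log_plus (y * t)) * cauchy_weight t \<partial>lborel) =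
      (\<integral>\<^sup>+t. (\<integral>\<^sup>+u. ?h t u \<partial>lborel) \<partial>lborel)"
  proof (rule nn_integral_cong)
    fix t :: real
    show "ennreal (log_plus (y * t)) * cauchy_weight t =
      (\<integral>\<^sup>+u. ?h t u \<partial>lborel)"
    proof (cases "t > 0")
      case True
      then show ?thesis
        using log_plus_nn_integral[OF True y] by (subst nn_integral_multc) auto
    qed (simp add: cauchy_weight_def)
  qed
  also have "\<dots> = (\<integral>\<^sup>+u. (\<integral>\<^sup>+t. ?h t u \<partial>lborel) \<partial>lborel)"
    by (rule lborel_pair.Fubini') measurable
  also have "\<dots> = (\<integral>\<^sup>+u. ennreal (arctan u / u) * indicator {0..y} u \<partial>lborel)"
  proof (rule nn_integral_cong_AE)
    have "AE u in lborel. u \<noteq> (0 :: real)" by (rule AE_lborel_singleton)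
    then show "AE u in lborel. (\<integral>\<^sup>+t. ?h t u \<partial>lborel) =
        ennreal (arctan u / u) * indicator {0..y} u"
    proof eventually_elim
      case (elim u)
      show ?case
      proof (cases "u \<in> {0..y}")
        case True
        then have u: "u > 0" "u \<le> y" using elim by auto
        have "(\<integral>\<^sup>+t. ?h t u \<partial>lborel) =
          (\<integral>\<^sup>+t. ennreal (1 / u) * (ennreal (1 / (1 + t\<^sup>2)) * indicator {1 / u..} t) \<partial>lborel)"
        proof (rule nn_integral_cong)
          fix t :: real
          have "1 / u > 0" using u by simp
          then have "\<not> 1 / u \<le> t" if "\<not> t > 0" using that by linarith
          moreover have "1 \<le> u * t \<longleftrightarrow> 1 / u \<le> t" using u by (simp add: field_simps)
          ultimately show "?h t u =
            ennreal (1 / u) * (ennreal (1 / (1 + t\<^sup>2)) * indicator {1 / u..} t)"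
            using u by (cases "t > 0") (simp_all add: cauchy_weight_def indicator_def)
        qed
        also have "\<dots> = ennreal (1 / u) * (\<integral>\<^sup>+t. ennreal (1 / (1 + t\<^sup>2)) * indicator {1 / u..} t \<partial>lborel)"
          by (rule nn_integral_cmult) auto
        also have "(\<integral>\<^sup>+t. ennreal (1 / (1 + t\<^sup>2)) * indicator {1 / u..} t \<partial>lborel) = ennreal (pi / 2 - arctan (1 / u))"
          by (rule nn_integral_FTC_atLeast)
             (auto intro!: derivative_eq_intros tendsto_arctan_at_top simp: inverse_eq_divide)
        also have "pi / 2 - arctan (1 / u) = arctan u"
          using u arctan_inverse[of u] by (simp add: inverse_eq_divide)
        also have "ennreal (1 / u) * ennreal (arctan u) = ennreal (arctan u / u)"
          using u by (simp flip: ennreal_mult)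
        finally show ?thesis using True by simp
      qed auto
    qed
  qed
  also have "\<dots> = ennreal (Ti2 y)"
    by (rule nn_integral_has_integral_lebesgue'[OF _ Ti2_has_integral]) auto
  finally show ?thesis .
qed

section \<open>The product of three Cauchy weights\<close>

lemma log_kernel_nonneg:
  assumes "b > 0" "t > 0" shows "0 \<le> log_kernel b t"
proof -
  consider "t = b" | "t < b" | "t > b" by linarith
  then show ?thesis
  proof cases
    case 2
    then have "ln t \<le> ln b" "t\<^sup>2 \<le> b\<^sup>2" using assms by (auto intro!: power_mono)
    then show ?thesis unfolding log_kernel_def by (intro divide_nonpos_nonpos) auto
  next
    case 3
    then have "ln t \<ge> ln b" "t\<^sup>2 \<ge> b\<^sup>2" using assms by (auto intro!: power_mono)
    then show ?thesis unfolding log_kernel_def by (intro divide_nonneg_nonneg) auto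
  qed (simp add: log_kernel_def)
qed

lemma log_kernel_measurable[measurable]: "log_kernel b \<in> borel_measurable borel"
  unfolding log_kernel_def[abs_def] by measurable

text \<open>
  Multiplicative convolution of the Cauchy weight with itself. By partial fractions,
  \<open>s / ((1 + s\<^sup>2) (s\<^sup>2 + z\<^sup>2))\<close> has the logarithmic primitive F, up to a factor \<open>z\<^sup>2 - 1\<close> that
  excludes \<open>z = 1\<close>.
\<close>

lemma cauchy_convolution:
  assumes z: "z > 0" "z \<noteq> 1"
  shows "(\<integral>\<^sup>+s. ennreal (1 / s) * cauchy_weight (z / s) * cauchy_weight s \<partial>lborel) = ennreal (log_kernel 1 z)"
proof -
  define F where "F = (\<lambda>t. (ln (1 + t\<^sup>2) - ln (t\<^sup>2 + z\<^sup>2)) / (2 * (z\<^sup>2 - 1)))"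
  have z2: "z\<^sup>2 - 1 \<noteq> 0" using z by (simp add: power2_eq_1_iff)
  have p: "1 + s\<^sup>2 > 0" "s\<^sup>2 + z\<^sup>2 > 0" for s
    using z by (simp_all add: add_pos_nonneg add_nonneg_pos)
  have "(\<integral>\<^sup>+s. ennreal (1 / s) * cauchy_weight (z / s) * cauchy_weight s \<partial>lborel) =
      (\<integral>\<^sup>+s. ennreal (s / ((1 + s\<^sup>2) * (s\<^sup>2 + z\<^sup>2))) * indicator {0..} s \<partial>lborel)"
  proof (rule nn_integral_cong)
    fix s :: real
    consider "s > 0" | "s < 0" | "s = 0" by linarith
    then show "ennreal (1 / s) * cauchy_weight (z / s) * cauchy_weight s =
        ennreal (s / ((1 + s\<^sup>2) * (s\<^sup>2 + z\<^sup>2))) * indicator {0..} s"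
    proof cases
      case 1
      have "1 / s * (1 / (1 + (z / s)\<^sup>2)) * (1 / (1 + s\<^sup>2)) = s / ((1 + s\<^sup>2) * (s\<^sup>2 + z\<^sup>2))"
      proof -
        have "1 + (z / s)\<^sup>2 = (s\<^sup>2 + z\<^sup>2) / s\<^sup>2" using 1 by (simp add: field_simps)
        then show ?thesis using 1 by (simp add: power2_eq_square)
      qed
      then show ?thesis
        using 1 z by (simp add: cauchy_weight_def flip: ennreal_mult)
    qed (auto simp: cauchy_weight_def)
  qed
  also have "\<dots> = ennreal (0 - F 0)"
  proof (rule nn_integral_FTC_atLeast)
    show "(F has_real_derivative s / ((1 + s\<^sup>2) * (s\<^sup>2 + z\<^sup>2))) (at s)" for s
    proof -
      have "(F has_real_derivative (2 * s / (1 + s\<^sup>2) - 2 * s / (s\<^sup>2 + z\<^sup>2)) / (2 * (z\<^sup>2 - 1))) (at s)"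
        unfolding F_def using p[of s] z2 by (auto intro!: derivative_eq_intros)
      also have "2 * s / (1 + s\<^sup>2) - 2 * s / (s\<^sup>2 + z\<^sup>2) = 2 * s * (z\<^sup>2 - 1) / ((1 + s\<^sup>2) * (s\<^sup>2 + z\<^sup>2))"
      proof -
        have ne: "1 + s\<^sup>2 \<noteq> 0" "s\<^sup>2 + z\<^sup>2 \<noteq> 0" using p[of s] by auto
        show ?thesis unfolding diff_frac_eq[OF ne]
          by (rule arg_cong2[where f = "(/)"]) (simp_all add: algebra_simps)
      qed
      also have "2 * s * (z\<^sup>2 - 1) / ((1 + s\<^sup>2) * (s\<^sup>2 + z\<^sup>2)) / (2 * (z\<^sup>2 - 1)) = s / ((1 + s\<^sup>2) * (s\<^sup>2 + z\<^sup>2))"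
        using z2 by (simp only: divide_divide_eq_left) (simp add: divide_simps)
      finally show ?thesis .
    qed
    show "(F \<longlongrightarrow> 0) at_top"
    proof -
      have "((\<lambda>t. ln (1 + t\<^sup>2) - ln (t\<^sup>2 + z\<^sup>2)) \<longlongrightarrow> 0) at_top"
        using z by real_asymp
      from tendsto_divide[OF this tendsto_const[of "2 * (z\<^sup>2 - 1)"]] show ?thesis
        using z2 by (simp add: F_def)
    qed
  qed (use p in \<open>auto intro!: divide_nonneg_nonneg mult_nonneg_nonneg less_imp_le\<close>)
  also have "0 - F 0 = (2 * ln z) / (2 * (z\<^sup>2 - 1))"
    using z by (simp add: F_def ln_realpow)
  also have "\<dots> = log_kernel 1 z"
    unfolding log_kernel_def by (subst mult_divide_mult_cancel_left) auto
  finally show ?thesis .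
qed

lemma cauchy_double:
  fixes h :: "real \<Rightarrow> ennreal"
  assumes h[measurable]: "h \<in> borel_measurable borel"
  shows "(\<integral>\<^sup>+s. (\<integral>\<^sup>+t. h (s * t) * cauchy_weight t \<partial>lborel) * cauchy_weight s \<partial>lborel) =
    (\<integral>\<^sup>+z. h z * (ennreal (log_kernel 1 z) * indicator {0<..} z) \<partial>lborel)"
proof -
  let ?w = "\<lambda>z s. ennreal (1 / s) * cauchy_weight (z / s) * cauchy_weight s"
  have "(\<integral>\<^sup>+s. (\<integral>\<^sup>+t. h (s * t) * cauchy_weight t \<partial>lborel) * cauchy_weight s \<partial>lborel) =
    (\<integral>\<^sup>+s. (\<integral>\<^sup>+z. h z * indicator {0<..} z * ?w z s \<partial>lborel) \<partial>lborel)"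
  proof (rule nn_integral_cong)
    fix s :: real
    show "(\<integral>\<^sup>+t. h (s * t) * cauchy_weight t \<partial>lborel) * cauchy_weight s =
      (\<integral>\<^sup>+z. h z * indicator {0<..} z * ?w z s \<partial>lborel)"
    proof (cases "s > 0")
      case True
      have "(\<integral>\<^sup>+z. h z * indicator {0<..} z * ?w z s \<partial>lborel) =
        ennreal \<bar>s\<bar> * (\<integral>\<^sup>+t. h (0 + s * t) * indicator {0<..} (0 + s * t) * (ennreal (1 / s) * cauchy_weight ((0 + s * t) / s) * cauchy_weight s) \<partial>lborel)"
        by (rule nn_integral_real_affine) (use True in auto)
      also have "\<dots> = ennreal \<bar>s\<bar> * (\<integral>\<^sup>+t. (h (s * t) * cauchy_weight t) * (ennreal (1 / s) * cauchy_weight s) \<partial>lborel)"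
      proof (rule arg_cong2[where f = "(*)"], rule refl, rule nn_integral_cong)
        fix t :: real
        show "h (0 + s * t) * indicator {0<..} (0 + s * t) * (ennreal (1 / s) * cauchy_weight ((0 + s * t) / s) * cauchy_weight s) =
            (h (s * t) * cauchy_weight t) * (ennreal (1 / s) * cauchy_weight s)"
          using True by (cases "t > 0") (simp_all add: mult_ac, simp add: cauchy_weight_def)
      qed
      also have "\<dots> = ennreal \<bar>s\<bar> * ((\<integral>\<^sup>+t. h (s * t) * cauchy_weight t \<partial>lborel) * (ennreal (1 / s) * cauchy_weight s))"
        by (subst nn_integral_multc) auto
      also have "\<dots> = (ennreal \<bar>s\<bar> * ennreal (1 / s)) * ((\<integral>\<^sup>+t. h (s * t) * cauchy_weight t \<partial>lborel) * cauchy_weight s)"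
        by (simp add: mult_ac)
      also have "ennreal \<bar>s\<bar> * ennreal (1 / s) = 1"
        using True by (simp flip: ennreal_mult)
      finally show ?thesis by simp
    qed (simp add: cauchy_weight_def)
  qed
  also have "\<dots> = (\<integral>\<^sup>+z. (\<integral>\<^sup>+s. h z * indicator {0<..} z * ?w z s \<partial>lborel) \<partial>lborel)"
    by (rule lborel_pair.Fubini') measurable
  also have "\<dots> = (\<integral>\<^sup>+z. h z * (ennreal (log_kernel 1 z) * indicator {0<..} z) \<partial>lborel)"
  proof (rule nn_integral_cong_AE)
    have "AE z in lborel. z \<noteq> (1 :: real)" by (rule AE_lborel_singleton)
    then show "AE z in lborel. (\<integral>\<^sup>+s. h z * indicator {0<..} z * ?w z s \<partial>lborel) =
        h z * (ennreal (log_kernel 1 z) * indicator {0<..} z)"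
    proof eventually_elim
      case (elim z)
      have "(\<integral>\<^sup>+s. h z * indicator {0<..} z * ?w z s \<partial>lborel) =
        h z * indicator {0<..} z * (\<integral>\<^sup>+s. ?w z s \<partial>lborel)"
        by (rule nn_integral_cmult) auto
      then show ?case
        using cauchy_convolution[of z] elim by (auto split: split_indicator)
    qed
  qed
  finally show ?thesis .
qed

lemma nn_integral_inversion:
  fixes f :: "real \<Rightarrow> ennreal"
  assumes f[measurable]: "f \<in> borel_measurable borel"
  shows "(\<integral>\<^sup>+s. f s * indicator {1..} s \<partial>lborel) =
    (\<integral>\<^sup>+u. f (1 / u) * ennreal (1 / u\<^sup>2) * indicator {0<..1} u \<partial>lborel)"
proof -
  have ex: "\<exists>n. x \<le> real n + 2" for x
  proof -
    obtain n where "x \<le> real n" using real_arch_simple by blast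
    then have "x \<le> real n + 2" by simp
    then show ?thesis by blast
  qed
  have U1: "(\<Union>n. {- (1 / (1 / (real n + 2)))..- (1 / 1)}) = {..- 1}"
  proof -
    have "\<exists>n. - real n - 2 \<le> x" for x
      using ex[of "- x"] by (metis add.inverse_inverse minus_add_distrib neg_le_iff_le uminus_add_conv_diff diff_conv_add_uminus)
    then show ?thesis by auto
  qed
  have U2: "(\<Union>n. {1 / (real n + 2)..1}) = {0<..1}"
  proof -
    have "\<exists>n. 1 / (real n + 2) \<le> x" if "x > 0" for x
    proof -
      obtain n where "1 / x \<le> real n + 2" using ex by blast
      then show ?thesis using that by (intro exI[of _ n]) (simp add: field_simps)
    qed
    moreover have "0 < x" if "1 / (real n + 2) \<le> x" for n x
      using that by (rule less_le_trans[rotated]) simp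
    ultimately show ?thesis by auto
  qed
  have "(\<integral>\<^sup>+s. f s * indicator {1..} s \<partial>lborel) = (\<integral>\<^sup>+s. f (0 + (- 1) * s) * indicator {1..} (0 + (- 1) * s) \<partial>lborel)"
    by (subst nn_integral_real_affine[of _ "- 1" 0]) auto
  also have "\<dots> = (\<integral>\<^sup>+s. f (- s) * indicator (\<Union>n. {- (1 / (1 / (real n + 2)))..- (1 / 1)}) s \<partial>lborel)"
    unfolding U1 by (rule nn_integral_cong) (auto split: split_indicator)
  also have "\<dots> = (\<integral>\<^sup>+u. f (- (- (1 / u))) * ennreal (1 / u\<^sup>2) * indicator (\<Union>n. {1 / (real n + 2)..1}) u \<partial>lborel)"
  proof (rule nn_integral_substitution_UN)
    fix n :: nat and x :: real assume "x \<in> {1 / (real n + 2)..1}"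
    moreover have "0 < 1 / (real n + 2)" by simp
    ultimately have "x > 0" unfolding atLeastAtMost_iff by linarith
    then show "((\<lambda>u. - (1 / u)) has_real_derivative 1 / x\<^sup>2) (at x)"
      by (auto intro!: derivative_eq_intros simp: power2_eq_square)
  next
    fix n :: nat
    have "x \<noteq> 0" if "x \<in> {1 / (real n + 2)..1}" for x
    proof -
      have "0 < 1 / (real n + 2)" by simp
      then show ?thesis using that unfolding atLeastAtMost_iff by linarith
    qed
    then show "continuous_on {1 / (real n + 2)..1} (\<lambda>u. 1 / u\<^sup>2)"
      by (intro continuous_intros) auto
  next
    have "1 / (real n + 2) \<le> 1 / (real m + 2)" if "m \<le> n" for m n
      using that by (intro divide_left_mono) auto
    then show "incseq (\<lambda>n. {1 / (real n + 2)..1})"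
      by (auto simp: incseq_def intro: order_trans)
  qed (auto simp: incseq_def)
  finally show ?thesis unfolding U2 by simp
qed

text \<open>
  The kernels for a and \<open>1/a\<close> are exchanged by \<open>t \<mapsto> 1/t\<close>, which makes folding at 1 possible.
\<close>

lemma log_kernel_inverse:
  assumes "a > 0" "u > 0"
  shows "log_kernel a (1 / u) * (1 / u\<^sup>2) = (1 / a)\<^sup>2 * log_kernel (1 / a) u"
proof -
  have 1: "((1 / u)\<^sup>2 - a\<^sup>2) * u\<^sup>2 = 1 - a\<^sup>2 * u\<^sup>2" "a\<^sup>2 * (u\<^sup>2 - (1 / a)\<^sup>2) = - (1 - a\<^sup>2 * u\<^sup>2)"
    using assms by (simp_all add: field_simps)
  have "log_kernel a (1 / u) * (1 / u\<^sup>2) = (- ln u - ln a) / (((1 / u)\<^sup>2 - a\<^sup>2) * u\<^sup>2)"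
    using assms by (simp add: log_kernel_def ln_div)
  moreover have "(1 / a)\<^sup>2 * log_kernel (1 / a) u = (ln u + ln a) / (a\<^sup>2 * (u\<^sup>2 - (1 / a)\<^sup>2))"
    using assms by (simp add: log_kernel_def ln_div power_divide)
  moreover have "(- ln u - ln a) / (1 - a\<^sup>2 * u\<^sup>2) = (- (- ln u - ln a)) / (- (1 - a\<^sup>2 * u\<^sup>2))"
    by (simp only: minus_divide_left[symmetric] minus_divide_right[symmetric] minus_minus)
  ultimately show ?thesis unfolding 1 by simp
qed

text \<open>
  The part over \<open>[1, \<infinity>)\<close> is brought to [0,1] by inversion. All three integrands are nonnegative on
  [0,1], also at 0, where \<open>Ti2\<close> vanishes and the default value \<open>ln 0 = 0\<close> is harmless.
\<close>

lemma Ti2_log_kernel_nn_integral: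
  assumes a: "a > 0"
    and A1: "((\<lambda>t. Ti2 t * log_kernel a t) has_integral A1) {0..1}"
    and A2: "((\<lambda>t. Ti2 t * log_kernel (1 / a) t) has_integral A2) {0..1}"
    and A3: "((\<lambda>t. - ln t * log_kernel (1 / a) t) has_integral A3) {0..1}"
  defines "A \<equiv> A1 + (1 / a)\<^sup>2 * (A2 + pi / 2 * A3)"
  shows "(\<integral>\<^sup>+s. ennreal (Ti2 s * log_kernel a s) * indicator {0<..} s \<partial>lborel) = ennreal A" and "0 \<le> A"
proof -
  let ?g = "\<lambda>t. (1 / a)\<^sup>2 * (Ti2 t * log_kernel (1 / a) t + pi / 2 * (- ln t * log_kernel (1 / a) t))" and ?f = "\<lambda>s. ennreal (Ti2 s * log_kernel a s)"
  let ?B = "(1 / a)\<^sup>2 * (A2 + pi / 2 * A3)"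
  have Ti2_0: "Ti2 0 = 0" by (simp add: Ti2_def)
  have nonneg1: "0 \<le> Ti2 t * log_kernel b t" if "t \<in> {0..1}" "b > 0" for t b
    using Ti2_nonneg[of t] log_kernel_nonneg[of b t] that Ti2_0 by (cases "t = 0") auto
  have nonneg2: "0 \<le> - ln t * log_kernel b t" if "t \<in> {0..1}" "b > 0" for t b
    using log_kernel_nonneg[of b t] that by (cases "t = 0") (auto simp: mult_nonpos_nonneg)
  have P1: "(\<integral>\<^sup>+s. ?f s * indicator {0..1} s \<partial>lborel) = ennreal A1"
    by (rule nn_integral_has_integral_lebesgue'[OF nonneg1 A1]) (use a in auto)
  have I2: "((\<lambda>t. ?g t)
      has_integral ?B) {0..1}"
    by (intro has_integral_mult_right has_integral_add A2 A3)
  have nonneg3: "0 \<le> ?g t"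
    if "t \<in> {0..1}" for t
  proof -
    have n: "0 \<le> Ti2 t * log_kernel (1 / a) t" "0 \<le> - ln t * log_kernel (1 / a) t"
      using nonneg1[OF that, of "1 / a"] nonneg2[OF that, of "1 / a"] a by auto
    show ?thesis
      by (intro mult_nonneg_nonneg[OF zero_le_power2] add_nonneg_nonneg[OF n(1)] mult_nonneg_nonneg[OF _ n(2)]) simp
  qed
  have P2: "(\<integral>\<^sup>+t. ennreal (?g t) * indicator {0..1} t \<partial>lborel)
      = ennreal (?B)"
    by (rule nn_integral_has_integral_lebesgue'[OF nonneg3 I2])
  have "(\<integral>\<^sup>+s. ?f s * indicator {1..} s \<partial>lborel) =
      (\<integral>\<^sup>+u. ennreal (Ti2 (1 / u) * log_kernel a (1 / u)) * ennreal (1 / u\<^sup>2) * indicator {0<..1} u \<partial>lborel)"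
    by (rule nn_integral_inversion) auto
  also have "\<dots> = (\<integral>\<^sup>+t. ennreal (?g t) * indicator {0..1} t \<partial>lborel)"
  proof (rule nn_integral_cong_AE)
    have "AE u in lborel. u \<noteq> (0 :: real)" by (rule AE_lborel_singleton)
    then show "AE u in lborel. ennreal (Ti2 (1 / u) * log_kernel a (1 / u)) * ennreal (1 / u\<^sup>2) * indicator {0<..1} u =
        ennreal (?g u) * indicator {0..1} u"
    proof eventually_elim
      case (elim u)
      show ?case
      proof (cases "u \<in> {0..1}")
        case True
        then have u: "u > 0" using elim by auto
        have "Ti2 (1 / u) * log_kernel a (1 / u) * (1 / u\<^sup>2) = (Ti2 u - pi / 2 * ln u) * ((1 / a)\<^sup>2 * log_kernel (1 / a) u)"
          by (simp only: mult.assoc log_kernel_inverse[OF a u] Ti2_inverse[OF u])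
        also have "\<dots> = ?g u"
          by (simp add: algebra_simps)
        finally have eq: "Ti2 (1 / u) * log_kernel a (1 / u) * (1 / u\<^sup>2) =
            ?g u" .
        have "ennreal (Ti2 (1 / u) * log_kernel a (1 / u)) * ennreal (1 / u\<^sup>2) =
            ennreal (Ti2 (1 / u) * log_kernel a (1 / u) * (1 / u\<^sup>2))"
          by (rule ennreal_mult[symmetric]) (use u a Ti2_nonneg log_kernel_nonneg in auto)
        then show ?thesis using True u unfolding eq by simp
      qed auto
    qed
  qed
  also note P2
  finally have P3: "(\<integral>\<^sup>+s. ?f s * indicator {1..} s \<partial>lborel) = ennreal (?B)" .
  have pos: "0 \<le> A1" "0 \<le> ?B"
    using has_integral_nonneg[OF A1 nonneg1] has_integral_nonneg[OF I2 nonneg3] a by auto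
  then show "0 \<le> A" by (simp add: A_def)
  have "(\<integral>\<^sup>+s. ?f s * indicator {0<..} s \<partial>lborel) =
     (\<integral>\<^sup>+s. ?f s * indicator {0..1} s + ?f s * indicator {1..} s \<partial>lborel)"
  proof (rule nn_integral_cong_AE)
    have "AE u in lborel. u \<noteq> (0 :: real)" "AE u in lborel. u \<noteq> (1 :: real)" by (rule AE_lborel_singleton)+
    then show "AE s in lborel. ?f s * indicator {0<..} s =
      ?f s * indicator {0..1} s + ?f s * indicator {1..} s"
      by eventually_elim (auto split: split_indicator)
  qed
  also have "\<dots> = ennreal A1 + ennreal (?B)"
    by (subst nn_integral_add) (auto simp: P1 P3)
  also have "\<dots> = ennreal A"
    unfolding A_def using pos by (rule ennreal_plus[symmetric])
  finally show "(\<integral>\<^sup>+s. ?f s * indicator {0<..} s \<partial>lborel) = ennreal A" .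
qed

definition tan_half :: "real \<Rightarrow> real"
  where "tan_half x = \<bar>tan (x / 2)\<bar>"

lemma tan_half_measurable[measurable]: "tan_half \<in> borel_measurable borel"
  unfolding tan_half_def[abs_def] by measurable

lemma tan_half_nonneg: "0 \<le> tan_half x" by (simp add: tan_half_def)

text \<open>
  Each angle contributes a factor 4, whence 64; the remaining factor a comes from rescaling
  the variable of integration to \<open>s = a z\<close>.
\<close>

lemma triple_log_plus:
  assumes a: "a > 0"
  shows "(\<integral>\<^sup>+x. (\<integral>\<^sup>+y. (\<integral>\<^sup>+z. ennreal (log_plus (a * tan_half x * tan_half y * tan_half z)) * indicator {0..2 * pi} z \<partial>lborel)
       * indicator {0..2 * pi} y \<partial>lborel) * indicator {0..2 * pi} x \<partial>lborel) =
     ennreal (64 * a) * (\<integral>\<^sup>+s. ennreal (Ti2 s * log_kernel a s) * indicator {0<..} s \<partial>lborel)"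
    (is "?lhs = _ * ?R")
proof -
  have 1: "(\<integral>\<^sup>+z. ennreal (log_plus (c * tan_half z)) * indicator {0..2 * pi} z \<partial>lborel) = 4 * ennreal (Ti2 c)" if "c \<ge> 0" for c
    using tan_substitution[of "\<lambda>t. ennreal (log_plus (c * t))"] cauchy_log_plus[OF that] by (simp add: tan_half_def)
  have 2: "(\<integral>\<^sup>+y. (4 * ennreal (Ti2 (c * tan_half y))) * indicator {0..2 * pi} y \<partial>lborel) =
      16 * (\<integral>\<^sup>+t. ennreal (Ti2 (c * t)) * cauchy_weight t \<partial>lborel)" for c
    using tan_substitution[of "\<lambda>t. 4 * ennreal (Ti2 (c * t))"]
    by (simp add: tan_half_def nn_integral_cmult mult.assoc)
  have 3: "(\<integral>\<^sup>+x. (16 * (\<integral>\<^sup>+t. ennreal (Ti2 (a * tan_half x * t)) * cauchy_weight t \<partial>lborel)) * indicator {0..2 * pi} x \<partial>lborel) =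
      64 * (\<integral>\<^sup>+s. (\<integral>\<^sup>+t. ennreal (Ti2 (a * s * t)) * cauchy_weight t \<partial>lborel) * cauchy_weight s \<partial>lborel)"
    using tan_substitution[of "\<lambda>s. 16 * (\<integral>\<^sup>+t. ennreal (Ti2 (a * s * t)) * cauchy_weight t \<partial>lborel)"]
    by (simp add: tan_half_def nn_integral_cmult mult.assoc)
  have 4: "(\<integral>\<^sup>+s. (\<integral>\<^sup>+t. ennreal (Ti2 (a * s * t)) * cauchy_weight t \<partial>lborel) * cauchy_weight s \<partial>lborel) =
      (\<integral>\<^sup>+z. ennreal (Ti2 (a * z)) * (ennreal (log_kernel 1 z) * indicator {0<..} z) \<partial>lborel)"
    using cauchy_double[of "\<lambda>z. ennreal (Ti2 (a * z))"] by (simp add: mult.assoc)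
  have 5: "(\<integral>\<^sup>+z. ennreal (Ti2 (a * z)) * (ennreal (log_kernel 1 z) * indicator {0<..} z) \<partial>lborel) =
      ennreal a * ?R"
  proof -
    have "?R = ennreal \<bar>a\<bar> * (\<integral>\<^sup>+z. ennreal (Ti2 (0 + a * z) * log_kernel a (0 + a * z)) * indicator {0<..} (0 + a * z) \<partial>lborel)"
      by (rule nn_integral_real_affine) (use a in auto)
    then have "ennreal a * ?R =
        ennreal (a * a) * (\<integral>\<^sup>+z. ennreal (Ti2 (a * z) * log_kernel a (a * z)) * indicator {0<..} (a * z) \<partial>lborel)"
      using a by (simp add: ennreal_mult mult.assoc)
    also have "\<dots> = (\<integral>\<^sup>+z. ennreal (a * a) * (ennreal (Ti2 (a * z) * log_kernel a (a * z)) * indicator {0<..} (a * z)) \<partial>lborel)"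
      by (rule nn_integral_cmult[symmetric]) auto
    also have "\<dots> = (\<integral>\<^sup>+z. ennreal (Ti2 (a * z)) * (ennreal (log_kernel 1 z) * indicator {0<..} z) \<partial>lborel)"
    proof (rule nn_integral_cong)
      fix z :: real
      show "ennreal (a * a) * (ennreal (Ti2 (a * z) * log_kernel a (a * z)) * indicator {0<..} (a * z)) =
        ennreal (Ti2 (a * z)) * (ennreal (log_kernel 1 z) * indicator {0<..} z)"
      proof (cases "z > 0")
        case True
        have "(a * z)\<^sup>2 - a\<^sup>2 = a\<^sup>2 * (z\<^sup>2 - 1)" by (simp add: algebra_simps power_mult_distrib)
        then have "log_kernel a (a * z) = ln z / (a\<^sup>2 * (z\<^sup>2 - 1))"
          using True a by (simp add: log_kernel_def ln_mult)
        then have "a * a * log_kernel a (a * z) = log_kernel 1 z"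
          using a by (simp add: log_kernel_def power2_eq_square)
        then have k: "a * a * (Ti2 (a * z) * log_kernel a (a * z)) = Ti2 (a * z) * log_kernel 1 z"
          by (metis mult.left_commute)
        have "ennreal (a * a) * ennreal (Ti2 (a * z) * log_kernel a (a * z)) = ennreal (a * a * (Ti2 (a * z) * log_kernel a (a * z)))"
          using True a Ti2_nonneg log_kernel_nonneg[of a "a * z"] by (intro ennreal_mult[symmetric]) auto
        also have "\<dots> = ennreal (Ti2 (a * z)) * ennreal (log_kernel 1 z)"
          unfolding k using True Ti2_nonneg log_kernel_nonneg[of 1 z] by (intro ennreal_mult) auto
        finally show ?thesis using True a by simp
      next
        case False
        then have "\<not> a * z > 0" using a by (simp add: zero_less_mult_iff)
        then show ?thesis using False by simp
      qed
    qed
    finally show ?thesis ..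
  qed
  have "?lhs = 64 * (ennreal a * ?R)"
    using a tan_half_nonneg by (simp only: 1 2 3 4 5 mult_nonneg_nonneg less_imp_le)
  also have "\<dots> = ennreal (64 * a) * ?R"
    using a by (simp add: ennreal_mult mult.assoc ennreal_numeral)
  finally show ?thesis .
qed

section \<open>Jensen's formula\<close>

lemma zeros_countable: "countable {t. 1 + c * cis t = 0}"
proof (cases "\<exists>s. 1 + c * cis s = 0")
  case True
  then obtain s where s: "1 + c * cis s = 0" by blast
  have "{t. 1 + c * cis t = 0} \<subseteq> range (\<lambda>n :: int. s + 2 * pi * n)"
  proof
    fix t assume "t \<in> {t. 1 + c * cis t = 0}"
    then have "c * cis t = c * cis s" "c \<noteq> 0" using s
      by (auto simp: add_eq_0_iff)
    then have "cis t = cis s" by simp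
    then have "sin t = sin s \<and> cos t = cos s" by (simp add: complex_eq_iff)
    then show "t \<in> range (\<lambda>n :: int. s + 2 * pi * n)"
      by (auto simp: sin_cos_eq_iff)
  qed
  then show ?thesis by (rule countable_subset) auto
next
  case False
  then have "{t. 1 + c * cis t = 0} = {}" by auto
  then show ?thesis by simp
qed

lemma AE_nonzero: "AE t in lborel. 1 + c * cis t \<noteq> 0"
  using AE_not_in[OF countable_imp_null_set_lborel[OF zeros_countable[of c]]] by simp

text \<open>
  Mean value property of \<open>Ln (1 + c u)\<close>, holomorphic on the closed unit disc.
\<close>

lemma ln_norm_has_integral_less:
  assumes c: "norm c < 1"
  shows "((\<lambda>t. ln (norm (1 + c * cis t))) has_integral 0) {0..2 * pi}"
proof -
  have nz: "1 + c * u \<notin> \<real>\<^sub>\<le>\<^sub>0" if "norm u \<le> 1" for u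
  proof
    assume "1 + c * u \<in> \<real>\<^sub>\<le>\<^sub>0"
    then have "Re (c * u) \<le> - 1" by (simp add: complex_nonpos_Reals_iff)
    then have "1 \<le> norm (c * u)" using abs_Re_le_cmod[of "c * u"] by linarith
    also have "\<dots> \<le> norm c * 1" unfolding norm_mult using that by (intro mult_left_mono) auto
    finally show False using c by simp
  qed
  have "(\<lambda>u. Ln (1 + c * u)) holomorphic_on cball 0 1"
    by (intro holomorphic_intros) (use nz in auto)
  then have "((\<lambda>u. Ln (1 + c * u) / (u - 0)) has_contour_integral (2 * of_real pi * \<i> * Ln (1 + c * 0))) (circlepath 0 1)"
    by (rule Cauchy_integral_circlepath_simple) simp
  then have "((\<lambda>t. \<i> * Ln (1 + c * cis t)) has_integral 0) {0..2 * pi}"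
    unfolding circlepath_def by (subst (asm) has_contour_integral_part_circlepath_iff) (simp_all add: mult.commute)
  from has_integral_linear[OF this bounded_linear_Im]
  have "((\<lambda>t. Re (Ln (1 + c * cis t))) has_integral 0) {0..2 * pi}" by (simp add: o_def)
  then show ?thesis
  proof (rule has_integral_eq[rotated])
    fix t :: real
    have "1 + c * cis t \<noteq> 0" using nz[of "cis t"] by auto
    then show "Re (Ln (1 + c * cis t)) = ln (norm (1 + c * cis t))" by (rule Re_Ln)
  qed
qed

text \<open>
  For \<open>\<bar>c\<bar> > 1\<close>, conjugation reduces to the parameter \<open>cnj (1/c)\<close>: on the unit circle,
  \<open>\<bar>1 + c u\<bar> = \<bar>c\<bar> \<bar>1 + cnj (1/c) u\<bar>\<close>.
\<close>

lemma ln_norm_has_integral: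
  assumes c: "norm c \<noteq> 1"
  shows "((\<lambda>t. ln (norm (1 + c * cis t))) has_integral 2 * pi * log_plus (norm c)) {0..2 * pi}"
proof (cases "norm c < 1")
  case True
  then have "log_plus (norm c) = 0"
    by (cases "c = 0") (auto simp: log_plus_def max_def)
  then show ?thesis using ln_norm_has_integral_less[OF True] by simp
next
  case False
  then have c1: "norm c > 1" using c by simp
  define d where "d = cnj (1 / c)"
  have d: "norm d < 1" using c1 by (auto simp: d_def norm_divide divide_less_eq)
  have "norm (1 + c * cis t) = norm c * norm (1 + d * cis t)" for t
  proof -
    have "norm (1 + d * cis t) = norm (cnj (1 + d * cis t) * cis t)"
      by (simp add: norm_mult del: complex_cnj_add)
    also have "cnj (1 + d * cis t) * cis t = cis t + 1 / c"
      by (simp add: d_def algebra_simps cis_cnj cis_mult)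
    finally have "norm c * norm (1 + d * cis t) = norm (c * (cis t + 1 / c))"
      by (simp add: norm_mult)
    also have "c * (cis t + 1 / c) = 1 + c * cis t" using c1 by (auto simp: field_simps)
    finally show ?thesis ..
  qed
  moreover have "norm (1 + d * cis t) \<noteq> 0" for t
  proof
    assume "norm (1 + d * cis t) = 0"
    then have "d * cis t = - 1" by (simp add: add_eq_0_iff)
    then have "norm (d * cis t) = 1" by simp
    then show False using d by (simp add: norm_mult)
  qed
  ultimately have eq: "ln (norm (1 + c * cis t)) = ln (norm c) + ln (norm (1 + d * cis t))" for t
    using c1 ln_mult[of "norm c" "norm (1 + d * cis t)"] by auto
  have "((\<lambda>t. ln (norm c) + ln (norm (1 + d * cis t))) has_integral (2 * pi * ln (norm c) + 0)) {0..2 * pi}"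
    using has_integral_const_real[of "ln (norm c)" 0 "2 * pi"]
    by (intro has_integral_add ln_norm_has_integral_less d) simp
  moreover have "log_plus (norm c) = ln (norm c)" using c1 by (simp add: log_plus_def)
  ultimately show ?thesis unfolding eq by simp
qed

text \<open>
  Lebesgue measure on the circle of angles, of total mass \<open>2 \<pi>\<close>, but on all of the reals so that
  measurability questions are those of Borel functions.
\<close>

definition torus :: "real measure"
  where "torus = density lborel (\<lambda>t. indicator {0..2 * pi} t)"

lemma sets_torus[measurable_cong]: "sets torus = sets borel"
  by (simp add: torus_def)

lemma space_torus[simp]: "space torus = UNIV"
  by (simp add: torus_def)

lemma nn_integral_torus:
  assumes [measurable]: "f \<in> borel_measurable borel"
  shows "(\<integral>\<^sup>+t. f t \<partial>torus) = (\<integral>\<^sup>+t. f t * indicator {0..2 * pi} t \<partial>lborel)"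
  unfolding torus_def by (subst nn_integral_density) (auto simp: mult.commute)

lemma AE_torus: "(AE t in lborel. P t) \<Longrightarrow> AE t in torus. P t"
  unfolding torus_def by (subst AE_density) auto

lemma emeasure_torus: "emeasure torus UNIV = ennreal (2 * pi)"
  using nn_integral_torus[of "\<lambda>_. 1"] by (simp add: nn_integral_const)

interpretation torus: finite_measure torus
  by standard (simp add: emeasure_torus)

lemma ln_norm_le: "ln (norm (1 + c * cis t)) \<le> ln (1 + norm c)"
proof (cases "1 + c * cis t = 0")
  case False
  have "norm (1 + c * cis t) \<le> 1 + norm c"
    using norm_triangle_ineq[of 1 "c * cis t"] by (simp add: norm_mult)
  then show ?thesis using False by (subst ln_le_cancel_iff) (auto simp: add_pos_nonneg)
qed simp

lemma log_plus_le: "x \<ge> 0 \<Longrightarrow> log_plus x \<le> ln (1 + x)"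
  by (cases "x = 0") (auto simp: log_plus_def)

lemma norm_affine_measurable: "(\<lambda>t. norm (1 + c * cis t)) \<in> borel_measurable borel"
  by (intro borel_measurable_continuous_onI continuous_intros)

lemma jensen_shift:
  assumes J: "(\<integral>\<^sup>+t. ennreal (ln (1 + norm c) - ln (norm (1 + c * cis t))) \<partial>torus) =
      ennreal (2 * pi * (ln (1 + norm c) - log_plus (norm c)))"
    and k: "k \<ge> 0"
  shows "(\<integral>\<^sup>+t. ennreal (k + ln (1 + norm c) - ln (norm (1 + c * cis t))) \<partial>torus) =
      ennreal (2 * pi * (k + ln (1 + norm c) - log_plus (norm c)))"
proof -
  have "(\<integral>\<^sup>+t. ennreal (k + ln (1 + norm c) - ln (norm (1 + c * cis t))) \<partial>torus) =
      (\<integral>\<^sup>+t. ennreal k + ennreal (ln (1 + norm c) - ln (norm (1 + c * cis t))) \<partial>torus)"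
    by (rule nn_integral_cong) (use k ln_norm_le[of c] in \<open>simp add: add_diff_eq flip: ennreal_plus\<close>)
  also have "\<dots> = ennreal k * ennreal (2 * pi) + ennreal (2 * pi * (ln (1 + norm c) - log_plus (norm c)))"
    using norm_affine_measurable[of c]
    by (subst nn_integral_add) (auto simp: J emeasure_torus measurable_cong_sets[OF sets_torus refl])
  also have "\<dots> = ennreal (k * (2 * pi) + 2 * pi * (ln (1 + norm c) - log_plus (norm c)))"
    using k log_plus_le[of "norm c"] by (subst ennreal_plus) (auto simp: ennreal_mult)
  finally show ?thesis by (simp add: algebra_simps)
qed

text \<open>
  Jensen's formula is stated for the nonnegative function \<open>ln (1 + \<bar>c\<bar>) - ln \<bar>1 + c u\<bar>\<close>, so
  that Tonelli's theorem applies later without a separate proof of integrability.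
\<close>

lemma jensen_generic:
  assumes c: "norm c \<noteq> 1"
  shows "(\<integral>\<^sup>+t. ennreal (ln (1 + norm c) - ln (norm (1 + c * cis t))) \<partial>torus) =
    ennreal (2 * pi * (ln (1 + norm c) - log_plus (norm c)))"
proof -
  have "((\<lambda>t. ln (1 + norm c) - ln (norm (1 + c * cis t))) has_integral
      (2 * pi * ln (1 + norm c) - 2 * pi * log_plus (norm c))) {0..2 * pi}"
    using has_integral_const_real[of "ln (1 + norm c)" 0 "2 * pi"]
    by (intro has_integral_diff ln_norm_has_integral c) simp
  then have "((\<lambda>t. ln (1 + norm c) - ln (norm (1 + c * cis t))) has_integral
      (2 * pi * (ln (1 + norm c) - log_plus (norm c)))) {0..2 * pi}"
    by (simp add: algebra_simps)
  then show ?thesis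
    using ln_norm_le[of c] by (subst nn_integral_torus) (auto intro!: nn_integral_has_integral_lebesgue' simp: cis_conv_exp)
qed

text \<open>
  On the unit circle the logarithm is unbounded. The parameters \<open>r c\<close> with r increasing to 1 are
  covered by the previous case, and \<open>\<bar>1 + w\<bar> \<le> 2 \<bar>1 + r w\<bar>\<close> for \<open>\<bar>w\<bar> = 1\<close> bounds the integrands by
  \<open>ln 2\<close> plus the limit function. That function is integrable by Fatou's lemma, so
  dominated convergence applies.
\<close>

lemma jensen_unit:
  assumes c: "norm c = 1"
  shows "(\<integral>\<^sup>+t. ennreal (ln 2 - ln (norm (1 + c * cis t))) \<partial>torus) = ennreal (2 * pi * ln 2)"
proof -
  define r where "r = (\<lambda>n :: nat. 1 - 1 / (real n + 2))"
  have r: "0 < r n" "r n < 1" for n by (simp_all add: r_def field_simps)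
  have r_lim: "r \<longlonglongrightarrow> 1" unfolding r_def by real_asymp
  define u where "u = (\<lambda>n t. ennreal (ln 2 - ln (norm (1 + r n * c * cis t))))"
  define v where "v = (\<lambda>t. ennreal (ln 2 - ln (norm (1 + c * cis t))))"
  have m[measurable]: "u n \<in> borel_measurable torus" "v \<in> borel_measurable torus" for n
    using norm_affine_measurable[of "r n * c"] norm_affine_measurable[of c]
    unfolding u_def v_def measurable_cong_sets[OF sets_torus refl] by measurable
  have norm_rc: "norm (r n * c) = r n" for n using r[of n] c by (simp add: norm_mult)
  have u_int: "(\<integral>\<^sup>+t. u n t \<partial>torus) = ennreal (2 * pi * ln 2)" for n
  proof -
    have n1: "norm (r n * c) \<noteq> 1" using norm_rc[of n] r[of n] by simp
    have lp: "log_plus (r n) = 0" using r[of n] by (simp add: log_plus_def)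
    have "0 \<le> ln 2 - ln (1 + r n)" using r[of n] by simp
    from jensen_shift[OF jensen_generic[OF n1] this, unfolded norm_rc lp]
    show ?thesis by (simp add: u_def)
  qed
  have AE0: "AE t in torus. 1 + c * cis t \<noteq> 0" by (rule AE_torus[OF AE_nonzero])
  have lim: "(\<lambda>n. u n t) \<longlonglongrightarrow> v t" if "1 + c * cis t \<noteq> 0" for t
  proof -
    have "(\<lambda>n. norm (1 + of_real (r n) * c * cis t)) \<longlonglongrightarrow> norm (1 + of_real 1 * c * cis t)"
      by (intro tendsto_intros r_lim)
    then have "(\<lambda>n. ln 2 - ln (norm (1 + of_real (r n) * c * cis t))) \<longlonglongrightarrow> ln 2 - ln (norm (1 + c * cis t))"
      using that by (intro tendsto_diff tendsto_const tendsto_ln) simp_all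
    then show ?thesis unfolding u_def v_def by (rule tendsto_ennrealI)
  qed
  have bound: "u n t \<le> ennreal (ln 2) + v t" if "1 + c * cis t \<noteq> 0" for n t
  proof -
    (* The triangle inequality for 1 + w = (1 + r w) + (1 - r) w, and 1 - r \<le> |1 + r w|. *)
    let ?w = "c * cis t"
    have w: "norm ?w = 1" using c by (simp add: norm_mult)
    have "norm ((1 - r n) *\<^sub>R ?w) = 1 - r n"
      unfolding norm_scaleR w using r[of n] by simp
    moreover have "1 + ?w = (1 + r n * ?w) + (1 - r n) *\<^sub>R ?w"
      by (simp add: scaleR_conv_of_real algebra_simps)
    ultimately have 1: "norm (1 + ?w) \<le> norm (1 + r n * ?w) + (1 - r n)"
      by (metis norm_triangle_ineq)
    have 2: "1 - r n \<le> norm (1 + r n * ?w)"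
      using norm_triangle_ineq2[of 1 "- (r n * ?w)"] r[of n] c by (simp add: norm_mult)
    have "norm (1 + ?w) / 2 \<le> norm (1 + r n * ?w)" using 1 2 by simp
    moreover have "norm (1 + ?w) > 0" using that by simp
    ultimately have "ln (norm (1 + ?w) / 2) \<le> ln (norm (1 + r n * ?w))" by (subst ln_le_cancel_iff) auto
    then have "ln 2 - ln (norm (1 + r n * ?w)) \<le> ln 2 + (ln 2 - ln (norm (1 + ?w)))"
      using that by (simp add: ln_div)
    moreover have "ln (norm (1 + ?w)) \<le> ln 2"
      using ln_norm_le[of c t] c by simp
    ultimately show ?thesis unfolding u_def v_def
      by (subst ennreal_plus[symmetric]) (auto simp: mult.assoc intro!: ennreal_leI)
  qed
  have v_fin: "(\<integral>\<^sup>+t. v t \<partial>torus) \<le> ennreal (2 * pi * ln 2)"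
  proof -
    have "(\<integral>\<^sup>+t. v t \<partial>torus) = (\<integral>\<^sup>+t. liminf (\<lambda>n. u n t) \<partial>torus)"
    proof (rule nn_integral_cong_AE)
      show "AE t in torus. v t = liminf (\<lambda>n. u n t)"
        using AE0 by eventually_elim (use lim in \<open>metis lim_imp_Liminf sequentially_bot\<close>)
    qed
    also have "\<dots> \<le> liminf (\<lambda>n. \<integral>\<^sup>+t. u n t \<partial>torus)" by (rule nn_integral_liminf) measurable
    also have "\<dots> = ennreal (2 * pi * ln 2)" unfolding u_int by (simp add: Liminf_const)
    finally show ?thesis .
  qed
  have "(\<lambda>n. \<integral>\<^sup>+t. u n t \<partial>torus) \<longlonglongrightarrow> (\<integral>\<^sup>+t. v t \<partial>torus)"
  proof (rule nn_integral_dominated_convergence[where w = "\<lambda>t. ennreal (ln 2) + v t"])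
    have "(\<integral>\<^sup>+t. ennreal (ln 2) + v t \<partial>torus) = ennreal (ln 2) * ennreal (2 * pi) + (\<integral>\<^sup>+t. v t \<partial>torus)"
      by (subst nn_integral_add) (auto simp: emeasure_torus)
    also have "\<dots> < \<infinity>"
      using v_fin by (auto simp: ennreal_mult_eq_top_iff less_top[symmetric] top_unique)
    finally show "(\<integral>\<^sup>+t. ennreal (ln 2) + v t \<partial>torus) < \<infinity>" .
    show "AE t in torus. u n t \<le> ennreal (ln 2) + v t" for n
      using AE0 by eventually_elim (rule bound)
    show "AE t in torus. (\<lambda>n. u n t) \<longlonglongrightarrow> v t"
      using AE0 by eventually_elim (rule lim)
  qed measurable
  then show ?thesis unfolding u_int v_def by (metis LIMSEQ_unique tendsto_const)
qed

lemma jensen: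
  shows "(\<integral>\<^sup>+t. ennreal (ln (1 + norm c) - ln (norm (1 + c * cis t))) \<partial>torus) =
    ennreal (2 * pi * (ln (1 + norm c) - log_plus (norm c)))"
proof (cases "norm c = 1")
  case True
  then show ?thesis using jensen_unit[OF True] by (simp add: log_plus_def)
qed (rule jensen_generic)

lemma jensen_affine:
  assumes A: "A \<noteq> 0" and C: "norm A + norm B \<le> exp C" "C \<ge> 0"
  shows "(\<integral>\<^sup>+t. ennreal (C - ln (norm (A + B * cis t))) \<partial>torus) =
      ennreal (2 * pi * (C - ln (norm A) - log_plus (norm B / norm A)))"
    and "0 \<le> C - ln (norm A) - log_plus (norm B / norm A)"
proof -
  define c where "c = B / A"
  define k where "k = C - ln (norm A) - ln (1 + norm c)"
  have k: "0 \<le> k"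
  proof -
    have "norm A + norm B = norm A * (1 + norm c)" using A by (simp add: c_def norm_divide field_simps)
    moreover have "ln (norm A + norm B) \<le> C"
      using C(1) A by (metis add_pos_nonneg ln_exp ln_mono norm_ge_zero zero_less_norm_iff)
    moreover have "1 + norm c > 0" by (simp add: add_pos_nonneg)
    ultimately show ?thesis
      using A by (simp add: k_def ln_mult)
  qed
  have "(\<integral>\<^sup>+t. ennreal (C - ln (norm (A + B * cis t))) \<partial>torus) =
      (\<integral>\<^sup>+t. ennreal (k + ln (1 + norm c) - ln (norm (1 + c * cis t))) \<partial>torus)"
  proof (rule nn_integral_cong_AE)
    show "AE t in torus. ennreal (C - ln (norm (A + B * cis t))) =
        ennreal (k + ln (1 + norm c) - ln (norm (1 + c * cis t)))"
      using AE_torus[OF AE_nonzero[of c]]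
    proof eventually_elim
      case (elim t)
      have "A + B * cis t = A * (1 + c * cis t)" using A by (simp add: c_def field_simps)
      then have "ln (norm (A + B * cis t)) = ln (norm A) + ln (norm (1 + c * cis t))"
        using A elim by (simp add: norm_mult ln_mult)
      then show ?case by (simp add: k_def diff_diff_eq)
    qed
  qed
  then show "(\<integral>\<^sup>+t. ennreal (C - ln (norm (A + B * cis t))) \<partial>torus) =
      ennreal (2 * pi * (C - ln (norm A) - log_plus (norm B / norm A)))"
    unfolding jensen_shift[OF jensen k] by (simp add: k_def c_def norm_divide)
  show "0 \<le> C - ln (norm A) - log_plus (norm B / norm A)"
    using k log_plus_le[of "norm c"] by (simp add: k_def c_def norm_divide)
qed

section \<open>Evaluation of polynomials\<close>

definition mono_eval :: "(nat \<Rightarrow> complex) \<Rightarrow> (nat \<Rightarrow>\<^sub>0 nat) \<Rightarrow> complex"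
  where "mono_eval z m = (\<Prod>i\<in>Poly_Mapping.keys m. z i ^ Poly_Mapping.lookup m i)"

lemma mono_eval_superset:
  assumes "finite S" "Poly_Mapping.keys m \<subseteq> S"
  shows "mono_eval z m = (\<Prod>i\<in>S. z i ^ Poly_Mapping.lookup m i)"
  unfolding mono_eval_def
  by (rule prod.mono_neutral_left) (use assms in \<open>auto simp: in_keys_iff\<close>)

lemma mono_eval_add: "mono_eval z (m + n) = mono_eval z m * mono_eval z n"
proof -
  let ?S = "Poly_Mapping.keys m \<union> Poly_Mapping.keys n"
  have "mono_eval z (m + n) = (\<Prod>i\<in>?S. z i ^ Poly_Mapping.lookup (m + n) i)"
    by (rule mono_eval_superset) (use Poly_Mapping.keys_add[of m n] in auto)
  also have "\<dots> = (\<Prod>i\<in>?S. z i ^ Poly_Mapping.lookup m i) * (\<Prod>i\<in>?S. z i ^ Poly_Mapping.lookup n i)"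
    by (simp add: lookup_add power_add prod.distrib)
  also have "\<dots> = mono_eval z m * mono_eval z n"
    by (subst (1 2) mono_eval_superset[of ?S]) auto
  finally show ?thesis .
qed

lemma mpoly_eval_superset:
  assumes "finite S" "Poly_Mapping.keys P \<subseteq> S"
  shows "mpoly_eval P z = (\<Sum>m\<in>S. Poly_Mapping.lookup P m * mono_eval z m)"
  unfolding mpoly_eval_def mono_eval_def[symmetric]
  by (rule sum.mono_neutral_left) (use assms in \<open>auto simp: in_keys_iff\<close>)

lemma mpoly_eval_add: "mpoly_eval (P + Q) z = mpoly_eval P z + mpoly_eval Q z"
proof -
  let ?S = "Poly_Mapping.keys P \<union> Poly_Mapping.keys Q"
  have "mpoly_eval (P + Q) z = (\<Sum>m\<in>?S. Poly_Mapping.lookup (P + Q) m * mono_eval z m)"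
    by (rule mpoly_eval_superset) (use Poly_Mapping.keys_add[of P Q] in auto)
  also have "\<dots> = (\<Sum>m\<in>?S. Poly_Mapping.lookup P m * mono_eval z m) + (\<Sum>m\<in>?S. Poly_Mapping.lookup Q m * mono_eval z m)"
    by (simp add: lookup_add distrib_right sum.distrib)
  also have "\<dots> = mpoly_eval P z + mpoly_eval Q z"
    by (subst (1 2) mpoly_eval_superset[of ?S]) auto
  finally show ?thesis .
qed

lemma mpoly_eval_diff: "mpoly_eval (P - Q) z = mpoly_eval P z - mpoly_eval Q z"
  using mpoly_eval_add[of "P - Q" Q z] by simp

lemma mpoly_eval_single: "mpoly_eval (Poly_Mapping.single m c) z = c * mono_eval z m"
  by (simp add: mpoly_eval_superset[of "{m}"] lookup_single)

lemma mpoly_eval_0: "mpoly_eval 0 z = 0"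
  by (simp add: mpoly_eval_def)

lemma update_eq_add_single:
  assumes "a \<notin> Poly_Mapping.keys f"
  shows "Poly_Mapping.update a b f = f + Poly_Mapping.single a b"
  by (rule poly_mapping_eqI)
     (use assms in \<open>auto simp: lookup_update lookup_add lookup_single in_keys_iff when_def\<close>)

lemma mpoly_eval_single_mult:
  "mpoly_eval (Poly_Mapping.single m c * Q) z = c * mono_eval z m * mpoly_eval Q z"
proof (induction Q rule: update_induct)
  case (update f a b)
  then show ?case
    by (simp add: update_eq_add_single distrib_left mpoly_eval_add mult_single mpoly_eval_single mono_eval_add)
qed (simp add: mpoly_eval_0)

lemma mpoly_eval_mult: "mpoly_eval (P * Q) z = mpoly_eval P z * mpoly_eval Q z"
proof (induction P rule: update_induct)
  case (update f a b)
  then show ?case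
    by (simp add: update_eq_add_single distrib_right mpoly_eval_add mpoly_eval_single mpoly_eval_single_mult)
qed (simp add: mpoly_eval_0)

lemma mpoly_eval_Const: "mpoly_eval (Const c) z = c"
  by (simp add: Const_def mpoly_eval_single mono_eval_def)

lemma mpoly_eval_1: "mpoly_eval 1 z = 1"
  using mpoly_eval_Const[of 1 z] by (simp add: Const_def single_one)

lemma mpoly_eval_Var: "mpoly_eval (Var i) z = z i"
  by (simp add: Var_def mpoly_eval_single mono_eval_def)

lemmas mpoly_eval_simps =
  mpoly_eval_add mpoly_eval_diff mpoly_eval_mult mpoly_eval_Const mpoly_eval_1 mpoly_eval_Var

section \<open>The average over the torus\<close>

lemma borel_measurable_compose_4:
  fixes g :: "real \<Rightarrow> real \<Rightarrow> real \<Rightarrow> real \<Rightarrow> 'b :: topological_space"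
  assumes g: "(\<lambda>(x, y, z, t). g x y z t) \<in> borel_measurable (borel \<Otimes>\<^sub>M borel \<Otimes>\<^sub>M borel \<Otimes>\<^sub>M borel)"
    and "p \<in> borel_measurable M" "q \<in> borel_measurable M" "r \<in> borel_measurable M" "s \<in> borel_measurable M"
  shows "(\<lambda>w. g (p w) (q w) (r w) (s w)) \<in> borel_measurable M"
proof -
  have "(\<lambda>w. (p w, q w, r w, s w)) \<in> M \<rightarrow>\<^sub>M borel \<Otimes>\<^sub>M borel \<Otimes>\<^sub>M borel \<Otimes>\<^sub>M borel"
    using assms(2-) by measurable
  from measurable_compose[OF this g] show ?thesis by simp
qed

lemma nn_integral_PiM_4:
  fixes g :: "real \<Rightarrow> real \<Rightarrow> real \<Rightarrow> real \<Rightarrow> ennreal"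
  assumes g[measurable]: "(\<lambda>(x, y, z, t). g x y z t) \<in> borel_measurable (borel \<Otimes>\<^sub>M borel \<Otimes>\<^sub>M borel \<Otimes>\<^sub>M borel)"
  shows "(\<integral>\<^sup>+\<theta>. g (\<theta> 0) (\<theta> 1) (\<theta> 2) (\<theta> 3) \<partial>Pi\<^sub>M {..<4 :: nat} (\<lambda>_. lborel)) =
    (\<integral>\<^sup>+x. \<integral>\<^sup>+y. \<integral>\<^sup>+z. \<integral>\<^sup>+t. g x y z t \<partial>lborel \<partial>lborel \<partial>lborel \<partial>lborel)"
proof -
  interpret product_sigma_finite "\<lambda>_ :: nat. lborel :: real measure" ..
  note gm = borel_measurable_compose_4[OF g]
  have comp: "(\<lambda>\<theta>. \<theta> i) \<in> borel_measurable (Pi\<^sub>M I (\<lambda>_ :: nat. lborel :: real measure))" if "i \<in> I" for i I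
    using measurable_component_singleton[OF that, of "\<lambda>_. lborel"] by simp
  have set: "{..<4 :: nat} = insert 0 (insert 1 (insert 2 (insert 3 {})))" by auto
  have "(\<integral>\<^sup>+\<theta>. g (\<theta> 0) (\<theta> 1) (\<theta> 2) (\<theta> 3) \<partial>Pi\<^sub>M {..<4 :: nat} (\<lambda>_. lborel)) =
      (\<integral>\<^sup>+x. \<integral>\<^sup>+\<theta>. g x (\<theta> 1) (\<theta> 2) (\<theta> 3) \<partial>Pi\<^sub>M (insert (1 :: nat) (insert 2 (insert 3 {}))) (\<lambda>_. lborel) \<partial>lborel)"
    unfolding set by (subst product_nn_integral_insert_rev) (auto intro!: gm comp simp del: One_nat_def)
  also have "\<dots> = (\<integral>\<^sup>+x. \<integral>\<^sup>+y. \<integral>\<^sup>+\<theta>. g x y (\<theta> 2) (\<theta> 3) \<partial>Pi\<^sub>M (insert (2 :: nat) (insert 3 {})) (\<lambda>_. lborel) \<partial>lborel \<partial>lborel)"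
    by (subst product_nn_integral_insert_rev) (auto intro!: gm comp simp del: One_nat_def)
  also have "\<dots> = (\<integral>\<^sup>+x. \<integral>\<^sup>+y. \<integral>\<^sup>+z. \<integral>\<^sup>+\<theta>. g x y z (\<theta> 3) \<partial>Pi\<^sub>M (insert (3 :: nat) {}) (\<lambda>_. lborel) \<partial>lborel \<partial>lborel \<partial>lborel)"
    by (subst product_nn_integral_insert_rev) (auto intro!: gm comp simp del: One_nat_def)
  also have "\<dots> = (\<integral>\<^sup>+x. \<integral>\<^sup>+y. \<integral>\<^sup>+z. \<integral>\<^sup>+t. g x y z t \<partial>lborel \<partial>lborel \<partial>lborel \<partial>lborel)"
    by (subst product_nn_integral_insert_rev) (auto intro!: gm comp simp: PiM_empty simp del: One_nat_def)
  finally show ?thesis .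
qed

lemma nn_integral_box_4:
  fixes f :: "real \<Rightarrow> real \<Rightarrow> real \<Rightarrow> real \<Rightarrow> ennreal"
  assumes f[measurable]: "(\<lambda>(x, y, z, t). f x y z t) \<in> borel_measurable (borel \<Otimes>\<^sub>M borel \<Otimes>\<^sub>M borel \<Otimes>\<^sub>M borel)"
  shows "(\<integral>\<^sup>+\<theta>. f (\<theta> 0) (\<theta> 1) (\<theta> 2) (\<theta> 3) * indicator (PiE {..<4} (\<lambda>_. {0..2 * pi})) \<theta>
      \<partial>Pi\<^sub>M {..<4 :: nat} (\<lambda>_. lborel)) =
    (\<integral>\<^sup>+x. \<integral>\<^sup>+y. \<integral>\<^sup>+z. \<integral>\<^sup>+t. f x y z t \<partial>torus \<partial>torus \<partial>torus \<partial>torus)"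
proof -
  let ?box = "\<lambda>\<theta>. indicator (PiE {..<4} (\<lambda>_. {0..2 * pi})) \<theta> :: ennreal"
  let ?i = "\<lambda>t. indicator {0..2 * pi} t :: ennreal"
  define g where "g = (\<lambda>x y z t. f x y z t * ?i t * ?i z * ?i y * ?i x)"
  note fm = borel_measurable_compose_4[OF f]
  have g: "(\<lambda>(x, y, z, t). g x y z t) \<in> borel_measurable (borel \<Otimes>\<^sub>M borel \<Otimes>\<^sub>M borel \<Otimes>\<^sub>M borel)"
    unfolding g_def case_prod_unfold
    by (intro borel_measurable_times_ennreal fm) measurable
  define F where "F = (\<lambda>(x, y, z, t). f x y z t)"
  have F[measurable]: "F \<in> borel_measurable (borel \<Otimes>\<^sub>M borel \<Otimes>\<^sub>M borel \<Otimes>\<^sub>M borel)"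
    using f by (simp add: F_def)
  have n3: "(\<lambda>z. \<integral>\<^sup>+t. F (x, y, z, t) * ?i t \<partial>lborel) \<in> borel_measurable borel" for x y
    by measurable
  have n2: "(\<lambda>y. \<integral>\<^sup>+z. (\<integral>\<^sup>+t. F (x, y, z, t) * ?i t \<partial>lborel) * ?i z \<partial>lborel) \<in> borel_measurable borel" for x
    by measurable
  have n1: "(\<lambda>x. \<integral>\<^sup>+y. (\<integral>\<^sup>+z. (\<integral>\<^sup>+t. F (x, y, z, t) * ?i t \<partial>lborel) * ?i z \<partial>lborel) * ?i y \<partial>lborel) \<in> borel_measurable borel"
    by measurable
  have n2': "(\<lambda>y. (\<integral>\<^sup>+z. (\<integral>\<^sup>+t. F (x, y, z, t) * ?i t \<partial>lborel) * ?i z \<partial>lborel) * ?i y) \<in> borel_measurable lborel" for x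
    by measurable
  note n' = n2'[unfolded F_def prod.case]
  note n = n1 n2 n3
  note n = n[unfolded F_def prod.case]
  have "(\<integral>\<^sup>+\<theta>. f (\<theta> 0) (\<theta> 1) (\<theta> 2) (\<theta> 3) * ?box \<theta>
      \<partial>Pi\<^sub>M {..<4 :: nat} (\<lambda>_. lborel)) =
      (\<integral>\<^sup>+\<theta>. g (\<theta> 0) (\<theta> 1) (\<theta> 2) (\<theta> 3) \<partial>Pi\<^sub>M {..<4 :: nat} (\<lambda>_. lborel))"
  proof (rule nn_integral_cong)
    fix \<theta> assume "\<theta> \<in> space (Pi\<^sub>M {..<4 :: nat} (\<lambda>_. lborel :: real measure))"
    then have "\<theta> \<in> extensional {..<4}" by (simp add: space_PiM PiE_def)
    moreover have "(\<forall>i<4 :: nat. \<theta> i \<in> {0..2 * pi}) \<longleftrightarrow>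
        \<theta> 0 \<in> {0..2 * pi} \<and> \<theta> 1 \<in> {0..2 * pi} \<and> \<theta> 2 \<in> {0..2 * pi} \<and> \<theta> 3 \<in> {0..2 * pi}"
    proof -
      have *: "i < 4 \<longleftrightarrow> i = 0 \<or> i = 1 \<or> i = 2 \<or> i = 3" for i :: nat by auto
      show ?thesis unfolding * by (simp only: all_simps imp_disjL all_conj_distrib simp_thms)
    qed
    ultimately have "\<theta> \<in> PiE {..<4} (\<lambda>_. {0..2 * pi}) \<longleftrightarrow>
        \<theta> 0 \<in> {0..2 * pi} \<and> \<theta> 1 \<in> {0..2 * pi} \<and> \<theta> 2 \<in> {0..2 * pi} \<and> \<theta> 3 \<in> {0..2 * pi}"
      by (simp only: PiE_def Pi_def Int_iff mem_Collect_eq lessThan_iff) auto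
    then have "?box \<theta> = ?i (\<theta> 3) * ?i (\<theta> 2) * ?i (\<theta> 1) * ?i (\<theta> 0)"
      unfolding indicator_def
      by (cases "\<theta> 0 \<in> {0..2 * pi}"; cases "\<theta> 1 \<in> {0..2 * pi}"; cases "\<theta> 2 \<in> {0..2 * pi}"; cases "\<theta> 3 \<in> {0..2 * pi}")
         (simp_all only: simp_thms of_bool_eq mult_1_left mult_1_right mult_zero_left mult_zero_right if_True if_False)
    then show "f (\<theta> 0) (\<theta> 1) (\<theta> 2) (\<theta> 3) * ?box \<theta> =
        g (\<theta> 0) (\<theta> 1) (\<theta> 2) (\<theta> 3)"
      unfolding g_def by (simp only: mult.assoc)
  qed
  also have "\<dots> = (\<integral>\<^sup>+x. \<integral>\<^sup>+y. \<integral>\<^sup>+z. \<integral>\<^sup>+t. g x y z t \<partial>lborel \<partial>lborel \<partial>lborel \<partial>lborel)"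
    by (rule nn_integral_PiM_4[OF g])
  also have "\<dots> = (\<integral>\<^sup>+x. (\<integral>\<^sup>+y. (\<integral>\<^sup>+z. (\<integral>\<^sup>+t. f x y z t * ?i t \<partial>lborel) * ?i z \<partial>lborel) * ?i y \<partial>lborel) * ?i x \<partial>lborel)"
    unfolding g_def
    by (simp add: nn_integral_multc fm n) (simp add: nn_integral_multc[OF n'])
  also have "\<dots> = (\<integral>\<^sup>+x. \<integral>\<^sup>+y. \<integral>\<^sup>+z. \<integral>\<^sup>+t. f x y z t \<partial>torus \<partial>torus \<partial>torus \<partial>torus)"
    by (simp add: nn_integral_torus fm n)
  finally show ?thesis .
qed

lemma norm_one_plus_cis: "norm (1 + cis x) = 2 * \<bar>cos (x / 2)\<bar>"
  and norm_one_minus_cis: "norm (1 - cis x) = 2 * \<bar>sin (x / 2)\<bar>"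
proof -
  have 1: "1 + cis (2 * y) = of_real (2 * cos y) * cis y" for y
    by (auto simp: complex_eq_iff cos_double_cos sin_double power2_eq_square)
  have 2: "1 - cis (2 * y) = of_real (2 * sin y) * (- \<i> * cis y)" for y
    by (auto simp: complex_eq_iff cos_double_sin sin_double power2_eq_square)
  from 1[of "x / 2"] 2[of "x / 2"] show "norm (1 + cis x) = 2 * \<bar>cos (x / 2)\<bar>" "norm (1 - cis x) = 2 * \<bar>sin (x / 2)\<bar>"
    by (simp_all add: norm_mult)
qed

lemma tan_half_eq: "norm (1 - cis x) / norm (1 + cis x) = tan_half x"
  by (simp add: norm_one_plus_cis norm_one_minus_cis tan_half_def tan_def)

lemma norm_cis_le: "norm (1 + cis u) \<le> 2" "norm (1 - cis u) \<le> 2"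
  using norm_triangle_ineq[of 1 "cis u"] norm_triangle_ineq4[of 1 "cis u"] by simp_all

text \<open>
  The shift by \<open>ln 2\<close>, the maximum of \<open>ln \<bar>1 + e\<^sup>i\<^sup>x\<bar>\<close>, makes the function nonnegative almost
  everywhere.
\<close>

definition log_defect :: "real \<Rightarrow> real"
  where "log_defect x = ln 2 - ln (norm (1 + cis x))"

lemma log_defect_nonneg: "1 + cis x \<noteq> 0 \<Longrightarrow> 0 \<le> log_defect x"
  unfolding log_defect_def using norm_triangle_ineq[of 1 "cis x"] by (subst diff_ge_0_iff_ge) (rule ln_mono, auto)

lemma norm_cis_measurable[measurable]: "(\<lambda>x. norm (1 + cis x)) \<in> borel_measurable borel"
  by (intro borel_measurable_continuous_onI continuous_intros)

lemma log_defect_measurable[measurable]: "log_defect \<in> borel_measurable borel"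
  unfolding log_defect_def[abs_def] by measurable

lemma AE_torus_nonzero: "AE x in torus. 1 + cis x \<noteq> 0"
  using AE_torus[OF AE_nonzero[of 1]] by simp

lemma nn_integral_log_defect:
  assumes "k \<ge> 0"
  shows "(\<integral>\<^sup>+x. ennreal (k + log_defect x) \<partial>torus) = ennreal (2 * pi * (k + ln 2))"
proof -
  have "(\<integral>\<^sup>+x. ennreal (k + log_defect x) \<partial>torus) = (\<integral>\<^sup>+x. ennreal k + ennreal (log_defect x) \<partial>torus)"
    by (rule nn_integral_cong_AE)
       (use AE_torus_nonzero in eventually_elim, use assms in \<open>simp add: log_defect_nonneg\<close>)
  also have "\<dots> = ennreal k * ennreal (2 * pi) + ennreal (2 * pi * ln 2)"
    using jensen_unit[of 1] by (subst nn_integral_add) (auto simp: emeasure_torus log_defect_def)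
  also have "\<dots> = ennreal (k * (2 * pi) + 2 * pi * ln 2)"
    using assms by (subst ennreal_plus) (auto simp: ennreal_mult)
  finally show ?thesis by (simp add: algebra_simps)
qed

definition torus_poly :: "real \<Rightarrow> real \<Rightarrow> real \<Rightarrow> real \<Rightarrow> real \<Rightarrow> complex"
  where "torus_poly a x y z t = (1 + cis x) * (1 + cis y) * (1 + cis z) +
    of_real a * (1 - cis x) * (1 - cis y) * (1 - cis z) * cis t"

lemma torus_poly_measurable[measurable]:
  "(\<lambda>(x, y, z, t). norm (torus_poly a x y z t)) \<in> borel_measurable (borel \<Otimes>\<^sub>M borel \<Otimes>\<^sub>M borel \<Otimes>\<^sub>M borel)"
proof -
  have "(\<lambda>(x, y, z, t). norm (torus_poly a x y z t)) \<in> borel_measurable borel"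
    unfolding torus_poly_def case_prod_unfold
    by (intro borel_measurable_continuous_onI continuous_intros)
  then show ?thesis by (simp add: borel_prod)
qed

text \<open>
  The constant C is an upper bound of \<open>ln \<bar>A\<bar> + log\<^sup>+ \<bar>B/A\<bar>\<close> and of \<open>ln \<bar>A + B y\<bar>\<close>. Moving the term with
  \<open>log\<^sup>+\<close> to the left avoids subtraction of extended reals; what remains is
  \<open>C - ln \<bar>A\<bar>\<close>, the sum of \<open>ln (1 + a)\<close> and the three defects, with mean value C.
\<close>

lemma quadruple_integral:
  assumes a: "a > 0"
  defines "C \<equiv> ln (8 + 8 * a)"
  shows "(\<integral>\<^sup>+x. \<integral>\<^sup>+y. \<integral>\<^sup>+z. \<integral>\<^sup>+t. ennreal (C - ln (norm (torus_poly a x y z t))) \<partial>torus \<partial>torus \<partial>torus \<partial>torus) +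
      ennreal (2 * pi) * (\<integral>\<^sup>+x. \<integral>\<^sup>+y. \<integral>\<^sup>+z. ennreal (log_plus (a * tan_half x * tan_half y * tan_half z)) \<partial>torus \<partial>torus \<partial>torus) =
    ennreal ((2 * pi) ^ 4 * C)"
proof -
  have C: "C = ln (1 + a) + 3 * ln 2"
  proof -
    have "C = ln ((1 + a) * 2 ^ 3)" by (simp add: C_def algebra_simps)
    also have "\<dots> = ln (1 + a) + 3 * ln 2" using a ln_realpow[of "2 :: real" 3] by (subst ln_mult) auto
    finally show ?thesis .
  qed
  have C0: "C \<ge> 0" "exp C = 8 + 8 * a" using a by (simp_all add: C_def)
  let ?G = "\<lambda>x y z. \<integral>\<^sup>+t. ennreal (C - ln (norm (torus_poly a x y z t))) \<partial>torus"
  let ?L = "\<lambda>x y z. ennreal (log_plus (a * tan_half x * tan_half y * tan_half z))"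
  let ?G1 = "\<lambda>x y. \<integral>\<^sup>+z. ?G x y z \<partial>torus" and ?L1 = "\<lambda>x y. \<integral>\<^sup>+z. ?L x y z \<partial>torus"
  have "(\<lambda>(x, y, z, t). ennreal (C - ln (norm (torus_poly a x y z t)))) \<in> borel_measurable (borel \<Otimes>\<^sub>M borel \<Otimes>\<^sub>M borel \<Otimes>\<^sub>M borel)"
    using torus_poly_measurable[of a] unfolding case_prod_unfold by measurable
  note Gm = borel_measurable_compose_4[OF this]
  have m3: "(\<lambda>z. ?G x y z) \<in> borel_measurable torus" for x y
    by (rule torus.borel_measurable_nn_integral) (auto simp: case_prod_unfold intro!: Gm, measurable)
  have m2: "(\<lambda>y. ?G1 x y) \<in> borel_measurable torus" for x
    by (intro torus.borel_measurable_nn_integral, simp add: case_prod_unfold,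
        intro torus.borel_measurable_nn_integral, simp add: case_prod_unfold)
       (intro Gm, measurable)
  have m1: "(\<lambda>x. \<integral>\<^sup>+y. ?G1 x y \<partial>torus) \<in> borel_measurable torus"
    by (intro torus.borel_measurable_nn_integral, simp add: case_prod_unfold,
        intro torus.borel_measurable_nn_integral, simp add: case_prod_unfold,
        intro torus.borel_measurable_nn_integral, simp add: case_prod_unfold)
       (intro Gm, measurable)
  have inner: "?G x y z + ennreal (2 * pi) * ?L x y z = ennreal (2 * pi) * ennreal ((ln (1 + a) + log_defect x + log_defect y) + log_defect z)"
    if nz: "1 + cis x \<noteq> 0" "1 + cis y \<noteq> 0" "1 + cis z \<noteq> 0" for x y z
  proof -
    define A where "A = (1 + cis x) * (1 + cis y) * (1 + cis z)"
    define B where "B = of_real a * (1 - cis x) * (1 - cis y) * (1 - cis z)"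
    have A: "A \<noteq> 0" using nz by (simp add: A_def)
    have "norm A \<le> 2 * 2 * 2" unfolding A_def norm_mult by (intro mult_mono norm_cis_le) auto
    moreover have "norm B \<le> a * 2 * 2 * 2" unfolding B_def norm_mult using a by (intro mult_mono norm_cis_le) auto
    ultimately have le: "norm A + norm B \<le> exp C" by (simp add: C0)
    have ratio: "norm B / norm A = a * tan_half x * tan_half y * tan_half z"
      unfolding tan_half_eq[symmetric] A_def B_def norm_mult using a by simp
    have lnA: "C - ln (norm A) = ln (1 + a) + log_defect x + log_defect y + log_defect z"
      using nz unfolding A_def norm_mult C log_defect_def by (simp add: ln_mult)
    have P: "torus_poly a x y z t = A + B * cis t" for t by (simp add: torus_poly_def A_def B_def)
    note J = jensen_affine[OF A le C0(1), unfolded ratio]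
    have "?G x y z + ennreal (2 * pi) * ?L x y z =
        ennreal (2 * pi * (C - ln (norm A) - log_plus (a * tan_half x * tan_half y * tan_half z))) + ennreal (2 * pi * log_plus (a * tan_half x * tan_half y * tan_half z))"
      unfolding P J(1) by (simp add: ennreal_mult log_plus_def)
    also have "\<dots> = ennreal (2 * pi * (C - ln (norm A) - log_plus (a * tan_half x * tan_half y * tan_half z)) + 2 * pi * log_plus (a * tan_half x * tan_half y * tan_half z))"
      using J(2) by (intro ennreal_plus[symmetric] mult_nonneg_nonneg) (auto simp: log_plus_def)
    also have "2 * pi * (C - ln (norm A) - log_plus (a * tan_half x * tan_half y * tan_half z)) + 2 * pi * log_plus (a * tan_half x * tan_half y * tan_half z)
        = 2 * pi * (ln (1 + a) + log_defect x + log_defect y + log_defect z)"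
      unfolding lnA[symmetric] by (simp add: algebra_simps)
    finally show ?thesis
      using a log_defect_nonneg[OF nz(1)] log_defect_nonneg[OF nz(2)] log_defect_nonneg[OF nz(3)]
      by (simp add: ennreal_mult)
  qed
  have em: "ennreal c * ennreal (d * X) = ennreal (c * d) * ennreal X" if "c \<ge> 0" "d \<ge> 0" "X \<ge> 0" for c d X
    using that by (simp add: ennreal_mult mult.assoc)
  have k0: "0 \<le> ln (1 + a)" "0 \<le> ln (2 :: real)" using a by simp_all
  have step1: "?G1 x y + ennreal (2 * pi) * ?L1 x y =
      ennreal ((2 * pi)^2) * ennreal ((ln (1 + a) + ln 2 + log_defect x) + log_defect y)"
    if nz: "1 + cis x \<noteq> 0" "1 + cis y \<noteq> 0" for x y
  proof -
    have k: "0 \<le> ln (1 + a) + log_defect x + log_defect y"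
      using k0 log_defect_nonneg[OF nz(1)] log_defect_nonneg[OF nz(2)] by simp
    have "?G1 x y + ennreal (2 * pi) * ?L1 x y =
        (\<integral>\<^sup>+z. ?G x y z + ennreal (2 * pi) * ?L x y z \<partial>torus)"
      by (subst nn_integral_add) (auto simp: nn_integral_cmult m3)
    also have "\<dots> = (\<integral>\<^sup>+z. ennreal (2 * pi) * ennreal ((ln (1 + a) + log_defect x + log_defect y) + log_defect z) \<partial>torus)"
      by (rule nn_integral_cong_AE) (use AE_torus_nonzero in eventually_elim, rule inner[OF nz])
    also have "\<dots> = ennreal (2 * pi) * ennreal (2 * pi * (ln (1 + a) + log_defect x + log_defect y + ln 2))"
      by (subst nn_integral_cmult) (auto simp: nn_integral_log_defect[OF k])
    also have "\<dots> = ennreal ((2 * pi)^2) * ennreal ((ln (1 + a) + ln 2 + log_defect x) + log_defect y)"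
    proof -
      have k': "0 \<le> ln (1 + a) + log_defect x + log_defect y + ln 2" using k k0(2) by linarith
      show ?thesis by (subst em[OF _ _ k']) (auto simp: power2_eq_square add_ac)
    qed
    finally show ?thesis .
  qed
  have step2: "(\<integral>\<^sup>+y. ?G1 x y \<partial>torus) + ennreal (2 * pi) * (\<integral>\<^sup>+y. ?L1 x y \<partial>torus) =
      ennreal ((2 * pi)^3) * ennreal ((ln (1 + a) + 2 * ln 2) + log_defect x)"
    if nz: "1 + cis x \<noteq> 0" for x
  proof -
    have k: "0 \<le> ln (1 + a) + ln 2 + log_defect x"
      using k0 log_defect_nonneg[OF nz] by simp
    have "(\<integral>\<^sup>+y. ?G1 x y \<partial>torus) + ennreal (2 * pi) * (\<integral>\<^sup>+y. ?L1 x y \<partial>torus) =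
        (\<integral>\<^sup>+y. ?G1 x y + ennreal (2 * pi) * ?L1 x y \<partial>torus)"
      by (subst nn_integral_add) (auto simp: nn_integral_cmult m2)
    also have "\<dots> = (\<integral>\<^sup>+y. ennreal ((2 * pi)^2) * ennreal ((ln (1 + a) + ln 2 + log_defect x) + log_defect y) \<partial>torus)"
      by (rule nn_integral_cong_AE) (use AE_torus_nonzero in eventually_elim, rule step1[OF nz])
    also have "\<dots> = ennreal ((2 * pi)^2) * ennreal (2 * pi * (ln (1 + a) + ln 2 + log_defect x + ln 2))"
      by (subst nn_integral_cmult) (auto simp: nn_integral_log_defect[OF k])
    also have "\<dots> = ennreal ((2 * pi)^2 * (2 * pi)) * ennreal ((ln (1 + a) + 2 * ln 2) + log_defect x)"
    proof -
      have k': "0 \<le> ln (1 + a) + ln 2 + log_defect x + ln 2" using k k0(2) by linarith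
      show ?thesis by (subst em[OF _ _ k']) (auto simp: add_ac)
    qed
    finally show ?thesis by (simp add: power2_eq_square power3_eq_cube mult_ac)
  qed
  have k: "0 \<le> ln (1 + a) + 2 * ln 2" using k0 by simp
  have "(\<integral>\<^sup>+x. \<integral>\<^sup>+y. ?G1 x y \<partial>torus \<partial>torus) + ennreal (2 * pi) * (\<integral>\<^sup>+x. \<integral>\<^sup>+y. ?L1 x y \<partial>torus \<partial>torus) =
      (\<integral>\<^sup>+x. (\<integral>\<^sup>+y. ?G1 x y \<partial>torus) + ennreal (2 * pi) * (\<integral>\<^sup>+y. ?L1 x y \<partial>torus) \<partial>torus)"
    by (subst nn_integral_add) (auto simp: nn_integral_cmult m1)
  also have "\<dots> = (\<integral>\<^sup>+x. ennreal ((2 * pi)^3) * ennreal ((ln (1 + a) + 2 * ln 2) + log_defect x) \<partial>torus)"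
    by (rule nn_integral_cong_AE) (use AE_torus_nonzero in eventually_elim, rule step2)
  also have "\<dots> = ennreal ((2 * pi)^3) * ennreal (2 * pi * (ln (1 + a) + 2 * ln 2 + ln 2))"
    by (subst nn_integral_cmult) (auto simp: nn_integral_log_defect[OF k])
  also have "\<dots> = ennreal ((2 * pi)^3 * (2 * pi * C))"
  proof -
    have e: "ln (1 + a) + 2 * ln 2 + ln 2 = C" by (simp add: C)
    show ?thesis unfolding e by (rule ennreal_mult[symmetric]) (use C0 in auto)
  qed
  also have "(2 * pi)^3 * (2 * pi * C) = (2 * pi)^4 * C"
    by (simp add: power3_eq_cube power4_eq_xxxx)
  finally show ?thesis .
qed

lemma triple_log_plus_torus:
  assumes "a > 0"
  shows "(\<integral>\<^sup>+x. \<integral>\<^sup>+y. \<integral>\<^sup>+z. ennreal (log_plus (a * tan_half x * tan_half y * tan_half z)) \<partial>torus \<partial>torus \<partial>torus) =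
    ennreal (64 * a) * (\<integral>\<^sup>+s. ennreal (Ti2 s * log_kernel a s) * indicator {0<..} s \<partial>lborel)"
  unfolding triple_log_plus[OF assms, symmetric] by (simp add: nn_integral_torus)

section \<open>The Mahler measure\<close>

text \<open>
  The integrals of C and of \<open>C - ln \<bar>P\<bar>\<close> are both finite and known, and their difference is the
  integral of \<open>ln \<bar>P\<bar>\<close>. As \<open>2 \<pi> \<cdot> 64 = 128 \<pi>\<close>, division by \<open>(2 \<pi>)\<^sup>4\<close> leaves \<open>8 a A / \<pi>\<^sup>3\<close>.
\<close>

lemma mahler_measure_torus_poly:
  assumes a: "a > 0"
    and P: "\<And>\<theta>. mpoly_eval P (\<lambda>j. cis (\<theta> j)) = torus_poly a (\<theta> 0) (\<theta> 1) (\<theta> 2) (\<theta> 3)"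
    and A: "(\<integral>\<^sup>+s. ennreal (Ti2 s * log_kernel a s) * indicator {0<..} s \<partial>lborel) = ennreal A" "0 \<le> A"
  shows "pi ^ 3 * mahler_measure 4 P = 8 * a * A"
proof -
  define C where "C = ln (8 + 8 * a)"
  define M where "M = Pi\<^sub>M {..<4 :: nat} (\<lambda>_. lborel :: real measure)"
  define box where "box = PiE {..<4 :: nat} (\<lambda>_. {0..2 * pi})"
  define N where "N = (\<lambda>\<theta> :: nat \<Rightarrow> real. norm (torus_poly a (\<theta> 0) (\<theta> 1) (\<theta> 2) (\<theta> 3)))"
  have box[measurable]: "box \<in> sets M"
    unfolding box_def M_def by (rule sets_PiM_I_finite) auto
  have c: "(\<lambda>\<theta>. \<theta> i) \<in> borel_measurable M" if "i < 4" for i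
    using measurable_component_singleton[of i "{..<4}" "\<lambda>_. lborel"] that by (simp add: M_def)
  have N[measurable]: "N \<in> borel_measurable M"
    unfolding N_def by (rule borel_measurable_compose_4[OF torus_poly_measurable]) (auto intro!: c)
  have C0: "C \<ge> 0" using a by (simp add: C_def)
  have le: "ln (N \<theta>) \<le> C" for \<theta>
  proof (cases "N \<theta> = 0")
    case False
    have "N \<theta> \<le> norm ((1 + cis (\<theta> 0)) * (1 + cis (\<theta> 1)) * (1 + cis (\<theta> 2))) +
        norm (of_real a * (1 - cis (\<theta> 0)) * (1 - cis (\<theta> 1)) * (1 - cis (\<theta> 2)) * cis (\<theta> 3))"
      unfolding N_def torus_poly_def by (rule norm_triangle_ineq)
    also have "\<dots> \<le> 2 * 2 * 2 + a * 2 * 2 * 2 * 1"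
      unfolding norm_mult using a by (intro add_mono mult_mono norm_cis_le) auto
    finally have "N \<theta> \<le> 8 + 8 * a" by simp
    moreover have "N \<theta> > 0" using False by (simp add: N_def)
    ultimately show ?thesis unfolding C_def using a by (intro ln_mono) auto
  qed (use C0 in simp)
  have Cm: "(\<lambda>(x, y, z, t). ennreal (C - ln (norm (torus_poly a x y z t)))) \<in> borel_measurable (borel \<Otimes>\<^sub>M borel \<Otimes>\<^sub>M borel \<Otimes>\<^sub>M borel)"
    using torus_poly_measurable[of a] unfolding case_prod_unfold by measurable
  let ?N4 = "\<integral>\<^sup>+\<theta>. ennreal (C - ln (N \<theta>)) * indicator box \<theta> \<partial>M"
  have N4: "?N4 + ennreal (128 * pi * a * A) = ennreal ((2 * pi) ^ 4 * C)"
  proof -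
    have "ennreal (2 * pi) * (ennreal (64 * a) * ennreal A) = ennreal (128 * pi * a * A)"
      using a A(2) by (simp add: mult_ac flip: ennreal_mult)
    then show ?thesis
      using quadruple_integral[OF a, folded C_def]
      unfolding triple_log_plus_torus[OF a] A(1) nn_integral_box_4[OF Cm, symmetric] M_def box_def N_def by simp
  qed
  have le2: "128 * pi * a * A \<le> (2 * pi) ^ 4 * C"
  proof -
    have "ennreal (128 * pi * a * A) \<le> ennreal ((2 * pi) ^ 4 * C)"
      unfolding N4[symmetric] by simp
    then show ?thesis using C0 by (simp add: ennreal_le_iff)
  qed
  have "?N4 = ennreal ((2 * pi) ^ 4 * C) - ennreal (128 * pi * a * A)"
    unfolding N4[symmetric] by (simp add: ennreal_add_diff_cancel_right)
  then have N4': "?N4 = ennreal ((2 * pi) ^ 4 * C - 128 * pi * a * A)"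
    using a A(2) by (simp add: ennreal_minus)
  have vol: "(\<integral>\<^sup>+\<theta>. ennreal C * indicator box \<theta> \<partial>M) = ennreal ((2 * pi) ^ 4 * C)"
  proof -
    have "(\<integral>\<^sup>+\<theta>. ennreal C * indicator box \<theta> \<partial>M) =
        (\<integral>\<^sup>+x. \<integral>\<^sup>+y. \<integral>\<^sup>+z. \<integral>\<^sup>+t. ennreal C \<partial>torus \<partial>torus \<partial>torus \<partial>torus)"
      unfolding M_def box_def by (rule nn_integral_box_4[of "\<lambda>_ _ _ _. ennreal C"]) simp
    also have "\<dots> = ennreal ((2 * pi) ^ 4 * C)"
      using C0 by (simp add: emeasure_torus power4_eq_xxxx mult_ac flip: ennreal_mult)
    finally show ?thesis .
  qed
  define f where "f = (\<lambda>\<theta>. indicator box \<theta> * (C - ln (N \<theta>)))"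
  define h where "h = (\<lambda>\<theta>. indicator box \<theta> * C)"
  have fnn: "(\<integral>\<^sup>+\<theta>. ennreal (f \<theta>) \<partial>M) = ennreal ((2 * pi) ^ 4 * C - 128 * pi * a * A)"
    unfolding N4'[symmetric] by (rule nn_integral_cong) (auto simp: f_def split: split_indicator)
  have hnn: "(\<integral>\<^sup>+\<theta>. ennreal (h \<theta>) \<partial>M) = ennreal ((2 * pi) ^ 4 * C)"
    unfolding vol[symmetric] by (rule nn_integral_cong) (auto simp: h_def split: split_indicator)
  have pos: "0 \<le> f \<theta>" "0 \<le> h \<theta>" for \<theta>
    using le[of \<theta>] C0 by (auto simp: f_def h_def)
  have meas[measurable]: "f \<in> borel_measurable M" "h \<in> borel_measurable M"
    unfolding f_def h_def by measurable
  have fi: "has_bochner_integral M f ((2 * pi) ^ 4 * C - 128 * pi * a * A)"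
    by (rule has_bochner_integral_nn_integral) (use pos le2 fnn in auto)
  have hi: "has_bochner_integral M h ((2 * pi) ^ 4 * C)"
    by (rule has_bochner_integral_nn_integral) (use pos C0 hnn in auto)
  have "has_bochner_integral M (\<lambda>\<theta>. h \<theta> - f \<theta>) (128 * pi * a * A)"
    using has_bochner_integral_diff[OF hi fi] by simp
  moreover have "h \<theta> - f \<theta> = indicator box \<theta> *\<^sub>R ln (norm (mpoly_eval P (\<lambda>j. cis (\<theta> j))))" for \<theta>
    by (simp add: h_def f_def P N_def algebra_simps)
  ultimately have "set_lebesgue_integral M box (\<lambda>\<theta>. ln (norm (mpoly_eval P (\<lambda>j. cis (\<theta> j))))) = 128 * pi * a * A"
    unfolding set_lebesgue_integral_def by (simp add: has_bochner_integral_integral_eq)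
  then have "mahler_measure 4 P = 1 / (2 * pi) ^ 4 * (128 * pi * a * A)"
    unfolding mahler_measure_def M_def box_def by simp
  then show ?thesis
    by (simp add: power4_eq_xxxx power3_eq_cube)
qed

theorem theorem16:
  fixes a :: real and v w x y :: cmpoly
  assumes "a > 0"
    and "v = Var 0" and "w = Var 1" and "x = Var 2" and "y = Var 3"
  shows "complex_of_real (pi ^ 3 * mahler_measure 4
           ((1 + v) * (1 + w) * (1 + x)
             + Const (of_real a) * (1 - v) * (1 - w) * (1 - x) * y))
         = 4 * of_real pi * L1 a 3 1 - 2 * of_real pi * L1_log a 2 1
           - 2 * \<i> * (L2 a 2 2 \<i> 1 + L2_log a 2 1 \<i> 1)"
proof -
  note a = \<open>a > 0\<close>
  have b: "1 / a > 0" using a by simp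
  obtain A1 where A1: "((\<lambda>t. Ti2 t * log_kernel a t) has_integral A1) {0..1}"
    "S2 2 2 a \<i> 1 + of_real (ln a) * S2 2 1 a \<i> 1 = 4 * \<i> * of_real (a * A1)"
    using depth_two_real[OF a] by blast
  obtain A2 where A2: "((\<lambda>t. Ti2 t * log_kernel (1 / a) t) has_integral A2) {0..1}"
    "S2 2 2 (1 / a) \<i> 1 + of_real (ln (1 / a)) * S2 2 1 (1 / a) \<i> 1 = 4 * \<i> * of_real (1 / a * A2)"
    using depth_two_real[OF b] by blast
  obtain A3 where A3: "((\<lambda>t. - ln t * log_kernel (1 / a) t) has_integral A3) {0..1}"
    "2 * L1 a 3 1 - L1_log a 2 1 = of_real (2 / a * A3)"
    using depth_one_real[OF a] by blast
  define A where "A = A1 + (1 / a)\<^sup>2 * (A2 + pi / 2 * A3)"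
  have "L2 a 2 2 \<i> 1 + L2_log a 2 1 \<i> 1 = 4 * \<i> * of_real (a * A1) + 4 * \<i> * of_real (1 / a * A2)"
    unfolding A1(2)[symmetric] A2(2)[symmetric] L2_def L2_log_def by simp
  moreover have "4 * of_real pi * L1 a 3 1 - 2 * of_real pi * L1_log a 2 1 = of_real (2 * pi) * of_real (2 / a * A3)"
    unfolding A3(2)[symmetric] by (simp add: algebra_simps)
  ultimately have "4 * of_real pi * L1 a 3 1 - 2 * of_real pi * L1_log a 2 1
      - 2 * \<i> * (L2 a 2 2 \<i> 1 + L2_log a 2 1 \<i> 1) = of_real (2 * pi) * of_real (2 / a * A3) + 8 * of_real (a * A1) + 8 * of_real (1 / a * A2)"
    by (simp add: algebra_simps)
  also have "\<dots> = of_real (8 * a * A)"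
    using a by (simp add: A_def field_simps power2_eq_square)
  also have "8 * a * A = pi ^ 3 * mahler_measure 4
           ((1 + v) * (1 + w) * (1 + x)
             + Const (of_real a) * (1 - v) * (1 - w) * (1 - x) * y)"
    unfolding A_def
    by (rule mahler_measure_torus_poly[symmetric, OF a _ Ti2_log_kernel_nn_integral[OF a A1(1) A2(1) A3(1)]])
       (simp add: assms mpoly_eval_simps torus_poly_def)
  finally show ?thesis ..
qed

end
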